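(* Let $(\mathscr{C},\mathbf{W})$ satisfy conditions (BF). Let $A,B$ be objects, let $\underline f^m:=(A^m,w^m,f^m):A\to B$ for $m=1,2,3$ be morphisms and let $\Gamma^1:\underline f^1\Rightarrow\underline f^2$ and $\Gamma^2:\underline f^2\Rightarrow\underline f^3$ be 2-morphisms in $\mathscr{C}[\mathbf{W}^{-1}]$. Fix any representative $(A^4,u^1,u^2,\alpha^1,\beta^1)$ for $\Gamma^1$ and $(A^5,u^3,u^4,\alpha^2,\beta^2)$ for $\Gamma^2$ (so $u^1:A^4\to A^1$, $u^2:A^4\to A^2$, $u^3:A^5\to A^2$, $u^4:A^5\to A^3$). Fix any set of data in $\mathscr{C}$ as follows: (F4) an object $C$, a morphism $t^1:C\to A^4$ in $\mathbf{W}$, a morphism $t^2:C\to A^5$ and an invertible 2-morphism $\rho:u^2\circ t^1\Rightarrow u^3\circ t^2$. Then the vertical composition $\Gamma^2\circ\Gamma^1$ is represented by $(C,u^1\circ t^1,u^4\circ t^2,\xi,\gamma)$, where $$\xi:=(\alpha^2\circ t^2)\bullet(w^2\circ\rho)\bullet(\alpha^1\circ t^1),\qquad \gamma:=(\beta^2\circ t^2)\bullet(f^2\circ\rho)\bullet(\beta^1\circ t^1).$$ Given any other pair of representatives for $\Gamma^1$ and $\Gamma^2$, and any other set of data as in (F4), the quintuple induced by the new data represents the same 2-morphism.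
   Context: Conventions. $\mathscr{C}$ is a bicategory and $\mathbf{W}$ a class of 1-morphisms in it. $\circ$ denotes composition of 1-morphisms and whiskering; $\bullet$ denotes vertical composition of 2-morphisms of $\mathscr{C}$ ($\beta\bullet\alpha$ means first $\alpha$, then $\beta$). Associators and unitors of $\mathscr{C}$ are omitted from the notation, as if $\mathscr{C}$ were a 2-category (by coherence they can be inserted unambiguously); the statement is meant for arbitrary bicategories. Conditions (BF): (BF1) every $\mathrm{id}_A$ is in $\mathbf{W}$. (BF2) $\mathbf{W}$ is closed under composition. (BF3) For every $w:A\to B$ in $\mathbf{W}$ and every $f:C\to B$ there are an object $D$, $w':D\to C$ in $\mathbf{W}$, $f':D\to A$ and an invertible 2-morphism $f\circ w'\Rightarrow w\circ f'$. (BF4a) For every $w:B\to A$ in $\mathbf{W}$, $f^1,f^2:C\to B$ and $\alpha:w\circ f^1\Rightarrow w\circ f^2$ there are an object $D$, $v:D\to C$ in $\mathbf{W}$ and $\beta:f^1\circ v\Rightarrow f^2\circ v$ with $\alpha\circ v=w\circ\beta$. (BF4b) If $\alpha$ in (BF4a) is invertible, so is $\beta$. (BF4c) If $(D',v',\beta')$ is another triple with the same properties as $(D,v,\beta)$ in (BF4a), there are an object $E$, $u:E\to D$, $u':E\to D'$ and an invertible $\zeta:v\circ u\Rightarrow v'\circ u'$ with $v\circ u\in\mathbf{W}$ and $(\beta'\circ u')\bullet(f^1\circ\zeta)=(f^2\circ\zeta)\bullet(\beta\circ u)$. (BF5) If $w:A\to B$ is in $\mathbf{W}$ and there is an invertible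 $v\Rightarrow w$, then $v\in\mathbf{W}$. Choices. $\mathrm{C}(\mathbf{W})$: for every $f:A'\to B$ and $v:B'\to B$ in $\mathbf{W}$, a chosen $(A'',v',f',\rho)$ with $v':A''\to A'$ in $\mathbf{W}$, $f':A''\to B'$, $\rho:f\circ v'\Rightarrow v\circ f'$ invertible. $\mathrm{D}(\mathbf{W})$: for every $w:B\to A$ in $\mathbf{W}$, $f^1,f^2:C\to B$, $\alpha:w\circ f^1\Rightarrow w\circ f^2$, a chosen $v:D\to C$ in $\mathbf{W}$ and $\beta:f^1\circ v\Rightarrow f^2\circ v$ with $\alpha\circ v=w\circ\beta$. Bicategory of fractions $\mathscr{C}[\mathbf{W}^{-1}]$ (Pronk). Objects: those of $\mathscr{C}$. A morphism $A\to B$ is a triple $(A',w,f)$ with $w:A'\to A$ in $\mathbf{W}$, $f:A'\to B$. A 2-morphism $(A^1,w^1,f^1)\Rightarrow(A^2,w^2,f^2)$ (both $A\to B$) is an equivalence class of data (its representatives) $(A^3,v^1,v^2,\alpha,\beta)$ with $v^m:A^3\to A^m$, $w^1\circ v^1\in\mathbf{W}$, $\alpha:w^1\circ v^1\Rightarrow w^2\circ v^2$ invertible, $\beta:f^1\circ v^1\Rightarrow f^2\circ v^2$; $(A^3,v^1,v^2,\alpha,\beta)$ and $(A'^3,v'^1,v'^2,\alpha',\beta')$ are equivalent iff there are $z:A^4\to A^3$, $z':A^4\to A'^3$ and invertible $\sigma^1:v'^1\circ z'\Rightarrow v^1\circ z$, $\sigma^2:v^2\circ z\Rightarrow v'^2\circ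 z'$ with $w^1\circ v^1\circ z\in\mathbf{W}$, $(w^2\circ\sigma^2)\bullet(\alpha\circ z)\bullet(w^1\circ\sigma^1)=\alpha'\circ z'$ and $(f^2\circ\sigma^2)\bullet(\beta\circ z)\bullet(f^1\circ\sigma^1)=\beta'\circ z'$. In Pronk's construction the vertical composition $\Gamma^2\circ\Gamma^1$ is defined as the class of the quintuple of the claim for any representatives of $\Gamma^1,\Gamma^2$ and for one particular set of data (F4), selected by means of the fixed choices $\mathrm{C}(\mathbf{W})$ and $\mathrm{D}(\mathbf{W})$; by Pronk, the result does not depend on the representatives used. *)

theory Defs
  imports Main
begin

section \<open>Bicategories\<close>

(* All 1-cells (2-cells) of a bicategory are collected in one set, with source and target maps
   (domain and codomain maps); passing from hom-families to this form amounts to replacing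
   the homs by their disjoint union.  Both compositions are in applicative order:
   "g \<cdot> f" is first f, then g, and "\<beta> \<bullet> \<alpha>" is first \<alpha>, then \<beta>.
   All operations are meaningful only on composable arguments. *)
record ('o, 'a, 'c) bicat =
  Obj :: "'o set"
  Mor :: "'a set"
  Cell :: "'c set"
  src :: "'a \<Rightarrow> 'o"
  trg :: "'a \<Rightarrow> 'o"
  dom :: "'c \<Rightarrow> 'a"
  cod :: "'c \<Rightarrow> 'a"
  id1 :: "'o \<Rightarrow> 'a"
  id2 :: "'a \<Rightarrow> 'c"
  comp1 :: "'a \<Rightarrow> 'a \<Rightarrow> 'a"  (infixr "\<cdot>\<index>" 75)
  vcomp :: "'c \<Rightarrow> 'c \<Rightarrow> 'c"  (infixr "\<bullet>\<index>" 65)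
  hcomp :: "'c \<Rightarrow> 'c \<Rightarrow> 'c"  (infixr "\<star>\<index>" 70)
  assoc :: "'a \<Rightarrow> 'a \<Rightarrow> 'a \<Rightarrow> 'c"
  lunit :: "'a \<Rightarrow> 'c"
  runit :: "'a \<Rightarrow> 'c"

definition hom :: "('o, 'a, 'c, 'm) bicat_scheme \<Rightarrow> 'o \<Rightarrow> 'o \<Rightarrow> 'a set" where
  "hom C A B = {f \<in> Mor C. src C f = A \<and> trg C f = B}"

definition hom2 :: "('o, 'a, 'c, 'm) bicat_scheme \<Rightarrow> 'a \<Rightarrow> 'a \<Rightarrow> 'c set" where
  "hom2 C f g = {\<alpha> \<in> Cell C. dom C \<alpha> = f \<and> cod C \<alpha> = g}"

definition is_inv2 :: "('o, 'a, 'c, 'm) bicat_scheme \<Rightarrow> 'c \<Rightarrow> 'c \<Rightarrow> bool" where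
  "is_inv2 C \<alpha> \<beta> \<longleftrightarrow>
     \<beta> \<in> hom2 C (cod C \<alpha>) (dom C \<alpha>) \<and>
     vcomp C \<beta> \<alpha> = id2 C (dom C \<alpha>) \<and> vcomp C \<alpha> \<beta> = id2 C (cod C \<alpha>)"

definition iso2 :: "('o, 'a, 'c, 'm) bicat_scheme \<Rightarrow> 'a \<Rightarrow> 'a \<Rightarrow> 'c set" where
  "iso2 C f g = {\<alpha> \<in> hom2 C f g. \<exists>\<beta>. is_inv2 C \<alpha> \<beta>}"

definition inv2 :: "('o, 'a, 'c, 'm) bicat_scheme \<Rightarrow> 'c \<Rightarrow> 'c" where
  "inv2 C \<alpha> = (THE \<beta>. is_inv2 C \<alpha> \<beta>)"

definition whisk_left :: "('o, 'a, 'c, 'm) bicat_scheme \<Rightarrow> 'a \<Rightarrow> 'c \<Rightarrow> 'c"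
  (infixr "\<rhd>\<index>" 70) where
  "whisk_left C g \<alpha> = hcomp C (id2 C g) \<alpha>"

definition whisk_right :: "('o, 'a, 'c, 'm) bicat_scheme \<Rightarrow> 'c \<Rightarrow> 'a \<Rightarrow> 'c"
  (infixl "\<lhd>\<index>" 70) where
  "whisk_right C \<alpha> f = hcomp C \<alpha> (id2 C f)"

locale bicategory =
  fixes C :: "('o, 'a, 'c, 'm) bicat_scheme" (structure)
  assumes src_Obj: "f \<in> Mor C \<Longrightarrow> src C f \<in> Obj C"
    and trg_Obj: "f \<in> Mor C \<Longrightarrow> trg C f \<in> Obj C"
    and dom_Mor: "\<alpha> \<in> Cell C \<Longrightarrow> dom C \<alpha> \<in> Mor C"
    and cod_Mor: "\<alpha> \<in> Cell C \<Longrightarrow> cod C \<alpha> \<in> Mor C"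
    and parallel_src: "\<alpha> \<in> Cell C \<Longrightarrow> src C (dom C \<alpha>) = src C (cod C \<alpha>)"
    and parallel_trg: "\<alpha> \<in> Cell C \<Longrightarrow> trg C (dom C \<alpha>) = trg C (cod C \<alpha>)"
    and id1_hom: "A \<in> Obj C \<Longrightarrow> id1 C A \<in> hom C A A"
    and comp1_hom: "\<lbrakk>f \<in> hom C A B; g \<in> hom C B D\<rbrakk> \<Longrightarrow> g \<cdot> f \<in> hom C A D"
    and id2_hom: "f \<in> Mor C \<Longrightarrow> id2 C f \<in> hom2 C f f"
    and vcomp_hom: "\<lbrakk>\<alpha> \<in> hom2 C f g; \<beta> \<in> hom2 C g h\<rbrakk> \<Longrightarrow> \<beta> \<bullet> \<alpha> \<in> hom2 C f h"
    and vcomp_id_left: "\<alpha> \<in> hom2 C f g \<Longrightarrow> id2 C g \<bullet> \<alpha> = \<alpha>"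
    and vcomp_id_right: "\<alpha> \<in> hom2 C f g \<Longrightarrow> \<alpha> \<bullet> id2 C f = \<alpha>"
    and vcomp_assoc:
      "\<lbrakk>\<alpha> \<in> hom2 C f g; \<beta> \<in> hom2 C g h; \<gamma> \<in> hom2 C h k\<rbrakk>
       \<Longrightarrow> (\<gamma> \<bullet> \<beta>) \<bullet> \<alpha> = \<gamma> \<bullet> (\<beta> \<bullet> \<alpha>)"
    and hcomp_hom:
      "\<lbrakk>f \<in> hom C A B; g \<in> hom C B D; \<alpha> \<in> hom2 C f f'; \<beta> \<in> hom2 C g g'\<rbrakk>
       \<Longrightarrow> \<beta> \<star> \<alpha> \<in> hom2 C (g \<cdot> f) (g' \<cdot> f')"
    and hcomp_id:
      "\<lbrakk>f \<in> hom C A B; g \<in> hom C B D\<rbrakk> \<Longrightarrow> id2 C g \<star> id2 C f = id2 C (g \<cdot> f)"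
    and interchange:
      "\<lbrakk>f \<in> hom C A B; g \<in> hom C B D;
        \<alpha> \<in> hom2 C f f'; \<alpha>' \<in> hom2 C f' f''; \<beta> \<in> hom2 C g g'; \<beta>' \<in> hom2 C g' g''\<rbrakk>
       \<Longrightarrow> (\<beta>' \<bullet> \<beta>) \<star> (\<alpha>' \<bullet> \<alpha>) = (\<beta>' \<star> \<alpha>') \<bullet> (\<beta> \<star> \<alpha>)"
    and assoc_iso:
      "\<lbrakk>f \<in> hom C A B; g \<in> hom C B D; h \<in> hom C D E\<rbrakk>
       \<Longrightarrow> assoc C h g f \<in> iso2 C ((h \<cdot> g) \<cdot> f) (h \<cdot> (g \<cdot> f))"
    and assoc_natural:
      "\<lbrakk>f \<in> hom C A B; g \<in> hom C B D; h \<in> hom C D E;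
        \<alpha> \<in> hom2 C f f'; \<beta> \<in> hom2 C g g'; \<gamma> \<in> hom2 C h h'\<rbrakk>
       \<Longrightarrow> assoc C h' g' f' \<bullet> ((\<gamma> \<star> \<beta>) \<star> \<alpha>) = (\<gamma> \<star> (\<beta> \<star> \<alpha>)) \<bullet> assoc C h g f"
    and lunit_iso: "f \<in> hom C A B \<Longrightarrow> lunit C f \<in> iso2 C (id1 C B \<cdot> f) f"
    and lunit_natural:
      "\<lbrakk>f \<in> hom C A B; \<alpha> \<in> hom2 C f f'\<rbrakk>
       \<Longrightarrow> lunit C f' \<bullet> (id1 C B \<rhd> \<alpha>) = \<alpha> \<bullet> lunit C f"
    and runit_iso: "f \<in> hom C A B \<Longrightarrow> runit C f \<in> iso2 C (f \<cdot> id1 C A) f"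
    and runit_natural:
      "\<lbrakk>f \<in> hom C A B; \<alpha> \<in> hom2 C f f'\<rbrakk>
       \<Longrightarrow> runit C f' \<bullet> (\<alpha> \<lhd> id1 C A) = \<alpha> \<bullet> runit C f"
    and pentagon:
      "\<lbrakk>f \<in> hom C A B; g \<in> hom C B D; h \<in> hom C D E; k \<in> hom C E F\<rbrakk>
       \<Longrightarrow> assoc C k h (g \<cdot> f) \<bullet> assoc C (k \<cdot> h) g f =
           (k \<rhd> assoc C h g f) \<bullet> assoc C k (h \<cdot> g) f \<bullet> (assoc C k h g \<lhd> f)"
    and triangle:
      "\<lbrakk>f \<in> hom C A B; g \<in> hom C B D\<rbrakk>
       \<Longrightarrow> (g \<rhd> lunit C f) \<bullet> assoc C g (id1 C B) f = runit C g \<lhd> f"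

(* For \<theta> : g \<cdot> v \<Rightarrow> g' \<cdot> v' this is the whiskering of \<theta> by u, rebracketed by associators to a
   2-cell g \<cdot> (v \<cdot> u) \<Rightarrow> g' \<cdot> (v' \<cdot> u).  All associators suppressed in the usual 2-categorical notation
   for the bicategory of fractions are accounted for by this operation. *)
definition whisk_reassoc ::
  "('o, 'a, 'c, 'm) bicat_scheme \<Rightarrow> 'a \<times> 'a \<Rightarrow> 'a \<times> 'a \<Rightarrow> 'c \<Rightarrow> 'a \<Rightarrow> 'c" where
  "whisk_reassoc C = (\<lambda>(g, v) (g', v') \<theta> u.
     vcomp C (assoc C g' v' u) (vcomp C (whisk_right C \<theta> u) (inv2 C (assoc C g v u))))"

section \<open>The conditions for a right calculus of fractions\<close>

(* For w : B \<rightarrow> A, f1 f2 : C \<rightarrow> B and \<alpha> : w \<cdot> f1 \<Rightarrow> w \<cdot> f2, the triples (D, v, \<beta>) with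
   v : D \<rightarrow> C in W and \<beta> : f1 \<cdot> v \<Rightarrow> f2 \<cdot> v such that \<alpha> whiskered by v is w whiskered with \<beta>. *)
definition liftings ::
  "('o, 'a, 'c, 'm) bicat_scheme \<Rightarrow> 'a set \<Rightarrow> 'a \<Rightarrow> 'a \<Rightarrow> 'a \<Rightarrow> 'c \<Rightarrow> ('o \<times> 'a \<times> 'c) set" where
  "liftings C W w f1 f2 \<alpha> = {(D, v, \<beta>).
     v \<in> hom C D (src C f1) \<inter> W \<and> \<beta> \<in> hom2 C (comp1 C f1 v) (comp1 C f2 v) \<and>
     whisk_reassoc C (w, f1) (w, f2) \<alpha> v = whisk_left C w \<beta>}"

(* BF4b only asks that some lifting of an invertible \<alpha> is invertible.  This is implied by the variant
   in which every lifting of an invertible \<alpha> is required to be invertible. *)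
locale BF_bicategory = bicategory C for C :: "('o, 'a, 'c, 'm) bicat_scheme" (structure) +
  fixes W :: "'a set"
  assumes W_Mor: "W \<subseteq> Mor C"
    and BF1: "A \<in> Obj C \<Longrightarrow> id1 C A \<in> W"
    and BF2: "\<lbrakk>f \<in> hom C A B \<inter> W; g \<in> hom C B D \<inter> W\<rbrakk> \<Longrightarrow> g \<cdot> f \<in> W"
    and BF3:
      "\<lbrakk>w \<in> hom C A B \<inter> W; f \<in> hom C X B\<rbrakk>
       \<Longrightarrow> \<exists>D w' f' \<rho>. w' \<in> hom C D X \<inter> W \<and> f' \<in> hom C D A \<and> \<rho> \<in> iso2 C (f \<cdot> w') (w \<cdot> f')"
    and BF4a:
      "\<lbrakk>w \<in> hom C B A \<inter> W; f1 \<in> hom C X B; f2 \<in> hom C X B; \<alpha> \<in> hom2 C (w \<cdot> f1) (w \<cdot> f2)\<rbrakk>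
       \<Longrightarrow> \<exists>D v \<beta>. (D, v, \<beta>) \<in> liftings C W w f1 f2 \<alpha>"
    and BF4b:
      "\<lbrakk>w \<in> hom C B A \<inter> W; f1 \<in> hom C X B; f2 \<in> hom C X B; \<alpha> \<in> iso2 C (w \<cdot> f1) (w \<cdot> f2)\<rbrakk>
       \<Longrightarrow> \<exists>D v \<beta>. (D, v, \<beta>) \<in> liftings C W w f1 f2 \<alpha> \<and> \<beta> \<in> iso2 C (f1 \<cdot> v) (f2 \<cdot> v)"
    and BF4c:
      "\<lbrakk>w \<in> hom C B A \<inter> W; f1 \<in> hom C X B; f2 \<in> hom C X B; \<alpha> \<in> hom2 C (w \<cdot> f1) (w \<cdot> f2);
        (D, v, \<beta>) \<in> liftings C W w f1 f2 \<alpha>; (D', v', \<beta>') \<in> liftings C W w f1 f2 \<alpha>\<rbrakk>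
       \<Longrightarrow> \<exists>E u u' \<zeta>. u \<in> hom C E D \<and> u' \<in> hom C E D' \<and> v \<cdot> u \<in> W \<and>
             \<zeta> \<in> iso2 C (v \<cdot> u) (v' \<cdot> u') \<and>
             whisk_reassoc C (f1, v') (f2, v') \<beta>' u' \<bullet> (f1 \<rhd> \<zeta>) =
             (f2 \<rhd> \<zeta>) \<bullet> whisk_reassoc C (f1, v) (f2, v) \<beta> u"
    and BF5: "\<lbrakk>w \<in> hom C A B \<inter> W; v \<in> hom C A B; \<nu> \<in> iso2 C v w\<rbrakk> \<Longrightarrow> v \<in> W"

definition C_choice ::
  "('o, 'a, 'c, 'm) bicat_scheme \<Rightarrow> 'a set \<Rightarrow> ('a \<Rightarrow> 'a \<Rightarrow> 'o \<times> 'a \<times> 'a \<times> 'c) \<Rightarrow> bool" where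
  "C_choice C W cc \<longleftrightarrow>
     (\<forall>A' B' B. \<forall>f \<in> hom C A' B. \<forall>v \<in> hom C B' B \<inter> W.
        case cc f v of (A'', v', f', \<rho>) \<Rightarrow>
          v' \<in> hom C A'' A' \<inter> W \<and> f' \<in> hom C A'' B' \<and>
          \<rho> \<in> iso2 C (comp1 C f v') (comp1 C v f'))"

definition D_choice ::
  "('o, 'a, 'c, 'm) bicat_scheme \<Rightarrow> 'a set \<Rightarrow> ('a \<Rightarrow> 'a \<Rightarrow> 'a \<Rightarrow> 'c \<Rightarrow> 'o \<times> 'a \<times> 'c) \<Rightarrow> bool" where
  "D_choice C W dd \<longleftrightarrow>
     (\<forall>A B X. \<forall>w \<in> hom C B A \<inter> W. \<forall>f1 \<in> hom C X B. \<forall>f2 \<in> hom C X B.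
        \<forall>\<alpha> \<in> hom2 C (comp1 C w f1) (comp1 C w f2).
          dd w f1 f2 \<alpha> \<in> liftings C W w f1 f2 \<alpha>)"

section \<open>The bicategory of fractions: morphisms and 2-morphisms\<close>

type_synonym ('o, 'a) frac = "'o \<times> 'a \<times> 'a"
type_synonym ('o, 'a, 'c) frac2 = "'o \<times> 'a \<times> 'a \<times> 'c \<times> 'c"

definition frac_hom ::
  "('o, 'a, 'c, 'm) bicat_scheme \<Rightarrow> 'a set \<Rightarrow> 'o \<Rightarrow> 'o \<Rightarrow> ('o, 'a) frac set" where
  "frac_hom C W A B = {(A', w, f). w \<in> hom C A' A \<inter> W \<and> f \<in> hom C A' B}"

fun frac_rep ::
  "('o, 'a, 'c, 'm) bicat_scheme \<Rightarrow> 'a set \<Rightarrow> ('o, 'a) frac \<Rightarrow> ('o, 'a) frac \<Rightarrow>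
   ('o, 'a, 'c) frac2 set" where
  "frac_rep C W (A1, w1, f1) (A2, w2, f2) = {(A3, v1, v2, \<alpha>, \<beta>).
     v1 \<in> hom C A3 A1 \<and> v2 \<in> hom C A3 A2 \<and> comp1 C w1 v1 \<in> W \<and>
     \<alpha> \<in> iso2 C (comp1 C w1 v1) (comp1 C w2 v2) \<and>
     \<beta> \<in> hom2 C (comp1 C f1 v1) (comp1 C f2 v2)}"

fun frac_rel ::
  "('o, 'a, 'c, 'm) bicat_scheme \<Rightarrow> 'a set \<Rightarrow> ('o, 'a) frac \<Rightarrow> ('o, 'a) frac \<Rightarrow>
   (('o, 'a, 'c) frac2 \<times> ('o, 'a, 'c) frac2) set" where
  "frac_rel C W (A1, w1, f1) (A2, w2, f2) = {((A3, v1, v2, \<alpha>, \<beta>), (A3', v1', v2', \<alpha>', \<beta>')).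
     (A3, v1, v2, \<alpha>, \<beta>) \<in> frac_rep C W (A1, w1, f1) (A2, w2, f2) \<and>
     (A3', v1', v2', \<alpha>', \<beta>') \<in> frac_rep C W (A1, w1, f1) (A2, w2, f2) \<and>
     (\<exists>A4 z z' \<sigma>1 \<sigma>2.
        z \<in> hom C A4 A3 \<and> z' \<in> hom C A4 A3' \<and>
        \<sigma>1 \<in> iso2 C (comp1 C v1' z') (comp1 C v1 z) \<and>
        \<sigma>2 \<in> iso2 C (comp1 C v2 z) (comp1 C v2' z') \<and>
        comp1 C w1 (comp1 C v1 z) \<in> W \<and>
        vcomp C (whisk_left C w2 \<sigma>2)
          (vcomp C (whisk_reassoc C (w1, v1) (w2, v2) \<alpha> z) (whisk_left C w1 \<sigma>1)) =
        whisk_reassoc C (w1, v1') (w2, v2') \<alpha>' z' \<and>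
        vcomp C (whisk_left C f2 \<sigma>2)
          (vcomp C (whisk_reassoc C (f1, v1) (f2, v2) \<beta> z) (whisk_left C f1 \<sigma>1)) =
        whisk_reassoc C (f1, v1') (f2, v2') \<beta>' z')}"

definition frac_hom2 ::
  "('o, 'a, 'c, 'm) bicat_scheme \<Rightarrow> 'a set \<Rightarrow> ('o, 'a) frac \<Rightarrow> ('o, 'a) frac \<Rightarrow>
   ('o, 'a, 'c) frac2 set set" where
  "frac_hom2 C W F1 F2 = frac_rep C W F1 F2 // frac_rel C W F1 F2"

section \<open>Vertical composition\<close>

fun F4_data ::
  "('o, 'a, 'c, 'm) bicat_scheme \<Rightarrow> 'a set \<Rightarrow> ('o, 'a, 'c) frac2 \<Rightarrow> ('o, 'a, 'c) frac2 \<Rightarrow>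
   ('o \<times> 'a \<times> 'a \<times> 'c) set" where
  "F4_data C W (A4, u1, u2, \<alpha>1, \<beta>1) (A5, u3, u4, \<alpha>2, \<beta>2) = {(X, t1, t2, \<rho>).
     t1 \<in> hom C X A4 \<inter> W \<and> t2 \<in> hom C X A5 \<and> \<rho> \<in> iso2 C (comp1 C u2 t1) (comp1 C u3 t2)}"

(* The 2-cells of the result are \<xi> = (\<alpha>2 t2) \<bullet> (w2 \<rho>) \<bullet> (\<alpha>1 t1) and \<gamma> = (\<beta>2 t2) \<bullet> (f2 \<rho>) \<bullet> (\<beta>1 t1). *)
fun frac_paste ::
  "('o, 'a, 'c, 'm) bicat_scheme \<Rightarrow> ('o, 'a) frac \<Rightarrow> ('o, 'a) frac \<Rightarrow> ('o, 'a) frac \<Rightarrow>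
   ('o, 'a, 'c) frac2 \<Rightarrow> ('o, 'a, 'c) frac2 \<Rightarrow> 'o \<times> 'a \<times> 'a \<times> 'c \<Rightarrow> ('o, 'a, 'c) frac2" where
  "frac_paste C (A1, w1, f1) (A2, w2, f2) (A3, w3, f3)
     (A4, u1, u2, \<alpha>1, \<beta>1) (A5, u3, u4, \<alpha>2, \<beta>2) (X, t1, t2, \<rho>) =
   (X, comp1 C u1 t1, comp1 C u4 t2,
    vcomp C (whisk_reassoc C (w2, u3) (w3, u4) \<alpha>2 t2)
      (vcomp C (whisk_left C w2 \<rho>) (whisk_reassoc C (w1, u1) (w2, u2) \<alpha>1 t1)),
    vcomp C (whisk_reassoc C (f2, u3) (f3, u4) \<beta>2 t2)
      (vcomp C (whisk_left C f2 \<rho>) (whisk_reassoc C (f1, u1) (f2, u2) \<beta>1 t1)))"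

(* Pronk's selection of (X, t1, t2, \<rho>).  First the choice for the pair (w2 \<cdot> u2, w2 \<cdot> u3) gives
   v' in W, g and an invertible \<rho>0 : (w2 \<cdot> u2) \<cdot> v' \<Rightarrow> (w2 \<cdot> u3) \<cdot> g; note that w2 \<cdot> u3 is in W because
   (A5, u3, ...) represents a 2-morphism out of (A2, w2, f2).  Then the choice for w2, u2 \<cdot> v', u3 \<cdot> g
   and \<rho>0 (rebracketed) gives v in W and \<sigma> : (u2 \<cdot> v') \<cdot> v \<Rightarrow> (u3 \<cdot> g) \<cdot> v lifting \<rho>0. *)
fun Pronk_data ::
  "('o, 'a, 'c, 'm) bicat_scheme \<Rightarrow> ('a \<Rightarrow> 'a \<Rightarrow> 'o \<times> 'a \<times> 'a \<times> 'c) \<Rightarrow>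
   ('a \<Rightarrow> 'a \<Rightarrow> 'a \<Rightarrow> 'c \<Rightarrow> 'o \<times> 'a \<times> 'c) \<Rightarrow> ('o, 'a) frac \<Rightarrow>
   ('o, 'a, 'c) frac2 \<Rightarrow> ('o, 'a, 'c) frac2 \<Rightarrow> 'o \<times> 'a \<times> 'a \<times> 'c" where
  "Pronk_data C cc dd (A2, w2, f2) (A4, u1, u2, \<alpha>1, \<beta>1) (A5, u3, u4, \<alpha>2, \<beta>2) =
     (let (E, v', g, \<rho>0) = cc (comp1 C w2 u2) (comp1 C w2 u3);
          \<rho>1 = vcomp C (assoc C w2 u3 g) (vcomp C \<rho>0 (inv2 C (assoc C w2 u2 v')));
          (D, v, \<sigma>) = dd w2 (comp1 C u2 v') (comp1 C u3 g) \<rho>1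
      in (D, comp1 C v' v, comp1 C g v,
          vcomp C (assoc C u3 g v) (vcomp C \<sigma> (inv2 C (assoc C u2 v' v)))))"

(* Representatives are eliminated by taking the union of the classes obtained from all pairs of
   representatives; as the result does not depend on them, this union is a single class. *)
definition frac_vcomp ::
  "('o, 'a, 'c, 'm) bicat_scheme \<Rightarrow> 'a set \<Rightarrow> ('a \<Rightarrow> 'a \<Rightarrow> 'o \<times> 'a \<times> 'a \<times> 'c) \<Rightarrow>
   ('a \<Rightarrow> 'a \<Rightarrow> 'a \<Rightarrow> 'c \<Rightarrow> 'o \<times> 'a \<times> 'c) \<Rightarrow>
   ('o, 'a) frac \<Rightarrow> ('o, 'a) frac \<Rightarrow> ('o, 'a) frac \<Rightarrow>
   ('o, 'a, 'c) frac2 set \<Rightarrow> ('o, 'a, 'c) frac2 set \<Rightarrow> ('o, 'a, 'c) frac2 set" where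
  "frac_vcomp C W cc dd F1 F2 F3 \<Gamma>2 \<Gamma>1 =
     (\<Union>r1 \<in> \<Gamma>1. \<Union>r2 \<in> \<Gamma>2.
        frac_rel C W F1 F3 `` {frac_paste C F1 F2 F3 r1 r2 (Pronk_data C cc dd F2 r1 r2)})"

end

theory Submission
  imports Defs
begin

text \<open>
  Both 2-cells of a representative \<open>(A3, v1, v2, \<alpha>, \<beta>)\<close> have the shape \<open>\<theta> : g1 \<cdot> v1 \<Rightarrow> g2 \<cdot> v2\<close>, and
  equivalence of representatives is generated by two moves: restricting \<open>\<theta>\<close> along a 1-cell \<open>z\<close> with
  \<open>w1 \<cdot> v1 \<cdot> z\<close> in \<open>W\<close>, and transporting \<open>\<theta>\<close> along invertible 2-cells of \<open>v1\<close> and \<open>v2\<close>. Transitivity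
  rests on completing cospans \<open>a, b\<close> to a square when \<open>w\<close> and \<open>w \<cdot> b\<close> are in \<open>W\<close>.

  Two sets of data \<open>(t1, t2, \<rho>)\<close> for the same representatives are compared by completing \<open>t1, t1'\<close> to a
  square, lifting the induced 2-cell between the second legs along \<open>w2 \<cdot> u3\<close>, and using that two 2-cells
  that agree after whiskering with \<open>w2\<close> agree after restriction along some 1-cell in \<open>W\<close>. Pasting
  commutes with both moves on the representatives, so it respects equivalence. The data selected by
  Pronk need not have \<open>\<rho>\<close> invertible, but \<open>w2 \<rhd> \<rho>\<close> is invertible, and this suffices throughout.
\<close>

section \<open>Calculus in a bicategory\<close>

text \<open>Since \<open>frac_vcomp\<close> is a union over all pairs of representatives, the
  independence of Pronk's composite from the representatives is proved here and not presupposed; the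
  data built from the fixed choices are treated as one more set of data. Three features shape the
  argument. No cancellation property of \<open>W\<close> is available: a witness of equivalence
  restricts along a 1-cell \<open>z\<close> of which only \<open>w1 \<cdot> v1 \<cdot> z\<close> is
  known to lie in \<open>W\<close>, hence conditions on 1-cells are kept in composite form.
  \<open>D_choice\<close> selects some lifting, possibly not invertible even when the lifted 2-cell
  is, which is why Pronk's \<rho> may fail to be invertible. Lastly, \<xi> depends on \<rho> only
  through \<open>w2 \<rhd> \<rho>\<close>, while \<gamma> contains \<open>f2 \<rhd> \<rho>\<close>:
  an identity that holds after whiskering with \<open>w2\<close> must be stripped of
  \<open>w2\<close>, at the price of a restriction, before it says anything about \<gamma>.
  Associators are controlled by a single normal form: boundaries are right-nested,
  \<open>g \<cdot> (v \<cdot> u)\<close>, and restriction is always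
  \<open>whisk_reassoc\<close>.\<close>

context bicategory
begin

section \<open>Boundaries of 1-cells and 2-cells\<close>

lemma homI: "\<lbrakk>f \<in> Mor C; src C f = A; trg C f = B\<rbrakk> \<Longrightarrow> f \<in> hom C A B"
  by (simp add: hom_def)

lemma homD:
  assumes "f \<in> hom C A B"
  shows "f \<in> Mor C" "src C f = A" "trg C f = B"
  using assms by (auto simp: hom_def)

lemma hom2I: "\<lbrakk>\<alpha> \<in> Cell C; dom C \<alpha> = f; cod C \<alpha> = g\<rbrakk> \<Longrightarrow> \<alpha> \<in> hom2 C f g"
  by (simp add: hom2_def)

lemma hom2D:
  assumes "\<alpha> \<in> hom2 C f g"
  shows "\<alpha> \<in> Cell C" "dom C \<alpha> = f" "cod C \<alpha> = g"
  using assms by (auto simp: hom2_def)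

text \<open>Invertibility without the two boundary 1-cells of \<open>iso2\<close>, so that simp can
  propagate it while \<open>dom\<close> and \<open>cod\<close> are rewritten separately.\<close>

definition iso :: "'c \<Rightarrow> bool" where
  "iso \<alpha> \<longleftrightarrow> \<alpha> \<in> Cell C \<and> (\<exists>\<beta>. is_inv2 C \<alpha> \<beta>)"

lemma iso2_iff: "\<alpha> \<in> iso2 C f g \<longleftrightarrow> iso \<alpha> \<and> dom C \<alpha> = f \<and> cod C \<alpha> = g"
  by (auto simp: iso2_def iso_def hom2_def)

lemma iso2D:
  assumes "\<alpha> \<in> iso2 C f g"
  shows "iso \<alpha>" "dom C \<alpha> = f" "cod C \<alpha> = g"
  using assms by (auto simp: iso2_iff)

lemma iso_Cell [simp]: "iso \<alpha> \<Longrightarrow> \<alpha> \<in> Cell C"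
  by (simp add: iso_def)

text \<open>The two axioms on parallel boundaries are reversed: source and target of a codomain
  rewrite to those of the domain, which gives boundary objects one normal form.\<close>

declare src_Obj [simp] trg_Obj [simp] dom_Mor [simp] cod_Mor [simp]
  parallel_src [symmetric, simp] parallel_trg [symmetric, simp]

text \<open>Once the domain and codomain of a 2-cell carry names, the simp rules above no longer
  match; this gives the same facts for the names.\<close>

lemma parallel:
  assumes "\<alpha> \<in> Cell C" "dom C \<alpha> = f" "cod C \<alpha> = g"
  shows "f \<in> Mor C" "g \<in> Mor C" "src C g = src C f" "trg C g = trg C f"
  using assms by auto

lemma id1_simps [simp]:
  assumes "A \<in> Obj C"
  shows "id1 C A \<in> Mor C" "src C (id1 C A) = A" "trg C (id1 C A) = A"
  using homD[OF id1_hom[OF assms]] by auto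

lemma comp1_simps [simp]:
  assumes "f \<in> Mor C" "g \<in> Mor C" "src C g = trg C f"
  shows "g \<cdot> f \<in> Mor C" "src C (g \<cdot> f) = src C f" "trg C (g \<cdot> f) = trg C g"
  using homD[OF comp1_hom, OF homI homI, OF assms(1) refl refl assms(2,3) refl] by auto

lemma id2_simps [simp]:
  assumes "f \<in> Mor C"
  shows "id2 C f \<in> Cell C" "dom C (id2 C f) = f" "cod C (id2 C f) = f"
  using hom2D[OF id2_hom[OF assms]] by auto

lemma vcomp_simps [simp]:
  assumes "\<alpha> \<in> Cell C" "\<beta> \<in> Cell C" "dom C \<beta> = cod C \<alpha>"
  shows "\<beta> \<bullet> \<alpha> \<in> Cell C" "dom C (\<beta> \<bullet> \<alpha>) = dom C \<alpha>" "cod C (\<beta> \<bullet> \<alpha>) = cod C \<beta>"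
  using hom2D[OF vcomp_hom, OF hom2I hom2I, OF assms(1) refl refl assms(2,3) refl] by auto

lemma vcomp_ids [simp]:
  assumes "\<alpha> \<in> Cell C"
  shows "dom C \<alpha> = f \<Longrightarrow> \<alpha> \<bullet> id2 C f = \<alpha>" "cod C \<alpha> = f \<Longrightarrow> id2 C f \<bullet> \<alpha> = \<alpha>"
  using vcomp_id_left[OF hom2I] vcomp_id_right[OF hom2I] assms by auto

text \<open>Right-nested composites are the simp normal form. Calculations below regroup the factors
  explicitly, rewrite one group, and let simp restore the nesting.\<close>

lemma vassoc [simp]:
  assumes "\<alpha> \<in> Cell C" "\<beta> \<in> Cell C" "\<gamma> \<in> Cell C" "dom C \<beta> = cod C \<alpha>" "dom C \<gamma> = cod C \<beta>"
  shows "(\<gamma> \<bullet> \<beta>) \<bullet> \<alpha> = \<gamma> \<bullet> \<beta> \<bullet> \<alpha>"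
  using assms by (intro vcomp_assoc hom2I) auto

lemma hcomp_simps [simp]:
  assumes "\<alpha> \<in> Cell C" "\<beta> \<in> Cell C" "src C (dom C \<beta>) = trg C (dom C \<alpha>)"
  shows "\<beta> \<star> \<alpha> \<in> Cell C" "dom C (\<beta> \<star> \<alpha>) = dom C \<beta> \<cdot> dom C \<alpha>"
    "cod C (\<beta> \<star> \<alpha>) = cod C \<beta> \<cdot> cod C \<alpha>"
  using hom2D[OF hcomp_hom, OF homI homI hom2I hom2I, OF _ refl refl _ assms(3) refl assms(1) refl refl assms(2)]
    assms by auto

section \<open>Whiskering and interchange\<close>

lemma whisk_left_simps [simp]:
  assumes "g \<in> Mor C" "\<alpha> \<in> Cell C" "src C g = trg C (dom C \<alpha>)"
  shows "g \<rhd> \<alpha> \<in> Cell C" "dom C (g \<rhd> \<alpha>) = g \<cdot> dom C \<alpha>" "cod C (g \<rhd> \<alpha>) = g \<cdot> cod C \<alpha>"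
  using assms by (auto simp: whisk_left_def)

lemma whisk_right_simps [simp]:
  assumes "f \<in> Mor C" "\<alpha> \<in> Cell C" "src C (dom C \<alpha>) = trg C f"
  shows "\<alpha> \<lhd> f \<in> Cell C" "dom C (\<alpha> \<lhd> f) = dom C \<alpha> \<cdot> f" "cod C (\<alpha> \<lhd> f) = cod C \<alpha> \<cdot> f"
  using assms by (auto simp: whisk_right_def)

lemma whisk_left_id [simp]:
  "\<lbrakk>g \<in> Mor C; f \<in> Mor C; src C g = trg C f\<rbrakk> \<Longrightarrow> g \<rhd> id2 C f = id2 C (g \<cdot> f)"
  unfolding whisk_left_def by (rule hcomp_id[OF homI homI]) auto

lemma whisk_right_id [simp]:
  "\<lbrakk>g \<in> Mor C; f \<in> Mor C; src C g = trg C f\<rbrakk> \<Longrightarrow> id2 C g \<lhd> f = id2 C (g \<cdot> f)"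
  unfolding whisk_right_def by (rule hcomp_id[OF homI homI]) auto

lemma interchange_Cell:
  assumes "\<alpha> \<in> Cell C" "\<alpha>' \<in> Cell C" "\<beta> \<in> Cell C" "\<beta>' \<in> Cell C"
    "dom C \<alpha>' = cod C \<alpha>" "dom C \<beta>' = cod C \<beta>" "src C (dom C \<beta>) = trg C (dom C \<alpha>)"
  shows "(\<beta>' \<bullet> \<beta>) \<star> (\<alpha>' \<bullet> \<alpha>) = (\<beta>' \<star> \<alpha>') \<bullet> (\<beta> \<star> \<alpha>)"
  using assms by (intro interchange homI hom2I) auto

lemma whisk_left_vcomp:
  assumes "g \<in> Mor C" "\<alpha> \<in> Cell C" "\<beta> \<in> Cell C" "dom C \<beta> = cod C \<alpha>" "src C g = trg C (dom C \<alpha>)"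
  shows "g \<rhd> (\<beta> \<bullet> \<alpha>) = (g \<rhd> \<beta>) \<bullet> (g \<rhd> \<alpha>)"
  using interchange_Cell[of \<alpha> \<beta> "id2 C g" "id2 C g"] assms by (simp add: whisk_left_def)

lemma whisk_right_vcomp:
  assumes "f \<in> Mor C" "\<alpha> \<in> Cell C" "\<beta> \<in> Cell C" "dom C \<beta> = cod C \<alpha>" "src C (dom C \<alpha>) = trg C f"
  shows "(\<beta> \<bullet> \<alpha>) \<lhd> f = (\<beta> \<lhd> f) \<bullet> (\<alpha> \<lhd> f)"
  using interchange_Cell[of "id2 C f" "id2 C f" \<alpha> \<beta>] assms by (simp add: whisk_right_def)

text \<open>Both sides equal \<open>\<beta> \<star> \<alpha>\<close>, by interchange with
  identities.\<close>

lemma whisk_exchange: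
  assumes "\<alpha> \<in> Cell C" "\<beta> \<in> Cell C" "src C (dom C \<beta>) = trg C (dom C \<alpha>)"
    "dom C \<alpha> = f" "cod C \<alpha> = f'" "dom C \<beta> = g" "cod C \<beta> = g'"
  shows "(\<beta> \<lhd> f') \<bullet> (g \<rhd> \<alpha>) = (g' \<rhd> \<alpha>) \<bullet> (\<beta> \<lhd> f)"
  using interchange_Cell[of \<alpha> "id2 C f'" "id2 C g" \<beta>] interchange_Cell[of "id2 C f" \<alpha> \<beta> "id2 C g'"] assms
  by (force simp: whisk_left_def whisk_right_def)

section \<open>Invertible 2-cells\<close>

lemma is_inv2_unique:
  assumes "\<alpha> \<in> Cell C" "is_inv2 C \<alpha> \<beta>" "is_inv2 C \<alpha> \<beta>'"
  shows "\<beta> = \<beta>'"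
proof -
  have "\<beta> = \<beta> \<bullet> (\<alpha> \<bullet> \<beta>')"
    using assms by (simp add: is_inv2_def hom2_def)
  also have "\<dots> = (\<beta> \<bullet> \<alpha>) \<bullet> \<beta>'"
    using assms(1) hom2D[of \<beta>] hom2D[of \<beta>'] assms(2,3) by (subst vassoc) (auto simp: is_inv2_def)
  also have "\<dots> = \<beta>'"
    using assms by (simp add: is_inv2_def hom2_def)
  finally show ?thesis .
qed

lemma isoI:
  assumes "\<alpha> \<in> Cell C" "\<beta> \<in> Cell C" "dom C \<beta> = cod C \<alpha>" "cod C \<beta> = dom C \<alpha>"
    "\<beta> \<bullet> \<alpha> = id2 C (dom C \<alpha>)" "\<alpha> \<bullet> \<beta> = id2 C (cod C \<alpha>)"
  shows "iso \<alpha>"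
  unfolding iso_def is_inv2_def hom2_def using assms by blast

lemma is_inv2_inv2:
  assumes "iso \<alpha>"
  shows "is_inv2 C \<alpha> (inv2 C \<alpha>)"
proof -
  obtain \<beta> where \<beta>: "\<alpha> \<in> Cell C" "is_inv2 C \<alpha> \<beta>"
    using assms by (auto simp: iso_def)
  show ?thesis
    unfolding inv2_def by (rule theI[of _ \<beta>]) (use \<beta> is_inv2_unique in auto)
qed

lemma inv2_simps [simp]:
  assumes "iso \<alpha>"
  shows "inv2 C \<alpha> \<in> Cell C" "dom C (inv2 C \<alpha>) = cod C \<alpha>" "cod C (inv2 C \<alpha>) = dom C \<alpha>"
    "inv2 C \<alpha> \<bullet> \<alpha> = id2 C (dom C \<alpha>)" "\<alpha> \<bullet> inv2 C \<alpha> = id2 C (cod C \<alpha>)"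
  using is_inv2_inv2[OF assms] by (auto simp: is_inv2_def hom2_def)

lemma inv2_iso [simp]: "iso \<alpha> \<Longrightarrow> iso (inv2 C \<alpha>)"
  by (rule isoI[of _ \<alpha>]) auto

lemma inv2_cancel [simp]:
  assumes "iso \<alpha>" "\<beta> \<in> Cell C"
  shows "cod C \<beta> = dom C \<alpha> \<Longrightarrow> inv2 C \<alpha> \<bullet> \<alpha> \<bullet> \<beta> = \<beta>"
    "cod C \<beta> = cod C \<alpha> \<Longrightarrow> \<alpha> \<bullet> inv2 C \<alpha> \<bullet> \<beta> = \<beta>"
  using assms by (simp_all flip: vassoc)

lemma iso_id2 [simp]: "f \<in> Mor C \<Longrightarrow> iso (id2 C f)"
  by (rule isoI[of _ "id2 C f"]) auto

lemma iso_vcomp [simp]: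
  assumes "iso \<alpha>" "iso \<beta>" "dom C \<beta> = cod C \<alpha>"
  shows "iso (\<beta> \<bullet> \<alpha>)"
  using assms by (intro isoI[of _ "inv2 C \<alpha> \<bullet> inv2 C \<beta>"]) auto

lemma whisk_left_inv:
  assumes "g \<in> Mor C" "iso \<alpha>" "src C g = trg C (dom C \<alpha>)"
  shows "(g \<rhd> inv2 C \<alpha>) \<bullet> (g \<rhd> \<alpha>) = id2 C (g \<cdot> dom C \<alpha>)"
    "(g \<rhd> \<alpha>) \<bullet> (g \<rhd> inv2 C \<alpha>) = id2 C (g \<cdot> cod C \<alpha>)"
  using assms by (simp_all flip: whisk_left_vcomp)

lemma iso_whisk_left [simp]:
  assumes "g \<in> Mor C" "iso \<alpha>" "src C g = trg C (dom C \<alpha>)"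
  shows "iso (g \<rhd> \<alpha>)"
  using assms by (intro isoI[of _ "g \<rhd> inv2 C \<alpha>"]) (auto simp: whisk_left_inv)

lemma iso_whisk_right [simp]:
  assumes "f \<in> Mor C" "iso \<alpha>" "src C (dom C \<alpha>) = trg C f"
  shows "iso (\<alpha> \<lhd> f)"
  using assms by (intro isoI[of _ "inv2 C \<alpha> \<lhd> f"]) (auto simp flip: whisk_right_vcomp)

text \<open>Simp does not identify \<open>g \<rhd> inv2 C \<alpha>\<close> with the inverse of
  \<open>g \<rhd> \<alpha>\<close>, so this pair has its own cancellation rules inside longer
  composites.\<close>

lemma whisk_left_inv_cancel:
  assumes "g \<in> Mor C" "iso \<alpha>" "src C g = trg C (dom C \<alpha>)" "\<beta> \<in> Cell C"
  shows "cod C \<beta> = g \<cdot> dom C \<alpha> \<Longrightarrow> (g \<rhd> inv2 C \<alpha>) \<bullet> (g \<rhd> \<alpha>) \<bullet> \<beta> = \<beta>"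
    "cod C \<beta> = g \<cdot> cod C \<alpha> \<Longrightarrow> (g \<rhd> \<alpha>) \<bullet> (g \<rhd> inv2 C \<alpha>) \<bullet> \<beta> = \<beta>"
proof -
  show "(g \<rhd> inv2 C \<alpha>) \<bullet> (g \<rhd> \<alpha>) \<bullet> \<beta> = \<beta>" if "cod C \<beta> = g \<cdot> dom C \<alpha>"
    using assms that by (subst vassoc[symmetric]) (auto simp: whisk_left_inv)
  show "(g \<rhd> \<alpha>) \<bullet> (g \<rhd> inv2 C \<alpha>) \<bullet> \<beta> = \<beta>" if "cod C \<beta> = g \<cdot> cod C \<alpha>"
    using assms that by (subst vassoc[symmetric]) (auto simp: whisk_left_inv)
qed

text \<open>Used for equations about \<open>whisk_reassoc\<close>, whose rightmost factor is an
  inverse associator: composed with associators, both sides can be compared without that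
  inverse.\<close>

lemma iso_cancel_right:
  assumes "iso \<gamma>" "\<alpha> \<in> Cell C" "\<beta> \<in> Cell C" "dom C \<alpha> = cod C \<gamma>" "dom C \<beta> = cod C \<gamma>"
    "\<alpha> \<bullet> \<gamma> = \<beta> \<bullet> \<gamma>"
  shows "\<alpha> = \<beta>"
proof -
  have "(\<alpha> \<bullet> \<gamma>) \<bullet> inv2 C \<gamma> = (\<beta> \<bullet> \<gamma>) \<bullet> inv2 C \<gamma>"
    using assms by simp
  with assms(1-5) show ?thesis by simp
qed

section \<open>Associators: naturality in each argument and the pentagon\<close>

lemma assoc_simps [simp]:
  assumes "f \<in> Mor C" "g \<in> Mor C" "h \<in> Mor C" "src C g = trg C f" "src C h = trg C g"
  shows "iso (assoc C h g f)" "dom C (assoc C h g f) = (h \<cdot> g) \<cdot> f"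
    "cod C (assoc C h g f) = h \<cdot> g \<cdot> f"
  using iso2D[OF assoc_iso, OF homI homI homI, OF assms(1) refl refl assms(2,4) refl assms(3,5) refl]
  by auto

lemma assoc_natural_Cell:
  assumes "\<alpha> \<in> Cell C" "\<beta> \<in> Cell C" "\<gamma> \<in> Cell C"
    "src C (dom C \<beta>) = trg C (dom C \<alpha>)" "src C (dom C \<gamma>) = trg C (dom C \<beta>)"
  shows "assoc C (cod C \<gamma>) (cod C \<beta>) (cod C \<alpha>) \<bullet> ((\<gamma> \<star> \<beta>) \<star> \<alpha>) =
    (\<gamma> \<star> (\<beta> \<star> \<alpha>)) \<bullet> assoc C (dom C \<gamma>) (dom C \<beta>) (dom C \<alpha>)"
  using assms by (intro assoc_natural homI hom2I) auto

lemma assoc_natural1: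
  assumes "\<gamma> \<in> Cell C" "dom C \<gamma> = h" "cod C \<gamma> = h'" "g \<in> Mor C" "f \<in> Mor C"
    "src C g = trg C f" "src C h = trg C g"
  shows "assoc C h' g f \<bullet> ((\<gamma> \<lhd> g) \<lhd> f) = (\<gamma> \<lhd> g \<cdot> f) \<bullet> assoc C h g f"
  using assoc_natural_Cell[of "id2 C f" "id2 C g" \<gamma>] assms
  by (force simp: whisk_right_def hcomp_id[OF homI homI])

lemma assoc_natural2:
  assumes "\<beta> \<in> Cell C" "dom C \<beta> = g" "cod C \<beta> = g'" "h \<in> Mor C" "f \<in> Mor C"
    "src C g = trg C f" "src C h = trg C g"
  shows "assoc C h g' f \<bullet> ((h \<rhd> \<beta>) \<lhd> f) = (h \<rhd> (\<beta> \<lhd> f)) \<bullet> assoc C h g f"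
  using assoc_natural_Cell[of "id2 C f" \<beta> "id2 C h"] assms
  by (auto simp: whisk_left_def whisk_right_def)

lemma assoc_natural3:
  assumes "\<alpha> \<in> Cell C" "dom C \<alpha> = f" "cod C \<alpha> = f'" "h \<in> Mor C" "g \<in> Mor C"
    "src C g = trg C f" "src C h = trg C g"
  shows "assoc C h g f' \<bullet> (h \<cdot> g \<rhd> \<alpha>) = (h \<rhd> g \<rhd> \<alpha>) \<bullet> assoc C h g f"
  using assoc_natural_Cell[of \<alpha> "id2 C g" "id2 C h"] assms
  by (force simp: whisk_left_def hcomp_id[OF homI homI])

lemma pentagon_Mor:
  assumes "f \<in> Mor C" "g \<in> Mor C" "h \<in> Mor C" "k \<in> Mor C"
    "src C g = trg C f" "src C h = trg C g" "src C k = trg C h"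
  shows "assoc C k h (g \<cdot> f) \<bullet> assoc C (k \<cdot> h) g f =
    (k \<rhd> assoc C h g f) \<bullet> assoc C k (h \<cdot> g) f \<bullet> (assoc C k h g \<lhd> f)"
  using assms by (intro pentagon homI) auto

section \<open>Restriction of a 2-cell between composites\<close>

lemma whisk_reassoc_eq:
  "whisk_reassoc C (g, v) (g', v') \<theta> u =
    assoc C g' v' u \<bullet> (\<theta> \<lhd> u) \<bullet> inv2 C (assoc C g v u)"
  by (simp add: whisk_reassoc_def)

lemma whisk_reassoc_simps [simp]:
  assumes "g \<in> Mor C" "v \<in> Mor C" "g' \<in> Mor C" "v' \<in> Mor C" "u \<in> Mor C" "\<theta> \<in> Cell C"
    "src C g = trg C v" "src C g' = trg C v'" "src C v = trg C u" "src C v' = trg C u"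
    "dom C \<theta> = g \<cdot> v" "cod C \<theta> = g' \<cdot> v'"
  shows "whisk_reassoc C (g, v) (g', v') \<theta> u \<in> Cell C"
    "dom C (whisk_reassoc C (g, v) (g', v') \<theta> u) = g \<cdot> v \<cdot> u"
    "cod C (whisk_reassoc C (g, v) (g', v') \<theta> u) = g' \<cdot> v' \<cdot> u"
    "iso \<theta> \<Longrightarrow> iso (whisk_reassoc C (g, v) (g', v') \<theta> u)"
  using assms by (simp_all add: whisk_reassoc_eq)

text \<open>The definition with the inverse associator moved across, the form that combines with
  pentagon and naturality.\<close>

lemma whisk_reassoc_assoc:
  assumes "g \<in> Mor C" "v \<in> Mor C" "g' \<in> Mor C" "v' \<in> Mor C" "u \<in> Mor C" "\<theta> \<in> Cell C"
    "src C g = trg C v" "src C g' = trg C v'" "src C v = trg C u" "src C v' = trg C u"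
    "dom C \<theta> = g \<cdot> v" "cod C \<theta> = g' \<cdot> v'"
  shows "whisk_reassoc C (g, v) (g', v') \<theta> u \<bullet> assoc C g v u = assoc C g' v' u \<bullet> (\<theta> \<lhd> u)"
  using assms by (simp add: whisk_reassoc_eq)

lemma whisk_reassoc_vcomp:
  assumes "g \<in> Mor C" "v \<in> Mor C" "g' \<in> Mor C" "v' \<in> Mor C" "g'' \<in> Mor C" "v'' \<in> Mor C"
    "u \<in> Mor C" "\<theta> \<in> Cell C" "\<theta>' \<in> Cell C"
    "src C g = trg C v" "src C g' = trg C v'" "src C g'' = trg C v''"
    "src C v = trg C u" "src C v' = trg C u" "src C v'' = trg C u"
    "dom C \<theta> = g \<cdot> v" "cod C \<theta> = g' \<cdot> v'" "dom C \<theta>' = g' \<cdot> v'" "cod C \<theta>' = g'' \<cdot> v''"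
  shows "whisk_reassoc C (g, v) (g'', v'') (\<theta>' \<bullet> \<theta>) u =
    whisk_reassoc C (g', v') (g'', v'') \<theta>' u \<bullet> whisk_reassoc C (g, v) (g', v') \<theta> u"
  using assms by (simp add: whisk_reassoc_eq whisk_right_vcomp)

text \<open>Naturality of the associator in its middle argument makes both associators
  cancel.\<close>

lemma whisk_reassoc_whisk_left:
  assumes "g \<in> Mor C" "v \<in> Mor C" "v' \<in> Mor C" "u \<in> Mor C" "\<rho> \<in> Cell C"
    "src C g = trg C v" "src C v = trg C u" "dom C \<rho> = v" "cod C \<rho> = v'"
  shows "whisk_reassoc C (g, v) (g, v') (g \<rhd> \<rho>) u = g \<rhd> (\<rho> \<lhd> u)"
proof -
  have v': "src C v' = trg C u" "src C g = trg C v'"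
    using assms parallel[of \<rho>] by auto
  have "assoc C g v' u \<bullet> ((g \<rhd> \<rho>) \<lhd> u) \<bullet> inv2 C (assoc C g v u) =
      (assoc C g v' u \<bullet> ((g \<rhd> \<rho>) \<lhd> u)) \<bullet> inv2 C (assoc C g v u)"
    using assms v' by simp
  also have "\<dots> = ((g \<rhd> (\<rho> \<lhd> u)) \<bullet> assoc C g v u) \<bullet> inv2 C (assoc C g v u)"
    using assms v' by (subst assoc_natural2[of \<rho> v v']) auto
  also have "\<dots> = g \<rhd> (\<rho> \<lhd> u)"
    using assms v' by simp
  finally show ?thesis by (simp add: whisk_reassoc_eq)
qed

text \<open>Restricting along \<open>u\<close> and then along \<open>y\<close> agrees with
  restricting along \<open>u \<cdot> y\<close>, up to associators of the inner legs. After
  composition with \<open>?X\<close>, a part of the pentagon on the source side, the target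
  pentagon, naturality at \<theta> and the source pentagon give the equation.\<close>

lemma whisk_reassoc_comp1:
  assumes "g \<in> Mor C" "v \<in> Mor C" "g' \<in> Mor C" "v' \<in> Mor C" "u \<in> Mor C" "y \<in> Mor C" "\<theta> \<in> Cell C"
    "src C g = trg C v" "src C g' = trg C v'" "src C v = trg C u" "src C v' = trg C u"
    "src C u = trg C y" "dom C \<theta> = g \<cdot> v" "cod C \<theta> = g' \<cdot> v'"
  shows "(g' \<rhd> assoc C v' u y) \<bullet>
      whisk_reassoc C (g, v \<cdot> u) (g', v' \<cdot> u) (whisk_reassoc C (g, v) (g', v') \<theta> u) y =
    whisk_reassoc C (g, v) (g', v') \<theta> (u \<cdot> y) \<bullet> (g \<rhd> assoc C v u y)"
    (is "?a' \<bullet> ?RR = ?R \<bullet> ?a")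
proof (rule iso_cancel_right)
  let ?X = "assoc C g (v \<cdot> u) y \<bullet> (assoc C g v u \<lhd> y)"
  let ?t = "whisk_reassoc C (g, v) (g', v') \<theta> u"
  have "?RR \<bullet> ?X = (?RR \<bullet> assoc C g (v \<cdot> u) y) \<bullet> (assoc C g v u \<lhd> y)"
    using assms by simp
  also have "\<dots> = assoc C g' (v' \<cdot> u) y \<bullet> (?t \<lhd> y) \<bullet> (assoc C g v u \<lhd> y)"
    using assms by (subst whisk_reassoc_assoc) auto
  also have "\<dots> = assoc C g' (v' \<cdot> u) y \<bullet> ((?t \<bullet> assoc C g v u) \<lhd> y)"
    using assms by (subst whisk_right_vcomp) auto
  also have "\<dots> = assoc C g' (v' \<cdot> u) y \<bullet> (assoc C g' v' u \<lhd> y) \<bullet> ((\<theta> \<lhd> u) \<lhd> y)"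
    using assms by (simp add: whisk_reassoc_assoc whisk_right_vcomp)
  finally have "(?a' \<bullet> ?RR) \<bullet> ?X =
      (?a' \<bullet> assoc C g' (v' \<cdot> u) y \<bullet> (assoc C g' v' u \<lhd> y)) \<bullet> ((\<theta> \<lhd> u) \<lhd> y)"
    using assms by simp
  also have "\<dots> = assoc C g' v' (u \<cdot> y) \<bullet> assoc C (g' \<cdot> v') u y \<bullet> ((\<theta> \<lhd> u) \<lhd> y)"
    using assms by (subst pentagon_Mor[symmetric]) auto
  also have "\<dots> = (assoc C g' v' (u \<cdot> y) \<bullet> (\<theta> \<lhd> u \<cdot> y)) \<bullet> assoc C (g \<cdot> v) u y"
    using assms by (subst assoc_natural1[of \<theta> "g \<cdot> v"]) auto
  also have "\<dots> = ?R \<bullet> assoc C g v (u \<cdot> y) \<bullet> assoc C (g \<cdot> v) u y"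
    using assms by (subst whisk_reassoc_assoc[symmetric]) auto
  also have "\<dots> = (?R \<bullet> ?a) \<bullet> ?X"
    using assms by (subst pentagon_Mor) auto
  finally show "(?a' \<bullet> ?RR) \<bullet> ?X = (?R \<bullet> ?a) \<bullet> ?X" .
qed (use assms in auto)

text \<open>The exchange law for \<theta> and \<mu>, framed by naturality of the associators in
  their last argument.\<close>

lemma whisk_reassoc_natural:
  assumes "g \<in> Mor C" "v \<in> Mor C" "g' \<in> Mor C" "v' \<in> Mor C" "\<mu> \<in> Cell C" "\<theta> \<in> Cell C"
    "dom C \<mu> = u" "cod C \<mu> = u'"
    "src C g = trg C v" "src C g' = trg C v'" "src C v = trg C u" "src C v' = trg C u"
    "dom C \<theta> = g \<cdot> v" "cod C \<theta> = g' \<cdot> v'"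
  shows "whisk_reassoc C (g, v) (g', v') \<theta> u' \<bullet> (g \<rhd> v \<rhd> \<mu>) =
    (g' \<rhd> v' \<rhd> \<mu>) \<bullet> whisk_reassoc C (g, v) (g', v') \<theta> u" (is "?R' \<bullet> ?m = ?m' \<bullet> ?R")
proof -
  have u: "u \<in> Mor C" "u' \<in> Mor C" "trg C u' = trg C u" "src C u' = src C u"
    using assms(9,11) parallel[OF assms(5,7,8)] by auto
  show ?thesis
  proof (rule iso_cancel_right[of "assoc C g v u"])
    have "(?R' \<bullet> ?m) \<bullet> assoc C g v u = ?R' \<bullet> assoc C g v u' \<bullet> (g \<cdot> v \<rhd> \<mu>)"
      using assms u by (subst assoc_natural3[of \<mu> u u']) auto
    also have "\<dots> = (?R' \<bullet> assoc C g v u') \<bullet> (g \<cdot> v \<rhd> \<mu>)"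
      using assms u by simp
    also have "\<dots> = assoc C g' v' u' \<bullet> ((\<theta> \<lhd> u') \<bullet> (g \<cdot> v \<rhd> \<mu>))"
      using assms u by (subst whisk_reassoc_assoc) auto
    also have "\<dots> = (assoc C g' v' u' \<bullet> (g' \<cdot> v' \<rhd> \<mu>)) \<bullet> (\<theta> \<lhd> u)"
      using assms u by (subst whisk_exchange[of \<mu> \<theta> u u']) auto
    also have "\<dots> = ?m' \<bullet> assoc C g' v' u \<bullet> (\<theta> \<lhd> u)"
      using assms u by (subst assoc_natural3[of \<mu> u u']) auto
    also have "\<dots> = (?m' \<bullet> ?R) \<bullet> assoc C g v u"
      using assms u by (subst whisk_reassoc_assoc[symmetric]) auto
    finally show "(?R' \<bullet> ?m) \<bullet> assoc C g v u = (?m' \<bullet> ?R) \<bullet> assoc C g v u" .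
  qed (use assms u in auto)
qed

section \<open>Transport along 2-cells between the legs\<close>

lemma whisk_left_vcomp3:
  assumes "g \<in> Mor C" "\<alpha> \<in> Cell C" "\<beta> \<in> Cell C" "\<gamma> \<in> Cell C"
    "dom C \<beta> = cod C \<alpha>" "dom C \<gamma> = cod C \<beta>" "src C g = trg C (dom C \<alpha>)"
  shows "g \<rhd> (\<gamma> \<bullet> \<beta> \<bullet> \<alpha>) = (g \<rhd> \<gamma>) \<bullet> (g \<rhd> \<beta>) \<bullet> (g \<rhd> \<alpha>)"
proof -
  have "trg C (dom C \<beta>) = trg C (dom C \<alpha>)"
    using assms by simp
  with assms show ?thesis by (simp add: whisk_left_vcomp)
qed

text \<open>\<open>whisk_reassoc\<close> preserves vertical composites and turns
  \<open>g \<rhd> \<sigma>\<close> into \<open>g \<rhd> (\<sigma> \<lhd> u)\<close>; hence transport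
  commutes with restriction.\<close>

lemma whisk_reassoc_transport:
  assumes mor: "g1 \<in> Mor C" "v1 \<in> Mor C" "g2 \<in> Mor C" "v2 \<in> Mor C" "v1' \<in> Mor C" "v2' \<in> Mor C" "u \<in> Mor C"
    and ty: "src C g1 = trg C v1" "src C g2 = trg C v2" "src C g1 = trg C v1'" "src C g2 = trg C v2'"
      "src C v1 = trg C u" "src C v2 = trg C u" "src C v1' = trg C u" "src C v2' = trg C u"
    and \<theta>: "\<theta> \<in> Cell C" "dom C \<theta> = g1 \<cdot> v1" "cod C \<theta> = g2 \<cdot> v2"
    and \<sigma>1: "\<sigma>1 \<in> Cell C" "dom C \<sigma>1 = v1'" "cod C \<sigma>1 = v1"
    and \<sigma>2: "\<sigma>2 \<in> Cell C" "dom C \<sigma>2 = v2" "cod C \<sigma>2 = v2'"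
  shows "whisk_reassoc C (g1, v1') (g2, v2') ((g2 \<rhd> \<sigma>2) \<bullet> \<theta> \<bullet> (g1 \<rhd> \<sigma>1)) u =
    (g2 \<rhd> (\<sigma>2 \<lhd> u)) \<bullet> whisk_reassoc C (g1, v1) (g2, v2) \<theta> u \<bullet> (g1 \<rhd> (\<sigma>1 \<lhd> u))"
proof -
  have "whisk_reassoc C (g1, v1') (g2, v2') ((g2 \<rhd> \<sigma>2) \<bullet> \<theta> \<bullet> (g1 \<rhd> \<sigma>1)) u =
    whisk_reassoc C (g2, v2) (g2, v2') (g2 \<rhd> \<sigma>2) u \<bullet> whisk_reassoc C (g1, v1) (g2, v2) \<theta> u \<bullet>
    whisk_reassoc C (g1, v1') (g1, v1) (g1 \<rhd> \<sigma>1) u"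
    using assms by (subst whisk_reassoc_vcomp[of _ _ g2 v2], simp_all, subst whisk_reassoc_vcomp, simp_all)
  then show ?thesis
    using assms by (simp add: whisk_reassoc_whisk_left)
qed

text \<open>A witness of equivalence can be restricted along any \<open>p\<close>; transitivity uses
  this to bring two witnesses to a common source. The hypothesis \<open>eq\<close> is restricted
  along \<open>p\<close>, and the twofold restrictions are merged by
  \<open>whisk_reassoc_comp1\<close>.\<close>

lemma whisk_reassoc_transport_iterated:
  assumes mor: "g1 \<in> Mor C" "v1 \<in> Mor C" "g2 \<in> Mor C" "v2 \<in> Mor C" "v1' \<in> Mor C" "v2' \<in> Mor C"
      "z \<in> Mor C" "z' \<in> Mor C" "p \<in> Mor C"
    and ty: "src C g1 = trg C v1" "src C g2 = trg C v2" "src C g1 = trg C v1'" "src C g2 = trg C v2'"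
      "src C v1 = trg C z" "src C v2 = trg C z" "src C v1' = trg C z'" "src C v2' = trg C z'"
      "src C z = trg C p" "src C z' = trg C p"
    and \<theta>: "\<theta> \<in> Cell C" "dom C \<theta> = g1 \<cdot> v1" "cod C \<theta> = g2 \<cdot> v2"
    and \<theta>': "\<theta>' \<in> Cell C" "dom C \<theta>' = g1 \<cdot> v1'" "cod C \<theta>' = g2 \<cdot> v2'"
    and \<sigma>1: "\<sigma>1 \<in> Cell C" "dom C \<sigma>1 = v1' \<cdot> z'" "cod C \<sigma>1 = v1 \<cdot> z"
    and \<sigma>2: "\<sigma>2 \<in> Cell C" "dom C \<sigma>2 = v2 \<cdot> z" "cod C \<sigma>2 = v2' \<cdot> z'"
    and eq: "(g2 \<rhd> \<sigma>2) \<bullet> whisk_reassoc C (g1, v1) (g2, v2) \<theta> z \<bullet> (g1 \<rhd> \<sigma>1) =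
      whisk_reassoc C (g1, v1') (g2, v2') \<theta>' z'"
  shows "(g2 \<rhd> whisk_reassoc C (v2, z) (v2', z') \<sigma>2 p) \<bullet>
      whisk_reassoc C (g1, v1) (g2, v2) \<theta> (z \<cdot> p) \<bullet>
      (g1 \<rhd> whisk_reassoc C (v1', z') (v1, z) \<sigma>1 p) =
    whisk_reassoc C (g1, v1') (g2, v2') \<theta>' (z' \<cdot> p)"
    (is "(g2 \<rhd> ?S2) \<bullet> ?R \<bullet> (g1 \<rhd> ?S1) = ?R'")
proof (rule iso_cancel_right)
  let ?r = "whisk_reassoc C (g1, v1) (g2, v2) \<theta> z"
  let ?r' = "whisk_reassoc C (g1, v1') (g2, v2') \<theta>' z'"
  let ?RR = "whisk_reassoc C (g1, v1 \<cdot> z) (g2, v2 \<cdot> z) ?r p"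
  let ?RR' = "whisk_reassoc C (g1, v1' \<cdot> z') (g2, v2' \<cdot> z') ?r' p"
  let ?X = "g1 \<rhd> assoc C v1' z' p"
  have RR: "?RR' = (g2 \<rhd> (\<sigma>2 \<lhd> p)) \<bullet> ?RR \<bullet> (g1 \<rhd> (\<sigma>1 \<lhd> p))"
    unfolding eq[symmetric] using assms by (subst whisk_reassoc_transport) auto
  have "?R' \<bullet> ?X = (g2 \<rhd> assoc C v2' z' p) \<bullet> ?RR'"
    using assms by (subst whisk_reassoc_comp1) auto
  also have "\<dots> = ((g2 \<rhd> assoc C v2' z' p) \<bullet> (g2 \<rhd> (\<sigma>2 \<lhd> p))) \<bullet> ?RR \<bullet> (g1 \<rhd> (\<sigma>1 \<lhd> p))"
    unfolding RR using assms by simp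
  also have "(g2 \<rhd> assoc C v2' z' p) \<bullet> (g2 \<rhd> (\<sigma>2 \<lhd> p)) = g2 \<rhd> (?S2 \<bullet> assoc C v2 z p)"
    using assms by (subst whisk_left_vcomp[symmetric]) (auto simp: whisk_reassoc_assoc)
  also have "\<dots> = (g2 \<rhd> ?S2) \<bullet> (g2 \<rhd> assoc C v2 z p)"
    using assms by (intro whisk_left_vcomp) auto
  also have "((g2 \<rhd> ?S2) \<bullet> (g2 \<rhd> assoc C v2 z p)) \<bullet> ?RR \<bullet> (g1 \<rhd> (\<sigma>1 \<lhd> p)) =
      (g2 \<rhd> ?S2) \<bullet> ((g2 \<rhd> assoc C v2 z p) \<bullet> ?RR) \<bullet> (g1 \<rhd> (\<sigma>1 \<lhd> p))"
    using assms by simp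
  also have "\<dots> = (g2 \<rhd> ?S2) \<bullet> ?R \<bullet> ((g1 \<rhd> assoc C v1 z p) \<bullet> (g1 \<rhd> (\<sigma>1 \<lhd> p)))"
    using assms by (subst whisk_reassoc_comp1) auto
  also have "(g1 \<rhd> assoc C v1 z p) \<bullet> (g1 \<rhd> (\<sigma>1 \<lhd> p)) = g1 \<rhd> (?S1 \<bullet> assoc C v1' z' p)"
    using assms by (subst whisk_left_vcomp[symmetric]) (auto simp: whisk_reassoc_assoc)
  also have "\<dots> = (g1 \<rhd> ?S1) \<bullet> ?X"
    using assms by (intro whisk_left_vcomp) auto
  finally show "((g2 \<rhd> ?S2) \<bullet> ?R \<bullet> (g1 \<rhd> ?S1)) \<bullet> ?X = ?R' \<bullet> ?X"
    using assms by simp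
qed (use assms in auto)

text \<open>The two witnesses share the middle 2-cell \<theta>', but their restricting 1-cells
  \<open>x'\<close> and \<open>y'\<close> agree only up to \<mu>. Naturality carries \<mu> across
  the restriction of \<theta>', where it cancels against its inverse.\<close>

lemma whisk_reassoc_transport_trans:
  assumes mor: "g1 \<in> Mor C" "v1 \<in> Mor C" "g2 \<in> Mor C" "v2 \<in> Mor C" "v1' \<in> Mor C" "v2' \<in> Mor C"
      "v1'' \<in> Mor C" "v2'' \<in> Mor C" "x \<in> Mor C" "x'' \<in> Mor C"
    and ty: "src C g1 = trg C v1" "src C g2 = trg C v2" "src C g1 = trg C v1'" "src C g2 = trg C v2'"
      "src C g1 = trg C v1''" "src C g2 = trg C v2''"
      "src C v1 = trg C x" "src C v2 = trg C x" "src C v1' = trg C x'" "src C v2' = trg C x'"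
      "src C v1'' = trg C x''" "src C v2'' = trg C x''"
    and \<theta>: "\<theta> \<in> Cell C" "dom C \<theta> = g1 \<cdot> v1" "cod C \<theta> = g2 \<cdot> v2"
    and \<theta>': "\<theta>' \<in> Cell C" "dom C \<theta>' = g1 \<cdot> v1'" "cod C \<theta>' = g2 \<cdot> v2'"
    and \<sigma>1: "\<sigma>1 \<in> Cell C" "dom C \<sigma>1 = v1' \<cdot> x'" "cod C \<sigma>1 = v1 \<cdot> x"
    and \<sigma>2: "\<sigma>2 \<in> Cell C" "dom C \<sigma>2 = v2 \<cdot> x" "cod C \<sigma>2 = v2' \<cdot> x'"
    and \<mu>: "iso \<mu>" "dom C \<mu> = x'" "cod C \<mu> = y'"
    and \<tau>1: "\<tau>1 \<in> Cell C" "dom C \<tau>1 = v1'' \<cdot> x''" "cod C \<tau>1 = v1' \<cdot> y'"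
    and \<tau>2: "\<tau>2 \<in> Cell C" "dom C \<tau>2 = v2' \<cdot> y'" "cod C \<tau>2 = v2'' \<cdot> x''"
    and eq: "(g2 \<rhd> \<sigma>2) \<bullet> whisk_reassoc C (g1, v1) (g2, v2) \<theta> x \<bullet> (g1 \<rhd> \<sigma>1) =
      whisk_reassoc C (g1, v1') (g2, v2') \<theta>' x'"
    and eq': "(g2 \<rhd> \<tau>2) \<bullet> whisk_reassoc C (g1, v1') (g2, v2') \<theta>' y' \<bullet> (g1 \<rhd> \<tau>1) =
      whisk_reassoc C (g1, v1'') (g2, v2'') \<theta>'' x''"
  shows "(g2 \<rhd> (\<tau>2 \<bullet> (v2' \<rhd> \<mu>) \<bullet> \<sigma>2)) \<bullet> whisk_reassoc C (g1, v1) (g2, v2) \<theta> x \<bullet>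
      (g1 \<rhd> (\<sigma>1 \<bullet> (v1' \<rhd> inv2 C \<mu>) \<bullet> \<tau>1)) =
    whisk_reassoc C (g1, v1'') (g2, v2'') \<theta>'' x''"
proof -
  let ?R = "whisk_reassoc C (g1, v1) (g2, v2) \<theta> x"
  let ?R' = "whisk_reassoc C (g1, v1') (g2, v2') \<theta>'"
  note x' = parallel[OF iso_Cell[OF \<mu>(1)] \<mu>(2,3)]
  have inv: "(g1 \<rhd> v1' \<rhd> \<mu>) \<bullet> (g1 \<rhd> v1' \<rhd> inv2 C \<mu>) = id2 C (g1 \<cdot> v1' \<cdot> y')"
    using assms x' by (simp add: whisk_left_vcomp[symmetric])
  have "(g2 \<rhd> (\<tau>2 \<bullet> (v2' \<rhd> \<mu>) \<bullet> \<sigma>2)) \<bullet> ?R \<bullet> (g1 \<rhd> (\<sigma>1 \<bullet> (v1' \<rhd> inv2 C \<mu>) \<bullet> \<tau>1)) =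
      (g2 \<rhd> \<tau>2) \<bullet> (g2 \<rhd> v2' \<rhd> \<mu>) \<bullet> ((g2 \<rhd> \<sigma>2) \<bullet> ?R \<bullet> (g1 \<rhd> \<sigma>1)) \<bullet> (g1 \<rhd> v1' \<rhd> inv2 C \<mu>) \<bullet> (g1 \<rhd> \<tau>1)"
    using mor ty \<theta> \<theta>' \<sigma>1 \<sigma>2 \<mu> \<tau>1 \<tau>2 x' by (simp add: whisk_left_vcomp3)
  also have "\<dots> = (g2 \<rhd> \<tau>2) \<bullet> ((g2 \<rhd> v2' \<rhd> \<mu>) \<bullet> ?R' x') \<bullet> (g1 \<rhd> v1' \<rhd> inv2 C \<mu>) \<bullet> (g1 \<rhd> \<tau>1)"
    unfolding eq using mor ty \<theta> \<theta>' \<sigma>1 \<sigma>2 \<mu> \<tau>1 \<tau>2 x' by simp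
  also have "(g2 \<rhd> v2' \<rhd> \<mu>) \<bullet> ?R' x' = ?R' y' \<bullet> (g1 \<rhd> v1' \<rhd> \<mu>)"
    using mor ty \<theta> \<theta>' \<sigma>1 \<sigma>2 \<mu> \<tau>1 \<tau>2 x' by (subst whisk_reassoc_natural[of _ _ _ _ \<mu>]) auto
  also have "(g2 \<rhd> \<tau>2) \<bullet> (?R' y' \<bullet> (g1 \<rhd> v1' \<rhd> \<mu>)) \<bullet> (g1 \<rhd> v1' \<rhd> inv2 C \<mu>) \<bullet> (g1 \<rhd> \<tau>1) =
      (g2 \<rhd> \<tau>2) \<bullet> ?R' y' \<bullet> ((g1 \<rhd> v1' \<rhd> \<mu>) \<bullet> (g1 \<rhd> v1' \<rhd> inv2 C \<mu>)) \<bullet> (g1 \<rhd> \<tau>1)"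
    using mor ty \<theta> \<theta>' \<sigma>1 \<sigma>2 \<mu> \<tau>1 \<tau>2 x' by simp
  also have "\<dots> = (g2 \<rhd> \<tau>2) \<bullet> ?R' y' \<bullet> (g1 \<rhd> \<tau>1)"
    unfolding inv using mor ty \<theta> \<theta>' \<sigma>1 \<sigma>2 \<mu> \<tau>1 \<tau>2 x' by simp
  finally show ?thesis unfolding eq' .
qed

text \<open>A lifting along a composite \<open>g \<cdot> h\<close> speaks of restriction with outer
  leg \<open>g \<cdot> h\<close>, whereas pasting uses outer leg \<open>g\<close> and inner leg
  \<open>h \<cdot> v\<close>. The two differ by associators only, by the pentagon on the source and
  on the target.\<close>

lemma whisk_reassoc_rebracket:
  assumes "g \<in> Mor C" "h \<in> Mor C" "v \<in> Mor C" "g' \<in> Mor C" "h' \<in> Mor C" "v' \<in> Mor C" "s \<in> Mor C"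
    and "src C g = trg C h" "src C h = trg C v" "src C g' = trg C h'" "src C h' = trg C v'"
      "src C v = trg C s" "src C v' = trg C s"
    and "\<kappa> \<in> Cell C" "dom C \<kappa> = (g \<cdot> h) \<cdot> v" "cod C \<kappa> = (g' \<cdot> h') \<cdot> v'"
  shows "(g' \<rhd> assoc C h' v' s) \<bullet> whisk_reassoc C (g, h \<cdot> v) (g', h' \<cdot> v')
      (assoc C g' h' v' \<bullet> \<kappa> \<bullet> inv2 C (assoc C g h v)) s =
    assoc C g' h' (v' \<cdot> s) \<bullet> whisk_reassoc C (g \<cdot> h, v) (g' \<cdot> h', v') \<kappa> s \<bullet>
      inv2 C (assoc C g h (v \<cdot> s)) \<bullet> (g \<rhd> assoc C h v s)"

proof (rule iso_cancel_right)
  let ?b' = "g' \<rhd> assoc C h' v' s" and ?c' = "assoc C g' h' (v' \<cdot> s)"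
  let ?b = "g \<rhd> assoc C h v s" and ?c = "assoc C g h (v \<cdot> s)"
  let ?R = "whisk_reassoc C (g \<cdot> h, v) (g' \<cdot> h', v') \<kappa> s"
  let ?Q = "whisk_reassoc C (g, h \<cdot> v) (g', h' \<cdot> v')
      (assoc C g' h' v' \<bullet> \<kappa> \<bullet> inv2 C (assoc C g h v)) s"
  let ?X = "assoc C g (h \<cdot> v) s \<bullet> (assoc C g h v \<lhd> s)"
  let ?\<kappa> = "assoc C g' h' v' \<bullet> \<kappa> \<bullet> inv2 C (assoc C g h v)"
  have "(?b' \<bullet> ?Q) \<bullet> ?X = ?b' \<bullet> (?Q \<bullet> assoc C g (h \<cdot> v) s) \<bullet> (assoc C g h v \<lhd> s)"
    using assms by simp
  also have "\<dots> = ?b' \<bullet> assoc C g' (h' \<cdot> v') s \<bullet> ((?\<kappa> \<lhd> s) \<bullet> (assoc C g h v \<lhd> s))"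
    using assms by (subst whisk_reassoc_assoc) auto
  also have "(?\<kappa> \<lhd> s) \<bullet> (assoc C g h v \<lhd> s) = (assoc C g' h' v' \<lhd> s) \<bullet> (\<kappa> \<lhd> s)"
    using assms by (simp add: whisk_right_vcomp[symmetric])
  also have "?b' \<bullet> assoc C g' (h' \<cdot> v') s \<bullet> (assoc C g' h' v' \<lhd> s) \<bullet> (\<kappa> \<lhd> s) =
      (?b' \<bullet> assoc C g' (h' \<cdot> v') s \<bullet> (assoc C g' h' v' \<lhd> s)) \<bullet> (\<kappa> \<lhd> s)"
    using assms by simp
  also have "\<dots> = ?c' \<bullet> assoc C (g' \<cdot> h') v' s \<bullet> (\<kappa> \<lhd> s)"
    using assms by (subst pentagon_Mor[symmetric]) auto
  also have "assoc C (g' \<cdot> h') v' s \<bullet> (\<kappa> \<lhd> s) = ?R \<bullet> assoc C (g \<cdot> h) v s"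
    using assms by (subst whisk_reassoc_assoc) auto
  \<comment> \<open>Inserting \<open>?c\<close> and its inverse exposes one side of the source
    pentagon.\<close>
  also have "assoc C (g \<cdot> h) v s = inv2 C ?c \<bullet> ?c \<bullet> assoc C (g \<cdot> h) v s"
    using assms by simp
  also have "?c \<bullet> assoc C (g \<cdot> h) v s = ?b \<bullet> ?X"
    using assms by (subst pentagon_Mor) auto
  also have "?c' \<bullet> ?R \<bullet> inv2 C ?c \<bullet> ?b \<bullet> ?X = (?c' \<bullet> ?R \<bullet> inv2 C ?c \<bullet> ?b) \<bullet> ?X"
    using assms by simp
  finally show "(?b' \<bullet> ?Q) \<bullet> ?X = (?c' \<bullet> ?R \<bullet> inv2 C ?c \<bullet> ?b) \<bullet> ?X" .
qed (use assms in auto)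

lemma transport_sym:
  assumes mor: "g1 \<in> Mor C" "g2 \<in> Mor C"
    and \<sigma>1: "iso \<sigma>1" "dom C \<sigma>1 = x1'" "cod C \<sigma>1 = x1" and \<sigma>2: "iso \<sigma>2" "dom C \<sigma>2 = x2" "cod C \<sigma>2 = x2'"
    and ty: "src C g1 = trg C x1" "src C g2 = trg C x2"
    and \<theta>: "\<theta> \<in> Cell C" "dom C \<theta> = g1 \<cdot> x1" "cod C \<theta> = g2 \<cdot> x2"
    and eq: "(g2 \<rhd> \<sigma>2) \<bullet> \<theta> \<bullet> (g1 \<rhd> \<sigma>1) = \<theta>'"
  shows "(g2 \<rhd> inv2 C \<sigma>2) \<bullet> \<theta>' \<bullet> (g1 \<rhd> inv2 C \<sigma>1) = \<theta>"
proof -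
  note par = parallel[OF iso_Cell[OF \<sigma>1(1)] \<sigma>1(2,3)] parallel[OF iso_Cell[OF \<sigma>2(1)] \<sigma>2(2,3)]
  show ?thesis
    unfolding eq[symmetric] using mor \<sigma>1 \<sigma>2 ty \<theta> par
    by (simp add: whisk_left_inv whisk_left_inv_cancel)
qed

lemma whisk_reassoc_comp1_inv:
  assumes "g \<in> Mor C" "v \<in> Mor C" "g' \<in> Mor C" "v' \<in> Mor C" "u \<in> Mor C" "y \<in> Mor C" "\<theta> \<in> Cell C"
    "src C g = trg C v" "src C g' = trg C v'" "src C v = trg C u" "src C v' = trg C u"
    "src C u = trg C y" "dom C \<theta> = g \<cdot> v" "cod C \<theta> = g' \<cdot> v'"
  shows "whisk_reassoc C (g, v \<cdot> u) (g', v' \<cdot> u) (whisk_reassoc C (g, v) (g', v') \<theta> u) y \<bullet>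
      (g \<rhd> inv2 C (assoc C v u y)) =
    (g' \<rhd> inv2 C (assoc C v' u y)) \<bullet> whisk_reassoc C (g, v) (g', v') \<theta> (u \<cdot> y)"
    (is "?RR \<bullet> ?i = ?i' \<bullet> ?R")
proof -
  have "?RR \<bullet> ?i = ?i' \<bullet> ((g' \<rhd> assoc C v' u y) \<bullet> ?RR) \<bullet> ?i"
    using assms by (simp add: whisk_left_inv_cancel)
  also have "\<dots> = ?i' \<bullet> ?R"
    using assms by (subst whisk_reassoc_comp1) (auto simp: whisk_left_inv)
  finally show ?thesis .
qed

text \<open>With the legs in \<open>W\<close> as \<open>g1 g2 g3\<close> this is \<xi>, with the
  other legs it is \<gamma>; each identity is thereby proved once for both.\<close>

definition paste :: "'a \<Rightarrow> 'a \<Rightarrow> 'a \<Rightarrow> 'a \<Rightarrow> 'a \<Rightarrow> 'a \<Rightarrow> 'a \<Rightarrow> 'c \<Rightarrow> 'c \<Rightarrow> 'a \<Rightarrow> 'a \<Rightarrow> 'c \<Rightarrow> 'c" where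
  "paste g1 g2 g3 u1 u2 u3 u4 \<theta>1 \<theta>2 t1 t2 \<rho> =
    whisk_reassoc C (g2, u3) (g3, u4) \<theta>2 t2 \<bullet> (g2 \<rhd> \<rho>) \<bullet> whisk_reassoc C (g1, u1) (g2, u2) \<theta>1 t1"

text \<open>Since \<rho> itself may fail to be invertible, the argument goes through
  \<open>w \<rhd> \<rho>\<close>: up to associators, \<open>w\<close> whiskered with the restriction
  of \<rho> is the restriction of \<open>w \<rhd> \<rho>\<close>.\<close>

lemma iso_whisk_left_reassoc:
  assumes "w \<in> Mor C" "u2 \<in> Mor C" "u3 \<in> Mor C" "t1 \<in> Mor C" "t2 \<in> Mor C" "z \<in> Mor C"
    "src C w = trg C u2" "trg C u3 = trg C u2" "src C u2 = trg C t1" "src C u3 = trg C t2"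
    "src C t1 = trg C z" "src C t2 = trg C z" "\<rho> \<in> Cell C" "dom C \<rho> = u2 \<cdot> t1" "cod C \<rho> = u3 \<cdot> t2"
    "iso (w \<rhd> \<rho>)"
  shows "iso (w \<rhd> whisk_reassoc C (u2, t1) (u3, t2) \<rho> z)"
proof -
  have "w \<rhd> whisk_reassoc C (u2, t1) (u3, t2) \<rho> z =
      (w \<rhd> assoc C u3 t2 z) \<bullet> (w \<rhd> (\<rho> \<lhd> z)) \<bullet> (w \<rhd> inv2 C (assoc C u2 t1 z))"
    unfolding whisk_reassoc_eq by (rule whisk_left_vcomp3) (simp_all add: assms)
  moreover have "w \<rhd> (\<rho> \<lhd> z) = whisk_reassoc C (w, u2 \<cdot> t1) (w, u3 \<cdot> t2) (w \<rhd> \<rho>) z"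
    by (rule whisk_reassoc_whisk_left[symmetric]) (simp_all add: assms)
  ultimately show ?thesis by (simp add: assms)
qed

text \<open>\<open>whisk_reassoc\<close> sees a 2-cell only through its whiskering with
  \<open>s\<close>, so a square that commutes merely after whiskering with \<open>s\<close> yields a
  commuting square of restrictions.\<close>

lemma whisk_reassoc_square:
  assumes mor: "u2 \<in> Mor C" "u3 \<in> Mor C" "s \<in> Mor C" "trg C u2 = trg C u3"
    and \<rho>: "\<rho> \<in> Cell C" "dom C \<rho> = u2 \<cdot> t1" "cod C \<rho> = u3 \<cdot> t2"
    and \<rho>': "\<rho>' \<in> Cell C" "dom C \<rho>' = u2 \<cdot> t1'" "cod C \<rho>' = u3 \<cdot> t2'"
    and \<mu>: "\<mu> \<in> Cell C" "dom C \<mu> = t1" "cod C \<mu> = t1'"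
    and \<nu>: "\<nu> \<in> Cell C" "dom C \<nu> = t2" "cod C \<nu> = t2'"
    and ty: "trg C t1 = src C u2" "trg C t2 = src C u3" "src C t1 = trg C s" "src C t2 = trg C s"
    and eq: "((u3 \<rhd> \<nu>) \<bullet> \<rho>) \<lhd> s = (\<rho>' \<bullet> (u2 \<rhd> \<mu>)) \<lhd> s"
  shows "(u3 \<rhd> (\<nu> \<lhd> s)) \<bullet> whisk_reassoc C (u2, t1) (u3, t2) \<rho> s =
    whisk_reassoc C (u2, t1') (u3, t2') \<rho>' s \<bullet> (u2 \<rhd> (\<mu> \<lhd> s))"
proof -
  note par = parallel[OF \<mu>] parallel[OF \<nu>]
  note S = mor \<rho> \<rho>' \<mu> \<nu> ty par
  have "(u3 \<rhd> (\<nu> \<lhd> s)) \<bullet> whisk_reassoc C (u2, t1) (u3, t2) \<rho> s =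
      whisk_reassoc C (u2, t1) (u3, t2') ((u3 \<rhd> \<nu>) \<bullet> \<rho>) s"
    by (subst whisk_reassoc_vcomp[of _ _ u3 t2]) (simp_all add: S whisk_reassoc_whisk_left)
  also have "\<dots> = whisk_reassoc C (u2, t1) (u3, t2') (\<rho>' \<bullet> (u2 \<rhd> \<mu>)) s"
    unfolding whisk_reassoc_eq eq ..
  also have "\<dots> = whisk_reassoc C (u2, t1') (u3, t2') \<rho>' s \<bullet> (u2 \<rhd> (\<mu> \<lhd> s))"
    by (subst whisk_reassoc_vcomp[of _ _ u2 t1']) (simp_all add: S whisk_reassoc_whisk_left)
  finally show ?thesis .
qed

text \<open>\<kappa> compares \<open>t2\<close> with \<open>t2'\<close> under the outer leg
  \<open>w \<cdot> u3\<close>, compatibly with \<rho>, \<rho>' and \<mu>, and \<nu> is its lifting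
  after restriction along \<open>s\<close>. Restricting \<open>eq\<close> along \<open>s\<close> and
  replacing the restricted \<kappa> by \<nu> gives the square for \<nu>, with \<open>w\<close> still
  in front.\<close>

lemma lifted_square:
  assumes mor: "w \<in> Mor C" "u2 \<in> Mor C" "u3 \<in> Mor C" "t2 \<in> Mor C" "t2' \<in> Mor C" "s \<in> Mor C"
    and ty: "src C w = trg C u2" "trg C u3 = trg C u2" "trg C t1 = src C u2" "trg C t2 = src C u3"
      "trg C t2' = src C u3" "src C t1 = trg C s" "src C t2 = trg C s" "src C t2' = trg C s"
    and \<rho>: "\<rho> \<in> Cell C" "dom C \<rho> = u2 \<cdot> t1" "cod C \<rho> = u3 \<cdot> t2"
    and \<rho>': "\<rho>' \<in> Cell C" "dom C \<rho>' = u2 \<cdot> t1'" "cod C \<rho>' = u3 \<cdot> t2'"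
    and \<mu>: "\<mu> \<in> Cell C" "dom C \<mu> = t1" "cod C \<mu> = t1'"
    and \<kappa>: "\<kappa> \<in> Cell C" "dom C \<kappa> = (w \<cdot> u3) \<cdot> t2" "cod C \<kappa> = (w \<cdot> u3) \<cdot> t2'"
    and \<nu>: "\<nu> \<in> Cell C" "dom C \<nu> = t2 \<cdot> s" "cod C \<nu> = t2' \<cdot> s"
    and lift: "whisk_reassoc C (w \<cdot> u3, t2) (w \<cdot> u3, t2') \<kappa> s = w \<cdot> u3 \<rhd> \<nu>"
    and eq: "(assoc C w u3 t2' \<bullet> \<kappa> \<bullet> inv2 C (assoc C w u3 t2)) \<bullet> (w \<rhd> \<rho>) = (w \<rhd> \<rho>') \<bullet> (w \<rhd> u2 \<rhd> \<mu>)"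
  shows "w \<rhd> ((u3 \<rhd> \<nu>) \<bullet> whisk_reassoc C (u2, t1) (u3, t2) \<rho> s) =
    w \<rhd> (whisk_reassoc C (u2, t1') (u3, t2') \<rho>' s \<bullet> (u2 \<rhd> (\<mu> \<lhd> s)))"
proof (rule iso_cancel_right)
  note par = parallel[OF \<mu>]
  have t1': "t1 \<in> Mor C" "t1' \<in> Mor C" "src C t1' = trg C s" "trg C t1' = src C u2"
    using par ty by auto
  note S = mor ty \<rho> \<rho>' \<mu> \<kappa> \<nu> t1'
  let ?\<kappa> = "assoc C w u3 t2' \<bullet> \<kappa> \<bullet> inv2 C (assoc C w u3 t2)"
  let ?K = "whisk_reassoc C (w, u3 \<cdot> t2) (w, u3 \<cdot> t2') ?\<kappa> s"
  let ?R = "whisk_reassoc C (u2, t1) (u3, t2) \<rho> s" and ?R' = "whisk_reassoc C (u2, t1') (u3, t2') \<rho>' s"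
  let ?X = "w \<rhd> assoc C u2 t1 s"
  \<comment> \<open>The restricted comparison \<open>?K\<close> is
    \<open>w \<rhd> u3 \<rhd> \<nu>\<close> up to associators of the inner legs.\<close>
  have "(w \<rhd> assoc C u3 t2' s) \<bullet> ?K =
      assoc C w u3 (t2' \<cdot> s) \<bullet> (w \<cdot> u3 \<rhd> \<nu>) \<bullet> inv2 C (assoc C w u3 (t2 \<cdot> s)) \<bullet> (w \<rhd> assoc C u3 t2 s)"
    unfolding lift[symmetric] by (rule whisk_reassoc_rebracket) (simp_all add: S)
  also have "\<dots> = (assoc C w u3 (t2' \<cdot> s) \<bullet> (w \<cdot> u3 \<rhd> \<nu>)) \<bullet>
      inv2 C (assoc C w u3 (t2 \<cdot> s)) \<bullet> (w \<rhd> assoc C u3 t2 s)"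
    by (simp add: S)
  also have "assoc C w u3 (t2' \<cdot> s) \<bullet> (w \<cdot> u3 \<rhd> \<nu>) = (w \<rhd> u3 \<rhd> \<nu>) \<bullet> assoc C w u3 (t2 \<cdot> s)"
    by (rule assoc_natural3) (simp_all add: S)
  also have "((w \<rhd> u3 \<rhd> \<nu>) \<bullet> assoc C w u3 (t2 \<cdot> s)) \<bullet>
      inv2 C (assoc C w u3 (t2 \<cdot> s)) \<bullet> (w \<rhd> assoc C u3 t2 s) = (w \<rhd> u3 \<rhd> \<nu>) \<bullet> (w \<rhd> assoc C u3 t2 s)"
    by (simp add: S)
  finally have E1: "(w \<rhd> u3 \<rhd> \<nu>) \<bullet> (w \<rhd> assoc C u3 t2 s) = (w \<rhd> assoc C u3 t2' s) \<bullet> ?K" ..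
  \<comment> \<open>The hypothesis \<open>eq\<close>, restricted along \<open>s\<close>.\<close>
  have "?K \<bullet> (w \<rhd> (\<rho> \<lhd> s)) = whisk_reassoc C (w, u2 \<cdot> t1) (w, u3 \<cdot> t2') (?\<kappa> \<bullet> (w \<rhd> \<rho>)) s"
    by (subst whisk_reassoc_vcomp[of _ _ w "u3 \<cdot> t2"]) (simp_all add: S whisk_reassoc_whisk_left)
  also have "\<dots> = whisk_reassoc C (w, u2 \<cdot> t1) (w, u3 \<cdot> t2') ((w \<rhd> \<rho>') \<bullet> (w \<rhd> u2 \<rhd> \<mu>)) s"
    unfolding eq ..
  also have "\<dots> = (w \<rhd> (\<rho>' \<lhd> s)) \<bullet> (w \<rhd> ((u2 \<rhd> \<mu>) \<lhd> s))"
    by (subst whisk_reassoc_vcomp[of _ _ w "u2 \<cdot> t1'"]) (simp_all add: S whisk_reassoc_whisk_left)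
  finally have E2: "?K \<bullet> (w \<rhd> (\<rho> \<lhd> s)) = (w \<rhd> (\<rho>' \<lhd> s)) \<bullet> (w \<rhd> ((u2 \<rhd> \<mu>) \<lhd> s))" .
  have "(w \<rhd> ((u3 \<rhd> \<nu>) \<bullet> ?R)) \<bullet> ?X = (w \<rhd> u3 \<rhd> \<nu>) \<bullet> (w \<rhd> (?R \<bullet> assoc C u2 t1 s))"
    by (simp add: S whisk_left_vcomp)
  also have "\<dots> = ((w \<rhd> u3 \<rhd> \<nu>) \<bullet> (w \<rhd> assoc C u3 t2 s)) \<bullet> (w \<rhd> (\<rho> \<lhd> s))"
    by (simp add: S whisk_left_vcomp whisk_reassoc_assoc)
  also have "\<dots> = (w \<rhd> assoc C u3 t2' s) \<bullet> (?K \<bullet> (w \<rhd> (\<rho> \<lhd> s)))"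
    unfolding E1 by (simp add: S)
  also have "\<dots> = ((w \<rhd> assoc C u3 t2' s) \<bullet> (w \<rhd> (\<rho>' \<lhd> s))) \<bullet> (w \<rhd> ((u2 \<rhd> \<mu>) \<lhd> s))"
    unfolding E2 by (simp add: S)
  also have "(w \<rhd> assoc C u3 t2' s) \<bullet> (w \<rhd> (\<rho>' \<lhd> s)) = w \<rhd> (assoc C u3 t2' s \<bullet> (\<rho>' \<lhd> s))"
    by (rule whisk_left_vcomp[symmetric]) (simp_all add: S)
  also have "assoc C u3 t2' s \<bullet> (\<rho>' \<lhd> s) = ?R' \<bullet> assoc C u2 t1' s"
    by (rule whisk_reassoc_assoc[symmetric]) (simp_all add: S)
  also have "(w \<rhd> (?R' \<bullet> assoc C u2 t1' s)) \<bullet> (w \<rhd> ((u2 \<rhd> \<mu>) \<lhd> s)) =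
      (w \<rhd> ?R') \<bullet> (w \<rhd> (assoc C u2 t1' s \<bullet> ((u2 \<rhd> \<mu>) \<lhd> s)))"
    by (simp add: S whisk_left_vcomp)
  also have "assoc C u2 t1' s \<bullet> ((u2 \<rhd> \<mu>) \<lhd> s) = (u2 \<rhd> (\<mu> \<lhd> s)) \<bullet> assoc C u2 t1 s"
    by (rule assoc_natural2) (simp_all add: S)
  also have "(w \<rhd> ?R') \<bullet> (w \<rhd> ((u2 \<rhd> (\<mu> \<lhd> s)) \<bullet> assoc C u2 t1 s)) =
      (w \<rhd> (?R' \<bullet> (u2 \<rhd> (\<mu> \<lhd> s)))) \<bullet> ?X"
    by (simp add: S whisk_left_vcomp)
  finally show "(w \<rhd> ((u3 \<rhd> \<nu>) \<bullet> ?R)) \<bullet> ?X = (w \<rhd> (?R' \<bullet> (u2 \<rhd> (\<mu> \<lhd> s)))) \<bullet> ?X" .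
qed (use parallel[OF \<mu>] in \<open>simp_all add: mor ty \<rho> \<rho>' \<mu> \<nu>\<close>)

end

section \<open>Pasting along a 2-cell\<close>

text \<open>Instantiated both with the legs in \<open>W\<close> and with the other legs of three fractions.\<close>

locale paste_data = bicategory C for C :: "('o, 'a, 'c, 'm) bicat_scheme" (structure) +
  fixes g1 g2 g3 u1 u2 u3 u4 :: 'a and \<theta>1 \<theta>2 :: 'c
  assumes mor [simp]: "g1 \<in> Mor C" "g2 \<in> Mor C" "g3 \<in> Mor C"
      "u1 \<in> Mor C" "u2 \<in> Mor C" "u3 \<in> Mor C" "u4 \<in> Mor C"
    and ty [simp]: "src C g1 = trg C u1" "src C g2 = trg C u2" "trg C u3 = trg C u2" "src C g3 = trg C u4"
      "src C u2 = src C u1" "src C u4 = src C u3"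
    and \<theta>1 [simp]: "\<theta>1 \<in> Cell C" "dom C \<theta>1 = g1 \<cdot> u1" "cod C \<theta>1 = g2 \<cdot> u2"
    and \<theta>2 [simp]: "\<theta>2 \<in> Cell C" "dom C \<theta>2 = g2 \<cdot> u3" "cod C \<theta>2 = g3 \<cdot> u4"
begin

text \<open>\<rho> enters the pasting only through \<open>g2 \<rhd> \<rho>\<close>, whence the form
  of the last claim.\<close>

lemma paste_simps:
  assumes "t1 \<in> Mor C" "t2 \<in> Mor C" "trg C t1 = src C u1" "trg C t2 = src C u3"
    "\<rho> \<in> Cell C" "dom C \<rho> = u2 \<cdot> t1" "cod C \<rho> = u3 \<cdot> t2"
  shows "paste g1 g2 g3 u1 u2 u3 u4 \<theta>1 \<theta>2 t1 t2 \<rho> \<in> Cell C"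
    "dom C (paste g1 g2 g3 u1 u2 u3 u4 \<theta>1 \<theta>2 t1 t2 \<rho>) = g1 \<cdot> u1 \<cdot> t1"
    "cod C (paste g1 g2 g3 u1 u2 u3 u4 \<theta>1 \<theta>2 t1 t2 \<rho>) = g3 \<cdot> u4 \<cdot> t2"
    "\<lbrakk>iso \<theta>1; iso \<theta>2; iso (g2 \<rhd> \<rho>)\<rbrakk> \<Longrightarrow> iso (paste g1 g2 g3 u1 u2 u3 u4 \<theta>1 \<theta>2 t1 t2 \<rho>)"
  using assms by (simp_all add: paste_def)

text \<open>The three factors are restricted separately. The associators left between them conjugate
  \<open>g2 \<rhd> (\<rho> \<lhd> z)\<close> into the rebracketed restriction of \<rho>; those of
  the outer legs make up the transport on the left-hand side.\<close>

lemma paste_restrict: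
  assumes t: "t1 \<in> Mor C" "t2 \<in> Mor C" "trg C t1 = src C u1" "trg C t2 = src C u3" "src C t2 = src C t1"
    and \<rho>: "\<rho> \<in> Cell C" "dom C \<rho> = u2 \<cdot> t1" "cod C \<rho> = u3 \<cdot> t2"
    and z: "z \<in> Mor C" "trg C z = src C t1"
  shows "(g3 \<rhd> assoc C u4 t2 z) \<bullet>
      whisk_reassoc C (g1, u1 \<cdot> t1) (g3, u4 \<cdot> t2) (paste g1 g2 g3 u1 u2 u3 u4 \<theta>1 \<theta>2 t1 t2 \<rho>) z \<bullet>
      (g1 \<rhd> inv2 C (assoc C u1 t1 z)) =
    paste g1 g2 g3 u1 u2 u3 u4 \<theta>1 \<theta>2 (t1 \<cdot> z) (t2 \<cdot> z) (whisk_reassoc C (u2, t1) (u3, t2) \<rho> z)"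
proof -
  let ?R1 = "whisk_reassoc C (g1, u1) (g2, u2) \<theta>1" and ?R2 = "whisk_reassoc C (g2, u3) (g3, u4) \<theta>2"
  let ?RR1 = "whisk_reassoc C (g1, u1 \<cdot> t1) (g2, u2 \<cdot> t1) (?R1 t1) z"
  let ?RR2 = "whisk_reassoc C (g2, u3 \<cdot> t2) (g3, u4 \<cdot> t2) (?R2 t2) z"
  let ?a = "\<lambda>u t. assoc C u t z"
  have "whisk_reassoc C (g1, u1 \<cdot> t1) (g3, u4 \<cdot> t2) (?R2 t2 \<bullet> (g2 \<rhd> \<rho>) \<bullet> ?R1 t1) z =
      ?RR2 \<bullet> whisk_reassoc C (g1, u1 \<cdot> t1) (g2, u3 \<cdot> t2) ((g2 \<rhd> \<rho>) \<bullet> ?R1 t1) z"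
    by (rule whisk_reassoc_vcomp) (simp_all add: t \<rho> z)
  also have "whisk_reassoc C (g1, u1 \<cdot> t1) (g2, u3 \<cdot> t2) ((g2 \<rhd> \<rho>) \<bullet> ?R1 t1) z =
      whisk_reassoc C (g2, u2 \<cdot> t1) (g2, u3 \<cdot> t2) (g2 \<rhd> \<rho>) z \<bullet> ?RR1"
    by (rule whisk_reassoc_vcomp) (simp_all add: t \<rho> z)
  also have "whisk_reassoc C (g2, u2 \<cdot> t1) (g2, u3 \<cdot> t2) (g2 \<rhd> \<rho>) z = g2 \<rhd> (\<rho> \<lhd> z)"
    by (rule whisk_reassoc_whisk_left) (simp_all add: t \<rho> z)
  finally have "(g3 \<rhd> ?a u4 t2) \<bullet>
      whisk_reassoc C (g1, u1 \<cdot> t1) (g3, u4 \<cdot> t2) (?R2 t2 \<bullet> (g2 \<rhd> \<rho>) \<bullet> ?R1 t1) z \<bullet> (g1 \<rhd> inv2 C (?a u1 t1)) =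
      ((g3 \<rhd> ?a u4 t2) \<bullet> ?RR2) \<bullet> (g2 \<rhd> (\<rho> \<lhd> z)) \<bullet> ?RR1 \<bullet> (g1 \<rhd> inv2 C (?a u1 t1))"
    by (simp add: t \<rho> z)
  also have "(g3 \<rhd> ?a u4 t2) \<bullet> ?RR2 = ?R2 (t2 \<cdot> z) \<bullet> (g2 \<rhd> ?a u3 t2)"
    by (rule whisk_reassoc_comp1) (simp_all add: t z)
  also have "?RR1 \<bullet> (g1 \<rhd> inv2 C (?a u1 t1)) = (g2 \<rhd> inv2 C (?a u2 t1)) \<bullet> ?R1 (t1 \<cdot> z)"
    by (rule whisk_reassoc_comp1_inv) (simp_all add: t z)
  also have "(?R2 (t2 \<cdot> z) \<bullet> (g2 \<rhd> ?a u3 t2)) \<bullet> (g2 \<rhd> (\<rho> \<lhd> z)) \<bullet> (g2 \<rhd> inv2 C (?a u2 t1)) \<bullet> ?R1 (t1 \<cdot> z) =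
      ?R2 (t2 \<cdot> z) \<bullet> ((g2 \<rhd> ?a u3 t2) \<bullet> (g2 \<rhd> (\<rho> \<lhd> z)) \<bullet> (g2 \<rhd> inv2 C (?a u2 t1))) \<bullet> ?R1 (t1 \<cdot> z)"
    by (simp add: t \<rho> z)
  also have "(g2 \<rhd> ?a u3 t2) \<bullet> (g2 \<rhd> (\<rho> \<lhd> z)) \<bullet> (g2 \<rhd> inv2 C (?a u2 t1)) =
      g2 \<rhd> whisk_reassoc C (u2, t1) (u3, t2) \<rho> z"
    unfolding whisk_reassoc_eq by (rule whisk_left_vcomp3[symmetric]) (simp_all add: t \<rho> z)
  finally show ?thesis by (simp add: paste_def)
qed

text \<open>By naturality, \<nu> slides through the second factor and the inverse of \<mu> through
  the first. They meet at \<rho>, where \<open>eq\<close> produces \<rho>' and lets \<mu>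
  cancel.\<close>

lemma paste_iso_data:
  assumes t: "t1 \<in> Mor C" "t2 \<in> Mor C" "trg C t1 = src C u1" "trg C t2 = src C u3" "src C t2 = src C t1"
    and \<rho>: "\<rho> \<in> Cell C" "dom C \<rho> = u2 \<cdot> t1" "cod C \<rho> = u3 \<cdot> t2"
    and \<rho>': "\<rho>' \<in> Cell C" "dom C \<rho>' = u2 \<cdot> t1'" "cod C \<rho>' = u3 \<cdot> t2'"
    and \<mu>: "iso \<mu>" "dom C \<mu> = t1" "cod C \<mu> = t1'"
    and \<nu>: "iso \<nu>" "dom C \<nu> = t2" "cod C \<nu> = t2'"
    and eq: "(u3 \<rhd> \<nu>) \<bullet> \<rho> = \<rho>' \<bullet> (u2 \<rhd> \<mu>)"
  shows "(g3 \<rhd> u4 \<rhd> \<nu>) \<bullet> paste g1 g2 g3 u1 u2 u3 u4 \<theta>1 \<theta>2 t1 t2 \<rho> \<bullet> (g1 \<rhd> u1 \<rhd> inv2 C \<mu>) =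
    paste g1 g2 g3 u1 u2 u3 u4 \<theta>1 \<theta>2 t1' t2' \<rho>'"
proof -
  let ?R1 = "whisk_reassoc C (g1, u1) (g2, u2) \<theta>1" and ?R2 = "whisk_reassoc C (g2, u3) (g3, u4) \<theta>2"
  note par = parallel[OF iso_Cell[OF \<mu>(1)] \<mu>(2,3)] parallel[OF iso_Cell[OF \<nu>(1)] \<nu>(2,3)]
  have t': "trg C t1' = src C u1" "trg C t2' = src C u3" "src C t1' = src C t1" "src C t2' = src C t1"
    using par t by auto
  note S = t t' par(2,6) \<rho> \<rho>' \<mu> \<nu>
  have inv: "(g2 \<rhd> u2 \<rhd> \<mu>) \<bullet> (g2 \<rhd> u2 \<rhd> inv2 C \<mu>) = id2 C (g2 \<cdot> u2 \<cdot> t1')"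
    by (simp add: S whisk_left_vcomp[symmetric])
  have g2: "(g2 \<rhd> u3 \<rhd> \<nu>) \<bullet> (g2 \<rhd> \<rho>) = (g2 \<rhd> \<rho>') \<bullet> (g2 \<rhd> u2 \<rhd> \<mu>)"
    using eq by (simp add: S whisk_left_vcomp[symmetric])
  have "(g3 \<rhd> u4 \<rhd> \<nu>) \<bullet> (?R2 t2 \<bullet> (g2 \<rhd> \<rho>) \<bullet> ?R1 t1) \<bullet> (g1 \<rhd> u1 \<rhd> inv2 C \<mu>) =
      ((g3 \<rhd> u4 \<rhd> \<nu>) \<bullet> ?R2 t2) \<bullet> (g2 \<rhd> \<rho>) \<bullet> ?R1 t1 \<bullet> (g1 \<rhd> u1 \<rhd> inv2 C \<mu>)"
    by (simp add: S)
  also have "(g3 \<rhd> u4 \<rhd> \<nu>) \<bullet> ?R2 t2 = ?R2 t2' \<bullet> (g2 \<rhd> u3 \<rhd> \<nu>)"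
    by (rule whisk_reassoc_natural[symmetric]) (simp_all add: S)
  also have "?R1 t1 \<bullet> (g1 \<rhd> u1 \<rhd> inv2 C \<mu>) = (g2 \<rhd> u2 \<rhd> inv2 C \<mu>) \<bullet> ?R1 t1'"
    by (rule whisk_reassoc_natural) (simp_all add: S)
  also have "(?R2 t2' \<bullet> (g2 \<rhd> u3 \<rhd> \<nu>)) \<bullet> (g2 \<rhd> \<rho>) \<bullet> (g2 \<rhd> u2 \<rhd> inv2 C \<mu>) \<bullet> ?R1 t1' =
      ?R2 t2' \<bullet> ((g2 \<rhd> u3 \<rhd> \<nu>) \<bullet> (g2 \<rhd> \<rho>)) \<bullet> (g2 \<rhd> u2 \<rhd> inv2 C \<mu>) \<bullet> ?R1 t1'"
    by (simp add: S)
  also have "\<dots> = ?R2 t2' \<bullet> (g2 \<rhd> \<rho>') \<bullet> ((g2 \<rhd> u2 \<rhd> \<mu>) \<bullet> (g2 \<rhd> u2 \<rhd> inv2 C \<mu>)) \<bullet> ?R1 t1'"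
    unfolding g2 by (simp add: S)
  also have "\<dots> = ?R2 t2' \<bullet> (g2 \<rhd> \<rho>') \<bullet> ?R1 t1'"
    unfolding inv by (simp add: S)
  finally show ?thesis by (simp add: paste_def)
qed

text \<open>Counterpart of \<open>paste_restrict\<close> with the arguments restricted in place of
  the data: inner associators are absorbed into \<rho>, outer ones form the transport.\<close>

lemma paste_whisk_args:
  assumes z: "z \<in> Mor C" "y \<in> Mor C" "trg C z = src C u1" "trg C y = src C u3"
    and t: "t1 \<in> Mor C" "t2 \<in> Mor C" "trg C t1 = src C z" "trg C t2 = src C y" "src C t2 = src C t1"
    and \<rho>: "\<rho> \<in> Cell C" "dom C \<rho> = (u2 \<cdot> z) \<cdot> t1" "cod C \<rho> = (u3 \<cdot> y) \<cdot> t2"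
  shows "(g3 \<rhd> assoc C u4 y t2) \<bullet>
      paste g1 g2 g3 (u1 \<cdot> z) (u2 \<cdot> z) (u3 \<cdot> y) (u4 \<cdot> y)
        (whisk_reassoc C (g1, u1) (g2, u2) \<theta>1 z) (whisk_reassoc C (g2, u3) (g3, u4) \<theta>2 y) t1 t2 \<rho> \<bullet>
      (g1 \<rhd> inv2 C (assoc C u1 z t1)) =
    paste g1 g2 g3 u1 u2 u3 u4 \<theta>1 \<theta>2 (z \<cdot> t1) (y \<cdot> t2)
      (assoc C u3 y t2 \<bullet> \<rho> \<bullet> inv2 C (assoc C u2 z t1))"
proof -
  let ?R1 = "whisk_reassoc C (g1, u1) (g2, u2) \<theta>1" and ?R2 = "whisk_reassoc C (g2, u3) (g3, u4) \<theta>2"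
  let ?RR1 = "whisk_reassoc C (g1, u1 \<cdot> z) (g2, u2 \<cdot> z) (?R1 z) t1"
  let ?RR2 = "whisk_reassoc C (g2, u3 \<cdot> y) (g3, u4 \<cdot> y) (?R2 y) t2"
  note S = z t \<rho>
  have "(g3 \<rhd> assoc C u4 y t2) \<bullet> (?RR2 \<bullet> (g2 \<rhd> \<rho>) \<bullet> ?RR1) \<bullet> (g1 \<rhd> inv2 C (assoc C u1 z t1)) =
      ((g3 \<rhd> assoc C u4 y t2) \<bullet> ?RR2) \<bullet> (g2 \<rhd> \<rho>) \<bullet> ?RR1 \<bullet> (g1 \<rhd> inv2 C (assoc C u1 z t1))"
    by (simp add: S)
  also have "(g3 \<rhd> assoc C u4 y t2) \<bullet> ?RR2 = ?R2 (y \<cdot> t2) \<bullet> (g2 \<rhd> assoc C u3 y t2)"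
    by (rule whisk_reassoc_comp1) (simp_all add: S)
  also have "?RR1 \<bullet> (g1 \<rhd> inv2 C (assoc C u1 z t1)) = (g2 \<rhd> inv2 C (assoc C u2 z t1)) \<bullet> ?R1 (z \<cdot> t1)"
    by (rule whisk_reassoc_comp1_inv) (simp_all add: S)
  also have "(?R2 (y \<cdot> t2) \<bullet> (g2 \<rhd> assoc C u3 y t2)) \<bullet> (g2 \<rhd> \<rho>) \<bullet>
        (g2 \<rhd> inv2 C (assoc C u2 z t1)) \<bullet> ?R1 (z \<cdot> t1) =
      ?R2 (y \<cdot> t2) \<bullet> ((g2 \<rhd> assoc C u3 y t2) \<bullet> (g2 \<rhd> \<rho>) \<bullet> (g2 \<rhd> inv2 C (assoc C u2 z t1))) \<bullet> ?R1 (z \<cdot> t1)"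
    by (simp add: S)
  also have "(g2 \<rhd> assoc C u3 y t2) \<bullet> (g2 \<rhd> \<rho>) \<bullet> (g2 \<rhd> inv2 C (assoc C u2 z t1)) =
      g2 \<rhd> (assoc C u3 y t2 \<bullet> \<rho> \<bullet> inv2 C (assoc C u2 z t1))"
    by (rule whisk_left_vcomp3[symmetric]) (simp_all add: S)
  finally show ?thesis by (simp add: paste_def)
qed

text \<open>The 2-cells \<sigma>2 and \<tau>1 on the inner legs are absorbed into \<rho>; \<sigma>1
  and \<tau>2 on the outer legs become a transport of the pasting.\<close>

lemma paste_transport_args:
  assumes \<sigma>1: "\<sigma>1 \<in> Cell C" "dom C \<sigma>1 = u1'" "cod C \<sigma>1 = u1"
    and \<sigma>2: "\<sigma>2 \<in> Cell C" "dom C \<sigma>2 = u2" "cod C \<sigma>2 = u2'"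
    and \<tau>1: "\<tau>1 \<in> Cell C" "dom C \<tau>1 = u3'" "cod C \<tau>1 = u3"
    and \<tau>2: "\<tau>2 \<in> Cell C" "dom C \<tau>2 = u4" "cod C \<tau>2 = u4'"
    and t: "t1 \<in> Mor C" "t2 \<in> Mor C" "trg C t1 = src C u1" "trg C t2 = src C u3" "src C t2 = src C t1"
    and \<rho>: "\<rho> \<in> Cell C" "dom C \<rho> = u2' \<cdot> t1" "cod C \<rho> = u3' \<cdot> t2"
  shows "(g3 \<rhd> (\<tau>2 \<lhd> t2)) \<bullet>
      paste g1 g2 g3 u1 u2 u3 u4 \<theta>1 \<theta>2 t1 t2 ((\<tau>1 \<lhd> t2) \<bullet> \<rho> \<bullet> (\<sigma>2 \<lhd> t1)) \<bullet> (g1 \<rhd> (\<sigma>1 \<lhd> t1)) =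
    paste g1 g2 g3 u1' u2' u3' u4' ((g2 \<rhd> \<sigma>2) \<bullet> \<theta>1 \<bullet> (g1 \<rhd> \<sigma>1)) ((g3 \<rhd> \<tau>2) \<bullet> \<theta>2 \<bullet> (g2 \<rhd> \<tau>1)) t1 t2 \<rho>"
proof -
  note par = parallel[OF \<sigma>1] parallel[OF \<sigma>2] parallel[OF \<tau>1] parallel[OF \<tau>2]
  have u': "u1' \<in> Mor C" "u2' \<in> Mor C" "u3' \<in> Mor C" "u4' \<in> Mor C"
    "src C u1' = src C u1" "src C u2' = src C u1" "src C u3' = src C u3" "src C u4' = src C u3"
    "trg C u1' = trg C u1" "trg C u2' = trg C u2" "trg C u3' = trg C u2" "trg C u4' = trg C u4"
    using par by auto
  note S = u' \<sigma>1 \<sigma>2 \<tau>1 \<tau>2 t \<rho>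
  have 1: "whisk_reassoc C (g1, u1') (g2, u2') ((g2 \<rhd> \<sigma>2) \<bullet> \<theta>1 \<bullet> (g1 \<rhd> \<sigma>1)) t1 =
      (g2 \<rhd> (\<sigma>2 \<lhd> t1)) \<bullet> whisk_reassoc C (g1, u1) (g2, u2) \<theta>1 t1 \<bullet> (g1 \<rhd> (\<sigma>1 \<lhd> t1))"
    by (rule whisk_reassoc_transport) (simp_all add: S)
  have 2: "whisk_reassoc C (g2, u3') (g3, u4') ((g3 \<rhd> \<tau>2) \<bullet> \<theta>2 \<bullet> (g2 \<rhd> \<tau>1)) t2 =
      (g3 \<rhd> (\<tau>2 \<lhd> t2)) \<bullet> whisk_reassoc C (g2, u3) (g3, u4) \<theta>2 t2 \<bullet> (g2 \<rhd> (\<tau>1 \<lhd> t2))"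
    by (rule whisk_reassoc_transport) (simp_all add: S)
  have 3: "g2 \<rhd> ((\<tau>1 \<lhd> t2) \<bullet> \<rho> \<bullet> (\<sigma>2 \<lhd> t1)) =
      (g2 \<rhd> (\<tau>1 \<lhd> t2)) \<bullet> (g2 \<rhd> \<rho>) \<bullet> (g2 \<rhd> (\<sigma>2 \<lhd> t1))"
    by (rule whisk_left_vcomp3) (simp_all add: S)
  show ?thesis
    unfolding paste_def 1 2 3 by (simp add: S)
qed

end

section \<open>Equivalence of representatives\<close>

context BF_bicategory
begin

section \<open>Closure properties of \<open>W\<close>\<close>

lemma W_imp_Mor [simp]: "f \<in> W \<Longrightarrow> f \<in> Mor C"
  using W_Mor by auto

lemma W_id1 [simp]: "A \<in> Obj C \<Longrightarrow> id1 C A \<in> W"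
  by (rule BF1)

lemma W_comp1 [simp]: "\<lbrakk>f \<in> W; g \<in> W; src C g = trg C f\<rbrakk> \<Longrightarrow> g \<cdot> f \<in> W"
  by (rule BF2) (auto simp: hom_def)

text \<open>BF5 for \<nu> and for its inverse.\<close>

lemma W_iso_iff:
  assumes "iso \<nu>" "dom C \<nu> = v" "cod C \<nu> = w"
  shows "v \<in> W \<longleftrightarrow> w \<in> W"
proof -
  note par = parallel[OF iso_Cell[OF assms(1)] assms(2,3)]
  show ?thesis
  proof
    show "w \<in> W" if "v \<in> W"
      by (rule BF5[of v "src C v" "trg C v" w "inv2 C \<nu>"]) (use that par assms in \<open>auto simp: hom_def iso2_iff\<close>)
    show "v \<in> W" if "w \<in> W"
      by (rule BF5[of w "src C v" "trg C v" v \<nu>]) (use that par assms in \<open>auto simp: hom_def iso2_iff\<close>)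
  qed
qed

lemma W_assoc_iff:
  assumes "f \<in> Mor C" "g \<in> Mor C" "h \<in> Mor C" "src C g = trg C f" "src C h = trg C g"
  shows "(h \<cdot> g) \<cdot> f \<in> W \<longleftrightarrow> h \<cdot> g \<cdot> f \<in> W"
  using assms by (intro W_iso_iff[of "assoc C h g f"]) auto

lemma W_comp1_assoc:
  assumes "f \<in> W" "g \<in> Mor C" "h \<in> Mor C" "src C g = trg C f" "src C h = trg C g" "h \<cdot> g \<in> W"
  shows "h \<cdot> g \<cdot> f \<in> W"
  using assms W_assoc_iff[of f g h] by simp

section \<open>Liftings, completion to squares, and cancellation of 1-cells in
  \<open>W\<close>\<close>

lemma lift_iso:
  assumes "w \<in> W" "f1 \<in> Mor C" "f2 \<in> Mor C" "src C w = trg C f1" "src C w = trg C f2" "src C f1 = src C f2"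
    "iso \<alpha>" "dom C \<alpha> = w \<cdot> f1" "cod C \<alpha> = w \<cdot> f2"
  obtains v \<beta> where "v \<in> W" "trg C v = src C f1" "iso \<beta>" "dom C \<beta> = f1 \<cdot> v" "cod C \<beta> = f2 \<cdot> v"
    "whisk_reassoc C (w, f1) (w, f2) \<alpha> v = w \<rhd> \<beta>"
proof -
  have "\<exists>D v \<beta>. (D, v, \<beta>) \<in> liftings C W w f1 f2 \<alpha> \<and> \<beta> \<in> iso2 C (f1 \<cdot> v) (f2 \<cdot> v)"
    by (rule BF4b[of w "src C w" "trg C w" f1 "src C f1"]) (use assms in \<open>auto simp: hom_def iso2_iff\<close>)
  then show ?thesis
    using that by (auto simp: liftings_def hom_def iso2_iff)
qed

text \<open>BF3 is applied to \<open>w \<cdot> a\<close> and \<open>w \<cdot> b\<close>, and BF4b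
  strips \<open>w\<close> from the resulting 2-cell after a restriction along some \<open>v\<close>
  in \<open>W\<close>. The assumption concerns \<open>w \<cdot> b\<close> and not \<open>b\<close>,
  as this is what representatives provide; \<open>p\<close> is the leg that lands in
  \<open>W\<close>.\<close>

lemma square_completion:
  assumes "w \<in> W" "a \<in> Mor C" "b \<in> Mor C" "src C w = trg C a" "src C w = trg C b" "w \<cdot> b \<in> W"
  obtains p q \<mu> where "p \<in> W" "trg C p = src C a" "q \<in> Mor C" "trg C q = src C b" "src C q = src C p"
    "iso \<mu>" "dom C \<mu> = a \<cdot> p" "cod C \<mu> = b \<cdot> q"
proof -
  have "\<exists>D w' f' \<rho>. w' \<in> hom C D (src C a) \<inter> W \<and> f' \<in> hom C D (src C b) \<and>
      \<rho> \<in> iso2 C ((w \<cdot> a) \<cdot> w') ((w \<cdot> b) \<cdot> f')"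
    by (rule BF3[of _ _ "trg C w"]) (use assms in \<open>auto simp: hom_def\<close>)
  then obtain w' f' \<rho> where w': "w' \<in> W" "trg C w' = src C a"
    and f': "f' \<in> Mor C" "trg C f' = src C b" "src C f' = src C w'"
    and \<rho>: "iso \<rho>" "dom C \<rho> = (w \<cdot> a) \<cdot> w'" "cod C \<rho> = (w \<cdot> b) \<cdot> f'"
    by (auto simp: hom_def iso2_iff)
  let ?\<rho> = "assoc C w b f' \<bullet> \<rho> \<bullet> inv2 C (assoc C w a w')"
  obtain v \<beta> where v: "v \<in> W" "trg C v = src C w'"
    and \<beta>: "iso \<beta>" "dom C \<beta> = (a \<cdot> w') \<cdot> v" "cod C \<beta> = (b \<cdot> f') \<cdot> v"
    by (rule lift_iso[of w "a \<cdot> w'" "b \<cdot> f'" ?\<rho>]) (use assms w' f' \<rho> in auto)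
  show ?thesis
    by (rule that[of "w' \<cdot> v" "f' \<cdot> v" "assoc C b f' v \<bullet> \<beta> \<bullet> inv2 C (assoc C a w' v)"])
      (use assms w' f' v \<beta> in auto)
qed

text \<open>BF4c is applied to the liftings of \<open>w \<rhd> \<beta>\<close> along an identity given by \<open>\<beta>\<close> and \<open>\<beta>'\<close>.\<close>

lemma whisk_left_W_faithful:
  assumes "w \<in> W" "\<beta> \<in> Cell C" "\<beta>' \<in> Cell C" "dom C \<beta> = f1" "cod C \<beta> = f2" "dom C \<beta>' = f1" "cod C \<beta>' = f2"
    "src C w = trg C f1" "w \<rhd> \<beta> = w \<rhd> \<beta>'"
  obtains s where "s \<in> W" "trg C s = src C f1" "\<beta> \<lhd> s = \<beta>' \<lhd> s"
proof -
  note par = parallel[OF assms(2,4,5)]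
  let ?i = "id1 C (src C f1)"
  have lift: "(src C f1, ?i, b \<lhd> ?i) \<in> liftings C W w f1 f2 (w \<rhd> b)"
    if "b \<in> Cell C" "dom C b = f1" "cod C b = f2" for b
    using assms par that by (auto simp: liftings_def hom_def hom2_def whisk_reassoc_whisk_left)
  have "\<exists>E u u' \<zeta>. u \<in> hom C E (src C f1) \<and> u' \<in> hom C E (src C f1) \<and> ?i \<cdot> u \<in> W \<and>
      \<zeta> \<in> iso2 C (?i \<cdot> u) (?i \<cdot> u') \<and>
      whisk_reassoc C (f1, ?i) (f2, ?i) (\<beta>' \<lhd> ?i) u' \<bullet> (f1 \<rhd> \<zeta>) =
      (f2 \<rhd> \<zeta>) \<bullet> whisk_reassoc C (f1, ?i) (f2, ?i) (\<beta> \<lhd> ?i) u"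
    by (rule BF4c[of w "src C w" "trg C w" f1 "src C f1" f2 "w \<rhd> \<beta>"])
      (use assms par lift[of \<beta>] lift[of \<beta>'] in \<open>auto simp: hom_def hom2_def\<close>)
  then obtain u u' \<zeta> where u: "u \<in> Mor C" "trg C u = src C f1" "u' \<in> Mor C" "trg C u' = src C f1"
      "?i \<cdot> u \<in> W"
    and \<zeta>: "iso \<zeta>" "dom C \<zeta> = ?i \<cdot> u" "cod C \<zeta> = ?i \<cdot> u'"
    and eq: "whisk_reassoc C (f1, ?i) (f2, ?i) (\<beta>' \<lhd> ?i) u' \<bullet> (f1 \<rhd> \<zeta>) =
      (f2 \<rhd> \<zeta>) \<bullet> whisk_reassoc C (f1, ?i) (f2, ?i) (\<beta> \<lhd> ?i) u"
    by (auto simp: hom_def iso2_iff)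
  have wr: "whisk_reassoc C (f1, ?i) (f2, ?i) (b \<lhd> ?i) x = b \<lhd> ?i \<cdot> x"
    if "b \<in> Cell C" "dom C b = f1" "cod C b = f2" "x \<in> Mor C" "trg C x = src C f1" for b x
  proof -
    have "assoc C f2 ?i x \<bullet> ((b \<lhd> ?i) \<lhd> x) \<bullet> inv2 C (assoc C f1 ?i x) =
        (assoc C f2 ?i x \<bullet> ((b \<lhd> ?i) \<lhd> x)) \<bullet> inv2 C (assoc C f1 ?i x)"
      using par that by simp
    also have "\<dots> = b \<lhd> ?i \<cdot> x"
      using par that by (subst assoc_natural1[of b f1]) auto
    finally show ?thesis by (simp add: whisk_reassoc_eq)
  qed
  have "(\<beta>' \<lhd> ?i \<cdot> u') \<bullet> (f1 \<rhd> \<zeta>) = (f2 \<rhd> \<zeta>) \<bullet> (\<beta> \<lhd> ?i \<cdot> u)"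
    using eq assms par u by (simp add: wr)
  \<comment> \<open>Exchange brings \<beta> to the side of \<open>u'\<close>, so that the invertible
    \<open>f1 \<rhd> \<zeta>\<close> cancels and both 2-cells are whiskered with
    \<open>?i \<cdot> u'\<close>.\<close>
  also have "\<dots> = (\<beta> \<lhd> ?i \<cdot> u') \<bullet> (f1 \<rhd> \<zeta>)"
    using assms par u \<zeta> by (intro whisk_exchange[symmetric]) auto
  finally have "\<beta>' \<lhd> ?i \<cdot> u' = \<beta> \<lhd> ?i \<cdot> u'"
    by (rule iso_cancel_right[rotated -1]) (use assms par u \<zeta> in auto)
  \<comment> \<open>BF4c puts \<open>?i \<cdot> u\<close> in \<open>W\<close>; \<zeta> passes this
    on to the witness \<open>?i \<cdot> u'\<close>.\<close>
  moreover have "?i \<cdot> u' \<in> W"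
    using W_iso_iff[OF \<zeta>] u by simp
  ultimately show ?thesis
    using that[of "?i \<cdot> u'"] u par by simp
qed

lemma W_comp1_assoc3:
  assumes "p \<in> W" "z \<in> Mor C" "v \<in> Mor C" "w \<in> Mor C"
    "src C z = trg C p" "src C v = trg C z" "src C w = trg C v" "w \<cdot> v \<cdot> z \<in> W"
  shows "w \<cdot> v \<cdot> z \<cdot> p \<in> W"
proof -
  have "w \<cdot> (v \<cdot> z) \<cdot> p \<in> W"
    using assms by - (rule W_comp1_assoc, auto)
  then show ?thesis
    using assms W_iso_iff[of "w \<rhd> assoc C v z p" "w \<cdot> (v \<cdot> z) \<cdot> p" "w \<cdot> v \<cdot> z \<cdot> p"] by simp
qed

section \<open>Representatives and witnesses of their equivalence\<close>

lemma frac_homD: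
  assumes "(A', w, f) \<in> frac_hom C W A B"
  shows "w \<in> W" "src C w = A'" "trg C w = A" "f \<in> Mor C" "src C f = A'" "trg C f = B"
  using assms by (auto simp: frac_hom_def hom_def)

lemma frac_rep_iff:
  "(X, v1, v2, \<alpha>, \<beta>) \<in> frac_rep C W (A1, w1, f1) (A2, w2, f2) \<longleftrightarrow>
    v1 \<in> Mor C \<and> src C v1 = X \<and> trg C v1 = A1 \<and> v2 \<in> Mor C \<and> src C v2 = X \<and> trg C v2 = A2 \<and>
    w1 \<cdot> v1 \<in> W \<and> iso \<alpha> \<and> dom C \<alpha> = w1 \<cdot> v1 \<and> cod C \<alpha> = w2 \<cdot> v2 \<and>
    \<beta> \<in> Cell C \<and> dom C \<beta> = f1 \<cdot> v1 \<and> cod C \<beta> = f2 \<cdot> v2"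
  by (auto simp: hom_def hom2_def iso2_iff)

text \<open>One of the two equations in the equivalence of representatives, uniform for \<alpha>
  with the legs in \<open>W\<close> and \<beta> with the other legs.\<close>

definition transports :: "'a \<Rightarrow> 'a \<Rightarrow> 'a \<Rightarrow> 'a \<Rightarrow> 'c \<Rightarrow> 'a \<Rightarrow> 'a \<Rightarrow> 'a \<Rightarrow> 'c \<Rightarrow> 'a \<Rightarrow> 'c \<Rightarrow> 'c \<Rightarrow> bool" where
  "transports g1 g2 v1 v2 \<theta> z v1' v2' \<theta>' z' \<sigma>1 \<sigma>2 \<longleftrightarrow>
    (g2 \<rhd> \<sigma>2) \<bullet> whisk_reassoc C (g1, v1) (g2, v2) \<theta> z \<bullet> (g1 \<rhd> \<sigma>1) =
    whisk_reassoc C (g1, v1') (g2, v2') \<theta>' z'"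

lemma frac_rel_iff:
  "((X, v1, v2, \<alpha>, \<beta>), (X', v1', v2', \<alpha>', \<beta>')) \<in> frac_rel C W (A1, w1, f1) (A2, w2, f2) \<longleftrightarrow>
    (X, v1, v2, \<alpha>, \<beta>) \<in> frac_rep C W (A1, w1, f1) (A2, w2, f2) \<and>
    (X', v1', v2', \<alpha>', \<beta>') \<in> frac_rep C W (A1, w1, f1) (A2, w2, f2) \<and>
    (\<exists>z z' \<sigma>1 \<sigma>2. z \<in> Mor C \<and> trg C z = X \<and> z' \<in> Mor C \<and> trg C z' = X' \<and> src C z' = src C z \<and>
      iso \<sigma>1 \<and> dom C \<sigma>1 = v1' \<cdot> z' \<and> cod C \<sigma>1 = v1 \<cdot> z \<and>
      iso \<sigma>2 \<and> dom C \<sigma>2 = v2 \<cdot> z \<and> cod C \<sigma>2 = v2' \<cdot> z' \<and>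
      w1 \<cdot> v1 \<cdot> z \<in> W \<and>
      transports w1 w2 v1 v2 \<alpha> z v1' v2' \<alpha>' z' \<sigma>1 \<sigma>2 \<and>
      transports f1 f2 v1 v2 \<beta> z v1' v2' \<beta>' z' \<sigma>1 \<sigma>2)"
  unfolding frac_rel.simps transports_def by (auto simp: hom_def iso2_iff)

declare frac_rep.simps [simp del] frac_rel.simps [simp del]

lemma frac_rel_sym:
  assumes F1: "(A1, w1, f1) \<in> frac_hom C W A B" and F2: "(A2, w2, f2) \<in> frac_hom C W A B"
    and r: "(r, r') \<in> frac_rel C W (A1, w1, f1) (A2, w2, f2)"
  shows "(r', r) \<in> frac_rel C W (A1, w1, f1) (A2, w2, f2)"
proof -
  note fr = frac_homD[OF F1] frac_homD[OF F2]
  obtain X v1 v2 \<alpha> \<beta> X' v1' v2' \<alpha>' \<beta>' where rr: "r = (X, v1, v2, \<alpha>, \<beta>)" "r' = (X', v1', v2', \<alpha>', \<beta>')"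
    using prod_cases5 by metis
  note rel = r[unfolded rr frac_rel_iff]
  note rep = rel[THEN conjunct1, unfolded frac_rep_iff] rel[THEN conjunct2, THEN conjunct1, unfolded frac_rep_iff]
  obtain z z' \<sigma>1 \<sigma>2 where z: "z \<in> Mor C" "trg C z = X" "z' \<in> Mor C" "trg C z' = X'" "src C z' = src C z"
    and \<sigma>1: "iso \<sigma>1" "dom C \<sigma>1 = v1' \<cdot> z'" "cod C \<sigma>1 = v1 \<cdot> z"
    and \<sigma>2: "iso \<sigma>2" "dom C \<sigma>2 = v2 \<cdot> z" "cod C \<sigma>2 = v2' \<cdot> z'"
    and zW: "w1 \<cdot> v1 \<cdot> z \<in> W"
    and eq: "transports w1 w2 v1 v2 \<alpha> z v1' v2' \<alpha>' z' \<sigma>1 \<sigma>2"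
      "transports f1 f2 v1 v2 \<beta> z v1' v2' \<beta>' z' \<sigma>1 \<sigma>2"
    using rel by blast
  \<comment> \<open>The relation asks for membership in \<open>W\<close> on the side of its first
    argument, so it is carried over along \<open>w1 \<rhd> \<sigma>1\<close>.\<close>
  have zW': "w1 \<cdot> v1' \<cdot> z' \<in> W"
    using W_iso_iff[of "w1 \<rhd> \<sigma>1" "w1 \<cdot> v1' \<cdot> z'" "w1 \<cdot> v1 \<cdot> z"] by (simp add: zW rep z \<sigma>1 fr)
  have "transports w1 w2 v1' v2' \<alpha>' z' v1 v2 \<alpha> z (inv2 C \<sigma>1) (inv2 C \<sigma>2)"
    unfolding transports_def
    by (rule transport_sym[OF _ _ \<sigma>1 \<sigma>2 _ _ _ _ _ eq(1)[unfolded transports_def]]) (auto simp: z rep fr)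
  moreover have "transports f1 f2 v1' v2' \<beta>' z' v1 v2 \<beta> z (inv2 C \<sigma>1) (inv2 C \<sigma>2)"
    unfolding transports_def
    by (rule transport_sym[OF _ _ \<sigma>1 \<sigma>2 _ _ _ _ _ eq(2)[unfolded transports_def]]) (auto simp: z rep fr)
  ultimately show ?thesis
    unfolding rr frac_rel_iff frac_rep_iff
    by (intro conjI exI[of _ z'] exI[of _ z] exI[of _ "inv2 C \<sigma>1"] exI[of _ "inv2 C \<sigma>2"])
      (auto simp: rep z \<sigma>1 \<sigma>2 zW')
qed

text \<open>The restricting 1-cells \<open>z'\<close> and \<open>y\<close> of the two witnesses both
  end at \<open>X'\<close>. They are completed to a square, whose 2-cell \<mu> joins the restricted
  witnesses.\<close>

lemma frac_rel_trans:
  assumes F1: "(A1, w1, f1) \<in> frac_hom C W A B" and F2: "(A2, w2, f2) \<in> frac_hom C W A B"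
    and r: "(r, r') \<in> frac_rel C W (A1, w1, f1) (A2, w2, f2)"
    and r': "(r', r'') \<in> frac_rel C W (A1, w1, f1) (A2, w2, f2)"
  shows "(r, r'') \<in> frac_rel C W (A1, w1, f1) (A2, w2, f2)"
proof -
  note fr = frac_homD[OF F1] frac_homD[OF F2]
  obtain X v1 v2 \<alpha> \<beta> X' v1' v2' \<alpha>' \<beta>' where rr: "r = (X, v1, v2, \<alpha>, \<beta>)" "r' = (X', v1', v2', \<alpha>', \<beta>')"
    using prod_cases5 by metis
  obtain X'' v1'' v2'' \<alpha>'' \<beta>'' where rr'': "r'' = (X'', v1'', v2'', \<alpha>'', \<beta>'')"
    using prod_cases5 by metis
  note rel = r[unfolded rr frac_rel_iff]
  note rep = rel[THEN conjunct1, unfolded frac_rep_iff] rel[THEN conjunct2, THEN conjunct1, unfolded frac_rep_iff]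
  note rel' = r'[unfolded rr rr'' frac_rel_iff]
  note rep' = rel'[THEN conjunct1, unfolded frac_rep_iff] rel'[THEN conjunct2, THEN conjunct1, unfolded frac_rep_iff]
  obtain z z' \<sigma>1 \<sigma>2 where z: "z \<in> Mor C" "trg C z = X" "z' \<in> Mor C" "trg C z' = X'" "src C z' = src C z"
    and \<sigma>1: "iso \<sigma>1" "dom C \<sigma>1 = v1' \<cdot> z'" "cod C \<sigma>1 = v1 \<cdot> z"
    and \<sigma>2: "iso \<sigma>2" "dom C \<sigma>2 = v2 \<cdot> z" "cod C \<sigma>2 = v2' \<cdot> z'"
    and zW: "w1 \<cdot> v1 \<cdot> z \<in> W"
    and eq: "transports w1 w2 v1 v2 \<alpha> z v1' v2' \<alpha>' z' \<sigma>1 \<sigma>2"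
      "transports f1 f2 v1 v2 \<beta> z v1' v2' \<beta>' z' \<sigma>1 \<sigma>2"
    using rel by blast
  obtain y y' \<tau>1 \<tau>2 where y: "y \<in> Mor C" "trg C y = X'" "y' \<in> Mor C" "trg C y' = X''" "src C y' = src C y"
    and \<tau>1: "iso \<tau>1" "dom C \<tau>1 = v1'' \<cdot> y'" "cod C \<tau>1 = v1' \<cdot> y"
    and \<tau>2: "iso \<tau>2" "dom C \<tau>2 = v2' \<cdot> y" "cod C \<tau>2 = v2'' \<cdot> y'"
    and yW: "w1 \<cdot> v1' \<cdot> y \<in> W"
    and eq': "transports w1 w2 v1' v2' \<alpha>' y v1'' v2'' \<alpha>'' y' \<tau>1 \<tau>2"
      "transports f1 f2 v1' v2' \<beta>' y v1'' v2'' \<beta>'' y' \<tau>1 \<tau>2"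
    using rel' by blast
  have v: "v1 \<in> Mor C" "src C v1 = X" "trg C v1 = A1" "v2 \<in> Mor C" "src C v2 = X" "trg C v2 = A2"
    "v1' \<in> Mor C" "src C v1' = X'" "trg C v1' = A1" "v2' \<in> Mor C" "src C v2' = X'" "trg C v2' = A2"
    "v1'' \<in> Mor C" "src C v1'' = X''" "trg C v1'' = A1" "v2'' \<in> Mor C" "src C v2'' = X''" "trg C v2'' = A2"
    "w1 \<cdot> v1' \<in> W"
    using rep rep' by auto
  have \<alpha>: "\<alpha> \<in> Cell C" "dom C \<alpha> = w1 \<cdot> v1" "cod C \<alpha> = w2 \<cdot> v2"
    "\<alpha>' \<in> Cell C" "dom C \<alpha>' = w1 \<cdot> v1'" "cod C \<alpha>' = w2 \<cdot> v2'"
    "\<alpha>'' \<in> Cell C" "dom C \<alpha>'' = w1 \<cdot> v1''" "cod C \<alpha>'' = w2 \<cdot> v2''"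
    "\<beta> \<in> Cell C" "dom C \<beta> = f1 \<cdot> v1" "cod C \<beta> = f2 \<cdot> v2"
    "\<beta>' \<in> Cell C" "dom C \<beta>' = f1 \<cdot> v1'" "cod C \<beta>' = f2 \<cdot> v2'"
    "\<beta>'' \<in> Cell C" "dom C \<beta>'' = f1 \<cdot> v1''" "cod C \<beta>'' = f2 \<cdot> v2''"
    using rep rep' by auto
  \<comment> \<open>In the completion \<open>w1 \<cdot> v1'\<close> takes the role of
    \<open>w\<close>; the second witness supplies the required membership.\<close>
  have yW': "(w1 \<cdot> v1') \<cdot> y \<in> W"
    using yW v y fr by (subst W_assoc_iff) auto
  obtain p q \<mu> where p: "p \<in> W" "trg C p = src C z'"
    and q: "q \<in> Mor C" "trg C q = src C y" "src C q = src C p"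
    and \<mu>: "iso \<mu>" "dom C \<mu> = z' \<cdot> p" "cod C \<mu> = y \<cdot> q"
    by (rule square_completion[of "w1 \<cdot> v1'" z' y]) (auto simp: v z y fr yW')
  \<comment> \<open>The first witness is restricted along \<open>p\<close> and the second along
    \<open>q\<close>, which have the same source.\<close>
  define S1 S2 T1 T2 where "S1 = whisk_reassoc C (v1', z') (v1, z) \<sigma>1 p"
    and "S2 = whisk_reassoc C (v2, z) (v2', z') \<sigma>2 p"
    and "T1 = whisk_reassoc C (v1'', y') (v1', y) \<tau>1 q"
    and "T2 = whisk_reassoc C (v2', y) (v2'', y') \<tau>2 q"
  have S: "iso S1" "dom C S1 = v1' \<cdot> z' \<cdot> p" "cod C S1 = v1 \<cdot> z \<cdot> p"
    "iso S2" "dom C S2 = v2 \<cdot> z \<cdot> p" "cod C S2 = v2' \<cdot> z' \<cdot> p"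
    "iso T1" "dom C T1 = v1'' \<cdot> y' \<cdot> q" "cod C T1 = v1' \<cdot> y \<cdot> q"
    "iso T2" "dom C T2 = v2' \<cdot> y \<cdot> q" "cod C T2 = v2'' \<cdot> y' \<cdot> q"
    unfolding S1_def S2_def T1_def T2_def by (auto simp: v z y p q \<sigma>1 \<sigma>2 \<tau>1 \<tau>2)
  have tr: "transports g1 g2 v1 v2 \<theta> (z \<cdot> p) v1'' v2'' \<theta>'' (y' \<cdot> q)
      (S1 \<bullet> (v1' \<rhd> inv2 C \<mu>) \<bullet> T1) (T2 \<bullet> (v2' \<rhd> \<mu>) \<bullet> S2)"
    if "transports g1 g2 v1 v2 \<theta> z v1' v2' \<theta>' z' \<sigma>1 \<sigma>2"
      "transports g1 g2 v1' v2' \<theta>' y v1'' v2'' \<theta>'' y' \<tau>1 \<tau>2"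
      "g1 \<in> Mor C" "g2 \<in> Mor C" "src C g1 = A1" "src C g2 = A2"
      "\<theta> \<in> Cell C" "dom C \<theta> = g1 \<cdot> v1" "cod C \<theta> = g2 \<cdot> v2"
      "\<theta>' \<in> Cell C" "dom C \<theta>' = g1 \<cdot> v1'" "cod C \<theta>' = g2 \<cdot> v2'"
      "\<theta>'' \<in> Cell C" "dom C \<theta>'' = g1 \<cdot> v1''" "cod C \<theta>'' = g2 \<cdot> v2''"
    for g1 g2 \<theta> \<theta>' \<theta>''
  proof -
    have t1: "transports g1 g2 v1 v2 \<theta> (z \<cdot> p) v1' v2' \<theta>' (z' \<cdot> p) S1 S2"
      unfolding transports_def S1_def S2_def
      by (rule whisk_reassoc_transport_iterated) (auto simp: that[unfolded transports_def] v z p \<sigma>1 \<sigma>2)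
    have t2: "transports g1 g2 v1' v2' \<theta>' (y \<cdot> q) v1'' v2'' \<theta>'' (y' \<cdot> q) T1 T2"
      unfolding transports_def T1_def T2_def
      by (rule whisk_reassoc_transport_iterated) (auto simp: that[unfolded transports_def] v y q \<tau>1 \<tau>2)
    show ?thesis
      unfolding transports_def
      by (rule whisk_reassoc_transport_trans[where \<mu> = \<mu> and \<theta>' = \<theta>' and x' = "z' \<cdot> p" and y' = "y \<cdot> q"])
        ((rule t1[unfolded transports_def] t2[unfolded transports_def] | simp add: that(3-) v z y p q \<mu> S; fail)+)
  qed
  have "w1 \<cdot> v1 \<cdot> z \<cdot> p \<in> W"
    by (rule W_comp1_assoc3) (auto simp: zW p v z fr)
  then show ?thesis
    unfolding rr rr'' frac_rel_iff
    by (intro conjI exI[of _ "z \<cdot> p"] exI[of _ "y' \<cdot> q"] exI[of _ "S1 \<bullet> (v1' \<rhd> inv2 C \<mu>) \<bullet> T1"]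
        exI[of _ "T2 \<bullet> (v2' \<rhd> \<mu>) \<bullet> S2"] tr[OF eq(1) eq'(1)] tr[OF eq(2) eq'(2)])
      (auto simp: rep rep' v z y p q \<mu> S \<alpha> fr frac_rep_iff)
qed

text \<open>Both restrictions of the witness are along the identity of \<open>X\<close>, and its
  2-cells are \<sigma>1 and \<sigma>2 whiskered with that identity.\<close>

lemma frac_rel_transport:
  assumes F1: "(A1, w1, f1) \<in> frac_hom C W A B" and F2: "(A2, w2, f2) \<in> frac_hom C W A B"
    and r: "(X, v1, v2, \<alpha>, \<beta>) \<in> frac_rep C W (A1, w1, f1) (A2, w2, f2)"
    and \<sigma>1: "iso \<sigma>1" "dom C \<sigma>1 = v1'" "cod C \<sigma>1 = v1"
    and \<sigma>2: "iso \<sigma>2" "dom C \<sigma>2 = v2" "cod C \<sigma>2 = v2'"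
    and \<alpha>': "(w2 \<rhd> \<sigma>2) \<bullet> \<alpha> \<bullet> (w1 \<rhd> \<sigma>1) = \<alpha>'" and \<beta>': "(f2 \<rhd> \<sigma>2) \<bullet> \<beta> \<bullet> (f1 \<rhd> \<sigma>1) = \<beta>'"
  shows "((X, v1, v2, \<alpha>, \<beta>), (X, v1', v2', \<alpha>', \<beta>')) \<in> frac_rel C W (A1, w1, f1) (A2, w2, f2)"
proof -
  note fr = frac_homD[OF F1] frac_homD[OF F2]
  note rep = r[unfolded frac_rep_iff]
  note par = parallel[OF iso_Cell[OF \<sigma>1(1)] \<sigma>1(2,3)] parallel[OF iso_Cell[OF \<sigma>2(1)] \<sigma>2(2,3)]
  have v': "src C v1' = X" "trg C v1' = A1" "src C v2' = X" "trg C v2' = A2"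
    using rep par by auto
  have "w1 \<cdot> v1' \<in> W"
    using W_iso_iff[of "w1 \<rhd> \<sigma>1" "w1 \<cdot> v1'" "w1 \<cdot> v1"] by (simp add: rep par(1,2,5,6) v' \<sigma>1 fr)
  then have r': "(X, v1', v2', \<alpha>', \<beta>') \<in> frac_rep C W (A1, w1, f1) (A2, w2, f2)"
    unfolding frac_rep_iff \<alpha>'[symmetric] \<beta>'[symmetric] by (auto simp: rep par(1,2,5,6) v' \<sigma>1 \<sigma>2 fr)
  have X: "X \<in> Obj C"
    using rep src_Obj by blast
  have W1: "w1 \<cdot> v1 \<cdot> id1 C X \<in> W"
    by (rule W_comp1_assoc) (auto simp: rep X fr)
  have "transports w1 w2 v1 v2 \<alpha> (id1 C X) v1' v2' \<alpha>' (id1 C X) (\<sigma>1 \<lhd> id1 C X) (\<sigma>2 \<lhd> id1 C X)"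
    unfolding transports_def \<alpha>'[symmetric]
    by (rule whisk_reassoc_transport[symmetric]) (auto simp: rep par(1,2,5,6) v' \<sigma>1 \<sigma>2 fr X)
  moreover have "transports f1 f2 v1 v2 \<beta> (id1 C X) v1' v2' \<beta>' (id1 C X) (\<sigma>1 \<lhd> id1 C X) (\<sigma>2 \<lhd> id1 C X)"
    unfolding transports_def \<beta>'[symmetric]
    by (rule whisk_reassoc_transport[symmetric]) (auto simp: rep par(1,2,5,6) v' \<sigma>1 \<sigma>2 fr X)
  ultimately show ?thesis
    unfolding frac_rel_iff
    by (intro conjI exI[of _ "id1 C X"] exI[of _ "\<sigma>1 \<lhd> id1 C X"] exI[of _ "\<sigma>2 \<lhd> id1 C X"])
      (auto simp: r r' rep par(1,2,5,6) v' \<sigma>1 \<sigma>2 X W1)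
qed

text \<open>The case of \<open>frac_rel_transport\<close> with identity 2-cells.\<close>

lemma frac_rel_refl:
  assumes F1: "(A1, w1, f1) \<in> frac_hom C W A B" and F2: "(A2, w2, f2) \<in> frac_hom C W A B"
    and r: "r \<in> frac_rep C W (A1, w1, f1) (A2, w2, f2)"
  shows "(r, r) \<in> frac_rel C W (A1, w1, f1) (A2, w2, f2)"
proof -
  note fr = frac_homD[OF F1] frac_homD[OF F2]
  obtain X v1 v2 \<alpha> \<beta> where rr: "r = (X, v1, v2, \<alpha>, \<beta>)"
    using prod_cases5 by metis
  note rep = r[unfolded rr frac_rep_iff]
  show ?thesis
    unfolding rr
    by (rule frac_rel_transport[OF F1 F2 r[unfolded rr], of "id2 C v1" _ "id2 C v2"]) (auto simp: rep fr)
qed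

lemma equiv_frac_rel:
  assumes F1: "(A1, w1, f1) \<in> frac_hom C W A B" and F2: "(A2, w2, f2) \<in> frac_hom C W A B"
  shows "equiv (frac_rep C W (A1, w1, f1) (A2, w2, f2)) (frac_rel C W (A1, w1, f1) (A2, w2, f2))"
proof (rule equivI)
  show "frac_rel C W (A1, w1, f1) (A2, w2, f2) \<subseteq>
      frac_rep C W (A1, w1, f1) (A2, w2, f2) \<times> frac_rep C W (A1, w1, f1) (A2, w2, f2)"
    by (auto simp: frac_rel.simps)
  show "refl_on (frac_rep C W (A1, w1, f1) (A2, w2, f2)) (frac_rel C W (A1, w1, f1) (A2, w2, f2))"
    by (rule refl_onI) (rule frac_rel_refl[OF assms])
  show "sym (frac_rel C W (A1, w1, f1) (A2, w2, f2))"
    by (rule symI) (rule frac_rel_sym[OF assms])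
  show "trans (frac_rel C W (A1, w1, f1) (A2, w2, f2))"
    by (rule transI) (rule frac_rel_trans[OF assms])
qed

text \<open>In the witness the left representative is restricted along \<open>z \<cdot> ?i\<close>
  and the right one along the identity \<open>?i\<close>; an associator and an inverse associator
  take the roles of \<sigma>1 and \<sigma>2.\<close>

lemma frac_rel_whisk:
  assumes F1: "(A1, w1, f1) \<in> frac_hom C W A B" and F2: "(A2, w2, f2) \<in> frac_hom C W A B"
    and r: "(X, v1, v2, \<alpha>, \<beta>) \<in> frac_rep C W (A1, w1, f1) (A2, w2, f2)"
    and z: "z \<in> Mor C" "trg C z = X" "w1 \<cdot> v1 \<cdot> z \<in> W"
  shows "((X, v1, v2, \<alpha>, \<beta>), (src C z, v1 \<cdot> z, v2 \<cdot> z, whisk_reassoc C (w1, v1) (w2, v2) \<alpha> z,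
    whisk_reassoc C (f1, v1) (f2, v2) \<beta> z)) \<in> frac_rel C W (A1, w1, f1) (A2, w2, f2)"
proof -
  note fr = frac_homD[OF F1] frac_homD[OF F2]
  note rep = r[unfolded frac_rep_iff]
  let ?i = "id1 C (src C z)"
  have i: "?i \<in> W" "src C ?i = src C z" "trg C ?i = src C z"
    using z by auto
  have W1: "w1 \<cdot> v1 \<cdot> z \<cdot> ?i \<in> W"
    by (rule W_comp1_assoc3) (auto simp: rep z i fr)
  have tr: "transports g1 g2 v1 v2 \<theta> (z \<cdot> ?i) (v1 \<cdot> z) (v2 \<cdot> z) (whisk_reassoc C (g1, v1) (g2, v2) \<theta> z) ?i
      (assoc C v1 z ?i) (inv2 C (assoc C v2 z ?i))"
    if "g1 \<in> Mor C" "g2 \<in> Mor C" "src C g1 = A1" "src C g2 = A2"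
      "\<theta> \<in> Cell C" "dom C \<theta> = g1 \<cdot> v1" "cod C \<theta> = g2 \<cdot> v2" for g1 g2 \<theta>
    unfolding transports_def
    by (subst whisk_reassoc_comp1[symmetric]) (auto simp: rep z i that whisk_left_inv_cancel)
  show ?thesis
    unfolding frac_rel_iff
    by (intro conjI exI[of _ "z \<cdot> ?i"] exI[of _ ?i] exI[of _ "assoc C v1 z ?i"]
        exI[of _ "inv2 C (assoc C v2 z ?i)"] tr r)
      (auto simp: rep z i fr W1 frac_rep_iff)
qed

end

section \<open>Vertical composition\<close>

locale three_fractions = BF_bicategory C W for C :: "('o, 'a, 'c, 'm) bicat_scheme" (structure) and W +
  fixes A B A1 A2 A3 :: 'o and w1 w2 w3 f1 f2 f3 :: 'a
  assumes F1: "(A1, w1, f1) \<in> frac_hom C W A B" and F2: "(A2, w2, f2) \<in> frac_hom C W A B"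
    and F3: "(A3, w3, f3) \<in> frac_hom C W A B"
begin

lemmas frac_simps [simp] = frac_homD[OF F1] frac_homD[OF F2] frac_homD[OF F3]

lemma frac_rel_transI:
  assumes "(r, r') \<in> frac_rel C W (A1, w1, f1) (A3, w3, f3)" "(r', r'') \<in> frac_rel C W (A1, w1, f1) (A3, w3, f3)"
  shows "(r, r'') \<in> frac_rel C W (A1, w1, f1) (A3, w3, f3)"
  by (rule frac_rel_trans[OF F1 F3 assms])

abbreviation Rep1 :: "('o, 'a, 'c) frac2 set" where "Rep1 \<equiv> frac_rep C W (A1, w1, f1) (A2, w2, f2)"
abbreviation Rep2 :: "('o, 'a, 'c) frac2 set" where "Rep2 \<equiv> frac_rep C W (A2, w2, f2) (A3, w3, f3)"
abbreviation Rel13 :: "(('o, 'a, 'c) frac2 \<times> ('o, 'a, 'c) frac2) set" where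
  "Rel13 \<equiv> frac_rel C W (A1, w1, f1) (A3, w3, f3)"
abbreviation Paste :: "('o, 'a, 'c) frac2 \<Rightarrow> ('o, 'a, 'c) frac2 \<Rightarrow> 'o \<times> 'a \<times> 'a \<times> 'c \<Rightarrow> ('o, 'a, 'c) frac2" where
  "Paste \<equiv> frac_paste C (A1, w1, f1) (A2, w2, f2) (A3, w3, f3)"

section \<open>Pasting of representatives and its dependence on the data\<close>

lemma Paste_eq:
  "Paste (A4, u1, u2, \<alpha>1, \<beta>1) (A5, u3, u4, \<alpha>2, \<beta>2) (X, t1, t2, \<rho>) =
    (X, u1 \<cdot> t1, u4 \<cdot> t2, paste w1 w2 w3 u1 u2 u3 u4 \<alpha>1 \<alpha>2 t1 t2 \<rho>, paste f1 f2 f3 u1 u2 u3 u4 \<beta>1 \<beta>2 t1 t2 \<rho>)"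
  by (simp add: paste_def)

text \<open>Weaker than \<^const>\<open>F4_data\<close> in two ways: only \<open>w2 \<rhd> \<rho>\<close> is invertible, which is all that is known for
  the data selected by Pronk, and only \<open>w1 \<cdot> u1 \<cdot> t1\<close> is in \<open>W\<close>,
  since the 1-cells along which representatives are restricted need not be in \<open>W\<close>.\<close>

fun weak_F4_data :: "('o, 'a, 'c) frac2 \<Rightarrow> ('o, 'a, 'c) frac2 \<Rightarrow> ('o \<times> 'a \<times> 'a \<times> 'c) set" where
  "weak_F4_data (A4, u1, u2, \<alpha>1, \<beta>1) (A5, u3, u4, \<alpha>2, \<beta>2) = {(X, t1, t2, \<rho>).
     t1 \<in> Mor C \<and> src C t1 = X \<and> trg C t1 = A4 \<and> t2 \<in> Mor C \<and> src C t2 = X \<and> trg C t2 = A5 \<and>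
     w1 \<cdot> u1 \<cdot> t1 \<in> W \<and> \<rho> \<in> Cell C \<and> dom C \<rho> = u2 \<cdot> t1 \<and> cod C \<rho> = u3 \<cdot> t2 \<and> iso (w2 \<rhd> \<rho>)}"

declare frac_paste.simps [simp del] weak_F4_data.simps [simp del]

lemma weak_F4_data_iff:
  "(X, t1, t2, \<rho>) \<in> weak_F4_data (A4, u1, u2, \<alpha>1, \<beta>1) (A5, u3, u4, \<alpha>2, \<beta>2) \<longleftrightarrow>
    t1 \<in> Mor C \<and> src C t1 = X \<and> trg C t1 = A4 \<and> t2 \<in> Mor C \<and> src C t2 = X \<and> trg C t2 = A5 \<and>
    w1 \<cdot> u1 \<cdot> t1 \<in> W \<and> \<rho> \<in> Cell C \<and> dom C \<rho> = u2 \<cdot> t1 \<and> cod C \<rho> = u3 \<cdot> t2 \<and> iso (w2 \<rhd> \<rho>)"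
  by (simp add: weak_F4_data.simps)

lemma paste_data_frac_rep:
  assumes "(A4, u1, u2, \<alpha>1, \<beta>1) \<in> Rep1" "(A5, u3, u4, \<alpha>2, \<beta>2) \<in> Rep2"
  shows "paste_data C w1 w2 w3 u1 u2 u3 u4 \<alpha>1 \<alpha>2" "paste_data C f1 f2 f3 u1 u2 u3 u4 \<beta>1 \<beta>2"
  by (unfold_locales; use assms in \<open>simp add: frac_rep_iff\<close>)+

lemma Paste_frac_rep:
  assumes r1: "r1 \<in> Rep1" and r2: "r2 \<in> Rep2" and d: "d \<in> weak_F4_data r1 r2"
  shows "Paste r1 r2 d \<in> frac_rep C W (A1, w1, f1) (A3, w3, f3)"
proof -
  obtain A4 u1 u2 \<alpha>1 \<beta>1 where r1': "r1 = (A4, u1, u2, \<alpha>1, \<beta>1)"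
    using prod_cases5 by metis
  obtain A5 u3 u4 \<alpha>2 \<beta>2 where r2': "r2 = (A5, u3, u4, \<alpha>2, \<beta>2)"
    using prod_cases5 by metis
  obtain X t1 t2 \<rho> where d': "d = (X, t1, t2, \<rho>)"
    using prod_cases4 by metis
  note S = r1[unfolded r1' frac_rep_iff] r2[unfolded r2' frac_rep_iff] d[unfolded r1' r2' d' weak_F4_data_iff]
  note pd = paste_data_frac_rep[OF r1[unfolded r1'] r2[unfolded r2']]
  note ps = paste_data.paste_simps[OF pd(1), of t1 t2 \<rho>] paste_data.paste_simps[OF pd(2), of t1 t2 \<rho>]
  show ?thesis
    unfolding r1' r2' d' Paste_eq frac_rep_iff by (simp add: ps S)
qed

text \<open>Restricting the pasted representative along \<open>z\<close> and transporting it along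
  the associators of its two legs gives, by \<open>paste_restrict\<close>, the pasting with
  restricted data.\<close>

lemma Paste_restrict:
  assumes r1: "(A4, u1, u2, \<alpha>1, \<beta>1) \<in> Rep1" and r2: "(A5, u3, u4, \<alpha>2, \<beta>2) \<in> Rep2"
    and d: "(X, t1, t2, \<rho>) \<in> weak_F4_data (A4, u1, u2, \<alpha>1, \<beta>1) (A5, u3, u4, \<alpha>2, \<beta>2)"
    and z: "z \<in> Mor C" "trg C z = X" "w1 \<cdot> u1 \<cdot> t1 \<cdot> z \<in> W"
    and d': "d' = (src C z, t1 \<cdot> z, t2 \<cdot> z, whisk_reassoc C (u2, t1) (u3, t2) \<rho> z)"
  shows "d' \<in> weak_F4_data (A4, u1, u2, \<alpha>1, \<beta>1) (A5, u3, u4, \<alpha>2, \<beta>2)"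
    "(Paste (A4, u1, u2, \<alpha>1, \<beta>1) (A5, u3, u4, \<alpha>2, \<beta>2) (X, t1, t2, \<rho>),
      Paste (A4, u1, u2, \<alpha>1, \<beta>1) (A5, u3, u4, \<alpha>2, \<beta>2) d') \<in> Rel13"
proof -
  note S = r1[unfolded frac_rep_iff] r2[unfolded frac_rep_iff] d[unfolded weak_F4_data_iff]
  note pd = paste_data_frac_rep[OF r1 r2]
  note ps = paste_data.paste_simps[OF pd(1), of t1 t2 \<rho>] paste_data.paste_simps[OF pd(2), of t1 t2 \<rho>]
  have "iso (w2 \<rhd> whisk_reassoc C (u2, t1) (u3, t2) \<rho> z)"
    by (rule iso_whisk_left_reassoc) (simp_all add: S z)
  then show d'_weak: "d' \<in> weak_F4_data (A4, u1, u2, \<alpha>1, \<beta>1) (A5, u3, u4, \<alpha>2, \<beta>2)"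
    unfolding d' weak_F4_data_iff by (simp add: S z)
  note P = Paste_frac_rep[OF r1 r2 d, unfolded Paste_eq]
  have W1: "w1 \<cdot> (u1 \<cdot> t1) \<cdot> z \<in> W"
    using W_iso_iff[of "w1 \<rhd> assoc C u1 t1 z" "w1 \<cdot> (u1 \<cdot> t1) \<cdot> z" "w1 \<cdot> u1 \<cdot> t1 \<cdot> z"] by (simp add: S z)
  have "z \<in> Mor C" "trg C z = X" by fact+
  note M1 = frac_rel_whisk[OF F1 F3 P this W1]
  note M1' = M1[THEN frac_rel_iff[THEN iffD1], THEN conjunct2, THEN conjunct1]
  show "(Paste (A4, u1, u2, \<alpha>1, \<beta>1) (A5, u3, u4, \<alpha>2, \<beta>2) (X, t1, t2, \<rho>),
      Paste (A4, u1, u2, \<alpha>1, \<beta>1) (A5, u3, u4, \<alpha>2, \<beta>2) d') \<in> Rel13"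
    unfolding d' Paste_eq
    by (rule frac_rel_transI[OF M1], rule frac_rel_transport[OF F1 F3 M1',
          where ?\<sigma>1.0 = "inv2 C (assoc C u1 t1 z)" and ?\<sigma>2.0 = "assoc C u4 t2 z"])
      (simp_all add: S z paste_data.paste_restrict[OF pd(1)] paste_data.paste_restrict[OF pd(2)])
qed

lemma Paste_iso_data:
  assumes r1: "(A4, u1, u2, \<alpha>1, \<beta>1) \<in> Rep1" and r2: "(A5, u3, u4, \<alpha>2, \<beta>2) \<in> Rep2"
    and d: "(X, t1, t2, \<rho>) \<in> weak_F4_data (A4, u1, u2, \<alpha>1, \<beta>1) (A5, u3, u4, \<alpha>2, \<beta>2)"
    and d': "(X', t1', t2', \<rho>') \<in> weak_F4_data (A4, u1, u2, \<alpha>1, \<beta>1) (A5, u3, u4, \<alpha>2, \<beta>2)"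
    and \<mu>: "iso \<mu>" "dom C \<mu> = t1" "cod C \<mu> = t1'" and \<nu>: "iso \<nu>" "dom C \<nu> = t2" "cod C \<nu> = t2'"
    and eq: "(u3 \<rhd> \<nu>) \<bullet> \<rho> = \<rho>' \<bullet> (u2 \<rhd> \<mu>)"
  shows "(Paste (A4, u1, u2, \<alpha>1, \<beta>1) (A5, u3, u4, \<alpha>2, \<beta>2) (X, t1, t2, \<rho>),
      Paste (A4, u1, u2, \<alpha>1, \<beta>1) (A5, u3, u4, \<alpha>2, \<beta>2) (X', t1', t2', \<rho>')) \<in> Rel13"
proof -
  note S = r1[unfolded frac_rep_iff] r2[unfolded frac_rep_iff] d[unfolded weak_F4_data_iff]
    d'[unfolded weak_F4_data_iff]
  note pd = paste_data_frac_rep[OF r1 r2]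
  have X': "X' = X"
    using parallel(3)[OF iso_Cell[OF \<mu>(1)] \<mu>(2,3)] S by simp
  show ?thesis
    unfolding Paste_eq X'
    by (rule frac_rel_transport[OF F1 F3 Paste_frac_rep[OF r1 r2 d, unfolded Paste_eq],
          where ?\<sigma>1.0 = "u1 \<rhd> inv2 C \<mu>" and ?\<sigma>2.0 = "u4 \<rhd> \<nu>"];
        (rule paste_data.paste_iso_data[OF pd(1)] paste_data.paste_iso_data[OF pd(2)])?;
        simp add: S \<mu> \<nu> eq)
qed

text \<open>The 2-cell \<gamma> contains \<open>f2 \<rhd> \<rho>\<close>, so a square commuting only
  under \<open>w2\<close> does not apply to it directly. Whiskered with a suitable \<open>s\<close>
  in \<open>W\<close> the square commutes without \<open>w2\<close>; both sets of data are
  restricted along this \<open>s\<close>.\<close>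

lemma Paste_square:
  assumes r1: "(A4, u1, u2, \<alpha>1, \<beta>1) \<in> Rep1" and r2: "(A5, u3, u4, \<alpha>2, \<beta>2) \<in> Rep2"
    and d: "(X, t1, t2, \<rho>) \<in> weak_F4_data (A4, u1, u2, \<alpha>1, \<beta>1) (A5, u3, u4, \<alpha>2, \<beta>2)"
    and d': "(X', t1', t2', \<rho>') \<in> weak_F4_data (A4, u1, u2, \<alpha>1, \<beta>1) (A5, u3, u4, \<alpha>2, \<beta>2)"
    and \<mu>: "iso \<mu>" "dom C \<mu> = t1" "cod C \<mu> = t1'" and \<nu>: "iso \<nu>" "dom C \<nu> = t2" "cod C \<nu> = t2'"
    and eq: "w2 \<rhd> ((u3 \<rhd> \<nu>) \<bullet> \<rho>) = w2 \<rhd> (\<rho>' \<bullet> (u2 \<rhd> \<mu>))"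
  shows "(Paste (A4, u1, u2, \<alpha>1, \<beta>1) (A5, u3, u4, \<alpha>2, \<beta>2) (X, t1, t2, \<rho>),
      Paste (A4, u1, u2, \<alpha>1, \<beta>1) (A5, u3, u4, \<alpha>2, \<beta>2) (X', t1', t2', \<rho>')) \<in> Rel13"
proof -
  note S = r1[unfolded frac_rep_iff] r2[unfolded frac_rep_iff] d[unfolded weak_F4_data_iff]
    d'[unfolded weak_F4_data_iff]
  have X': "X' = X"
    using parallel(3)[OF iso_Cell[OF \<mu>(1)] \<mu>(2,3)] S by simp
  obtain s where s: "s \<in> W" "trg C s = src C (u2 \<cdot> t1)"
    and eqs: "((u3 \<rhd> \<nu>) \<bullet> \<rho>) \<lhd> s = (\<rho>' \<bullet> (u2 \<rhd> \<mu>)) \<lhd> s"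
    by (rule whisk_left_W_faithful[of w2 "(u3 \<rhd> \<nu>) \<bullet> \<rho>" "\<rho>' \<bullet> (u2 \<rhd> \<mu>)" "u2 \<cdot> t1" "u3 \<cdot> t2'"])
      (simp_all add: S \<mu> \<nu> eq)
  have sX: "trg C s = X" "s \<in> Mor C"
    using s by (simp_all add: S)
  have sW: "w1 \<cdot> u1 \<cdot> t1 \<cdot> s \<in> W" "w1 \<cdot> u1 \<cdot> t1' \<cdot> s \<in> W"
    by (rule W_comp1_assoc3; simp add: S s sX X'[symmetric]; simp add: X')+
  note D = Paste_restrict[OF r1 r2 d sX(2,1) sW(1) refl]
  note D' = Paste_restrict[OF r1 r2 d' sX(2) sX(1)[folded X'] sW(2) refl]
  have sq: "(u3 \<rhd> (\<nu> \<lhd> s)) \<bullet> whisk_reassoc C (u2, t1) (u3, t2) \<rho> s =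
      whisk_reassoc C (u2, t1') (u3, t2') \<rho>' s \<bullet> (u2 \<rhd> (\<mu> \<lhd> s))"
    by (rule whisk_reassoc_square) (simp_all add: S \<mu> \<nu> sX eqs)
  have M: "(Paste (A4, u1, u2, \<alpha>1, \<beta>1) (A5, u3, u4, \<alpha>2, \<beta>2)
        (src C s, t1 \<cdot> s, t2 \<cdot> s, whisk_reassoc C (u2, t1) (u3, t2) \<rho> s),
      Paste (A4, u1, u2, \<alpha>1, \<beta>1) (A5, u3, u4, \<alpha>2, \<beta>2)
        (src C s, t1' \<cdot> s, t2' \<cdot> s, whisk_reassoc C (u2, t1') (u3, t2') \<rho>' s)) \<in> Rel13"
    by (rule Paste_iso_data[OF r1 r2 D(1) D'(1) _ _ _ _ _ _ sq]) (simp_all add: S \<mu> \<nu> sX)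
  show ?thesis
    by (rule frac_rel_transI[OF D(2) frac_rel_transI[OF M frac_rel_sym[OF F1 F3 D'(2)]]])
qed

text \<open>When the first legs are isomorphic, the second legs become so after a restriction: the
  2-cell induced between them under \<open>w2 \<cdot> u3\<close> can be lifted, because membership
  in \<open>Rep2\<close> puts \<open>w2 \<cdot> u3\<close> in \<open>W\<close>.\<close>

lemma Paste_same_leg:
  assumes r1: "(A4, u1, u2, \<alpha>1, \<beta>1) \<in> Rep1" and r2: "(A5, u3, u4, \<alpha>2, \<beta>2) \<in> Rep2"
    and d: "(X, t1, t2, \<rho>) \<in> weak_F4_data (A4, u1, u2, \<alpha>1, \<beta>1) (A5, u3, u4, \<alpha>2, \<beta>2)"
    and d': "(X, t1', t2', \<rho>') \<in> weak_F4_data (A4, u1, u2, \<alpha>1, \<beta>1) (A5, u3, u4, \<alpha>2, \<beta>2)"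
    and \<mu>: "iso \<mu>" "dom C \<mu> = t1" "cod C \<mu> = t1'"
  shows "(Paste (A4, u1, u2, \<alpha>1, \<beta>1) (A5, u3, u4, \<alpha>2, \<beta>2) (X, t1, t2, \<rho>),
      Paste (A4, u1, u2, \<alpha>1, \<beta>1) (A5, u3, u4, \<alpha>2, \<beta>2) (X, t1', t2', \<rho>')) \<in> Rel13"
proof -
  note S = r1[unfolded frac_rep_iff] r2[unfolded frac_rep_iff] d[unfolded weak_F4_data_iff]
    d'[unfolded weak_F4_data_iff]
  \<comment> \<open>Back along \<open>w2 \<rhd> \<rho>\<close>, across \<mu>, and on along
    \<open>w2 \<rhd> \<rho>'\<close>: an invertible 2-cell even if \<rho> and \<rho>' are not.
    \<open>?\<kappa>\<close> is its rebracketing for the lifting along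
    \<open>w2 \<cdot> u3\<close>.\<close>
  let ?\<kappa>0 = "(w2 \<rhd> \<rho>') \<bullet> (w2 \<rhd> u2 \<rhd> \<mu>) \<bullet> inv2 C (w2 \<rhd> \<rho>)"
  let ?\<kappa> = "inv2 C (assoc C w2 u3 t2') \<bullet> ?\<kappa>0 \<bullet> assoc C w2 u3 t2"
  obtain s \<nu> where s: "s \<in> W" "trg C s = src C t2"
    and \<nu>: "iso \<nu>" "dom C \<nu> = t2 \<cdot> s" "cod C \<nu> = t2' \<cdot> s"
    and lift: "whisk_reassoc C (w2 \<cdot> u3, t2) (w2 \<cdot> u3, t2') ?\<kappa> s = w2 \<cdot> u3 \<rhd> \<nu>"
    by (rule lift_iso[of "w2 \<cdot> u3" t2 t2' ?\<kappa>]) (simp_all add: S \<mu>)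
  have sX: "trg C s = X" "s \<in> Mor C"
    using s by (simp_all add: S)
  have sW: "w1 \<cdot> u1 \<cdot> t1 \<cdot> s \<in> W" "w1 \<cdot> u1 \<cdot> t1' \<cdot> s \<in> W"
    by (rule W_comp1_assoc3; simp add: S s sX)+
  note D = Paste_restrict[OF r1 r2 d sX(2,1) sW(1) refl]
  note D' = Paste_restrict[OF r1 r2 d' sX(2,1) sW(2) refl]
  have "w2 \<rhd> ((u3 \<rhd> \<nu>) \<bullet> whisk_reassoc C (u2, t1) (u3, t2) \<rho> s) =
      w2 \<rhd> (whisk_reassoc C (u2, t1') (u3, t2') \<rho>' s \<bullet> (u2 \<rhd> (\<mu> \<lhd> s)))"
    by (rule lifted_square[OF _ _ _ _ _ _ _ _ _ _ _ _ _ _ _ _ _ _ _ _ _ _ _ _ _ _ _ _ _ lift])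
      (simp_all add: S \<mu> \<nu> sX)
  then have M: "(Paste (A4, u1, u2, \<alpha>1, \<beta>1) (A5, u3, u4, \<alpha>2, \<beta>2)
        (src C s, t1 \<cdot> s, t2 \<cdot> s, whisk_reassoc C (u2, t1) (u3, t2) \<rho> s),
      Paste (A4, u1, u2, \<alpha>1, \<beta>1) (A5, u3, u4, \<alpha>2, \<beta>2)
        (src C s, t1' \<cdot> s, t2' \<cdot> s, whisk_reassoc C (u2, t1') (u3, t2') \<rho>' s)) \<in> Rel13"
    by (rule Paste_square[OF r1 r2 D(1) D'(1), rotated -1]) (simp_all add: S \<mu> \<nu> sX)
  show ?thesis
    by (rule frac_rel_transI[OF D(2) frac_rel_transI[OF M frac_rel_sym[OF F1 F3 D'(2)]]])
qed

text \<open>Completing \<open>t1\<close> and \<open>t1'\<close> to a square over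
  \<open>w1 \<cdot> u1\<close> reduces the claim to data with isomorphic first legs.\<close>

lemma Paste_independent:
  assumes r1: "(A4, u1, u2, \<alpha>1, \<beta>1) \<in> Rep1" and r2: "(A5, u3, u4, \<alpha>2, \<beta>2) \<in> Rep2"
    and d: "(X, t1, t2, \<rho>) \<in> weak_F4_data (A4, u1, u2, \<alpha>1, \<beta>1) (A5, u3, u4, \<alpha>2, \<beta>2)"
    and d': "(X', t1', t2', \<rho>') \<in> weak_F4_data (A4, u1, u2, \<alpha>1, \<beta>1) (A5, u3, u4, \<alpha>2, \<beta>2)"
  shows "(Paste (A4, u1, u2, \<alpha>1, \<beta>1) (A5, u3, u4, \<alpha>2, \<beta>2) (X, t1, t2, \<rho>),
      Paste (A4, u1, u2, \<alpha>1, \<beta>1) (A5, u3, u4, \<alpha>2, \<beta>2) (X', t1', t2', \<rho>')) \<in> Rel13"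
proof -
  note S = r1[unfolded frac_rep_iff] r2[unfolded frac_rep_iff] d[unfolded weak_F4_data_iff]
    d'[unfolded weak_F4_data_iff]
  have "(w1 \<cdot> u1) \<cdot> t1' \<in> W"
    using W_assoc_iff[of t1' u1 w1] by (simp add: S)
  then obtain p q \<mu> where p: "p \<in> W" "trg C p = src C t1"
    and q: "q \<in> Mor C" "trg C q = src C t1'" "src C q = src C p"
    and \<mu>: "iso \<mu>" "dom C \<mu> = t1 \<cdot> p" "cod C \<mu> = t1' \<cdot> q"
    using square_completion[of "w1 \<cdot> u1" t1 t1' thesis] by (simp add: S)
  have pX: "p \<in> Mor C" "trg C p = X" "trg C q = X'"
    using p q by (simp_all add: S)
  have pW: "w1 \<cdot> u1 \<cdot> t1 \<cdot> p \<in> W"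
    by (rule W_comp1_assoc3; simp add: S p)
  \<comment> \<open>\<open>q\<close> itself is not known to be in \<open>W\<close>; the composite
    is, through \<mu>.\<close>
  then have qW: "w1 \<cdot> u1 \<cdot> t1' \<cdot> q \<in> W"
    using W_iso_iff[of "w1 \<rhd> u1 \<rhd> \<mu>" "w1 \<cdot> u1 \<cdot> t1 \<cdot> p" "w1 \<cdot> u1 \<cdot> t1' \<cdot> q"] by (simp add: S p \<mu>)
  note D = Paste_restrict[OF r1 r2 d pX(1,2) pW refl]
  note D' = Paste_restrict[OF r1 r2 d' q(1) pX(3) qW refl, unfolded q(3)]
  show ?thesis
    by (rule frac_rel_transI[OF D(2) frac_rel_transI[OF
          Paste_same_leg[OF r1 r2 D(1) D'(1) \<mu>] frac_rel_sym[OF F1 F3 D'(2)]]])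
qed

text \<open>Composing the legs of the data with \<open>z\<close> and \<open>y\<close> shifts the
  restriction from the representatives to the data; the associators of the outer legs give the
  transport between the two pastings.\<close>

lemma Paste_whisk_args:
  assumes r1: "(A4, u1, u2, \<alpha>1, \<beta>1) \<in> Rep1" and r2: "(A5, u3, u4, \<alpha>2, \<beta>2) \<in> Rep2"
    and z: "z \<in> Mor C" "trg C z = A4" and y: "y \<in> Mor C" "trg C y = A5"
    and r1': "r1' = (src C z, u1 \<cdot> z, u2 \<cdot> z, whisk_reassoc C (w1, u1) (w2, u2) \<alpha>1 z,
      whisk_reassoc C (f1, u1) (f2, u2) \<beta>1 z)" "r1' \<in> Rep1"
    and r2': "r2' = (src C y, u3 \<cdot> y, u4 \<cdot> y, whisk_reassoc C (w2, u3) (w3, u4) \<alpha>2 y,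
      whisk_reassoc C (f2, u3) (f3, u4) \<beta>2 y)" "r2' \<in> Rep2"
    and d: "d \<in> weak_F4_data r1' r2'"
  obtains d' where "d' \<in> weak_F4_data (A4, u1, u2, \<alpha>1, \<beta>1) (A5, u3, u4, \<alpha>2, \<beta>2)"
    "(Paste r1' r2' d, Paste (A4, u1, u2, \<alpha>1, \<beta>1) (A5, u3, u4, \<alpha>2, \<beta>2) d') \<in> Rel13"
proof -
  obtain X t1 t2 \<rho> where d': "d = (X, t1, t2, \<rho>)"
    using prod_cases4 by metis
  note S = r1[unfolded frac_rep_iff] r2[unfolded frac_rep_iff] d[unfolded r1' r2' d' weak_F4_data_iff] z y
  note pd = paste_data_frac_rep[OF r1 r2]
  let ?d = "(X, z \<cdot> t1, y \<cdot> t2, assoc C u3 y t2 \<bullet> \<rho> \<bullet> inv2 C (assoc C u2 z t1))"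
  have "w2 \<rhd> (assoc C u3 y t2 \<bullet> \<rho> \<bullet> inv2 C (assoc C u2 z t1)) =
      (w2 \<rhd> assoc C u3 y t2) \<bullet> (w2 \<rhd> \<rho>) \<bullet> (w2 \<rhd> inv2 C (assoc C u2 z t1))"
    by (rule whisk_left_vcomp3) (simp_all add: S)
  moreover have "w1 \<cdot> u1 \<cdot> z \<cdot> t1 \<in> W"
    using W_iso_iff[of "w1 \<rhd> assoc C u1 z t1" "w1 \<cdot> (u1 \<cdot> z) \<cdot> t1" "w1 \<cdot> u1 \<cdot> z \<cdot> t1"] by (simp add: S)
  ultimately have "?d \<in> weak_F4_data (A4, u1, u2, \<alpha>1, \<beta>1) (A5, u3, u4, \<alpha>2, \<beta>2)"
    by (simp add: weak_F4_data_iff S)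
  moreover have "(Paste r1' r2' d, Paste (A4, u1, u2, \<alpha>1, \<beta>1) (A5, u3, u4, \<alpha>2, \<beta>2) ?d) \<in> Rel13"
    unfolding d' r1'(1) r2'(1) Paste_eq
    by (rule frac_rel_transport[OF F1 F3
          Paste_frac_rep[OF r1'(2) r2'(2) d, unfolded d' r1'(1) r2'(1) Paste_eq],
          where ?\<sigma>1.0 = "inv2 C (assoc C u1 z t1)" and ?\<sigma>2.0 = "assoc C u4 y t2"];
        (rule paste_data.paste_whisk_args[OF pd(1)] paste_data.paste_whisk_args[OF pd(2)])?;
        simp add: S)
  ultimately show ?thesis by (rule that)
qed

text \<open>\<sigma>2 and \<tau>1 are pasted onto \<rho>. The data move from the changed
  representatives to the original ones, as in \<open>Paste_whisk_args\<close>.\<close>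

lemma Paste_transport_args:
  assumes r1: "r1 = (A4, u1, u2, \<alpha>1, \<beta>1)" "r1 \<in> Rep1" and r2: "r2 = (A5, u3, u4, \<alpha>2, \<beta>2)" "r2 \<in> Rep2"
    and \<sigma>1: "iso \<sigma>1" "dom C \<sigma>1 = u1'" "cod C \<sigma>1 = u1"
    and \<sigma>2: "iso \<sigma>2" "dom C \<sigma>2 = u2" "cod C \<sigma>2 = u2'"
    and \<tau>1: "iso \<tau>1" "dom C \<tau>1 = u3'" "cod C \<tau>1 = u3"
    and \<tau>2: "iso \<tau>2" "dom C \<tau>2 = u4" "cod C \<tau>2 = u4'"
    and r1': "r1' = (A4, u1', u2', (w2 \<rhd> \<sigma>2) \<bullet> \<alpha>1 \<bullet> (w1 \<rhd> \<sigma>1), (f2 \<rhd> \<sigma>2) \<bullet> \<beta>1 \<bullet> (f1 \<rhd> \<sigma>1))"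
    and r2': "r2' = (A5, u3', u4', (w3 \<rhd> \<tau>2) \<bullet> \<alpha>2 \<bullet> (w2 \<rhd> \<tau>1), (f3 \<rhd> \<tau>2) \<bullet> \<beta>2 \<bullet> (f2 \<rhd> \<tau>1))"
    and d: "d \<in> weak_F4_data r1' r2'"
  obtains d' where "d' \<in> weak_F4_data r1 r2" "(Paste r1 r2 d', Paste r1' r2' d) \<in> Rel13"
proof -
  obtain X t1 t2 \<rho> where d': "d = (X, t1, t2, \<rho>)"
    using prod_cases4 by metis
  note S = r1(2)[unfolded r1(1) frac_rep_iff] r2(2)[unfolded r2(1) frac_rep_iff]
    d[unfolded r1' r2' d' weak_F4_data_iff] \<sigma>1 \<sigma>2 \<tau>1 \<tau>2
  note par = parallel[OF iso_Cell[OF \<sigma>1(1)] \<sigma>1(2,3)] parallel[OF iso_Cell[OF \<sigma>2(1)] \<sigma>2(2,3)]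
    parallel[OF iso_Cell[OF \<tau>1(1)] \<tau>1(2,3)] parallel[OF iso_Cell[OF \<tau>2(1)] \<tau>2(2,3)]
  have u': "u1' \<in> Mor C" "u2' \<in> Mor C" "u3' \<in> Mor C" "u4' \<in> Mor C"
    "src C u1' = A4" "src C u2' = A4" "src C u3' = A5" "src C u4' = A5"
    "trg C u1' = A1" "trg C u2' = A2" "trg C u3' = A2" "trg C u4' = A3"
    using par S by auto
  note pd = paste_data_frac_rep[OF r1(2)[unfolded r1(1)] r2(2)[unfolded r2(1)]]
  let ?\<rho> = "(\<tau>1 \<lhd> t2) \<bullet> \<rho> \<bullet> (\<sigma>2 \<lhd> t1)"
  let ?d = "(X, t1, t2, ?\<rho>)"
  have "w2 \<rhd> ?\<rho> = (w2 \<rhd> (\<tau>1 \<lhd> t2)) \<bullet> (w2 \<rhd> \<rho>) \<bullet> (w2 \<rhd> (\<sigma>2 \<lhd> t1))"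
    by (rule whisk_left_vcomp3) (simp_all add: S u')
  moreover have "w1 \<cdot> u1 \<cdot> t1 \<in> W"
    using W_iso_iff[of "w1 \<rhd> (\<sigma>1 \<lhd> t1)" "w1 \<cdot> u1' \<cdot> t1" "w1 \<cdot> u1 \<cdot> t1"] by (simp add: S u')
  ultimately have d_weak: "?d \<in> weak_F4_data r1 r2"
    unfolding r1(1) r2(1) by (simp add: weak_F4_data_iff S u')
  moreover have "(Paste r1 r2 ?d, Paste r1' r2' d) \<in> Rel13"
    unfolding d' r1(1) r2(1) r1' r2' Paste_eq
    by (rule frac_rel_transport[OF F1 F3
          Paste_frac_rep[OF r1(2) r2(2) d_weak, unfolded r1(1) r2(1) Paste_eq],
          where ?\<sigma>1.0 = "\<sigma>1 \<lhd> t1" and ?\<sigma>2.0 = "\<tau>2 \<lhd> t2"];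
        (rule paste_data.paste_transport_args[OF pd(1)] paste_data.paste_transport_args[OF pd(2)])?;
        simp add: S u')
  ultimately show ?thesis by (rule that)
qed

text \<open>The two pairs of representatives are compared through their restrictions along the
  witnesses, \<open>q1 q2\<close> and \<open>q1' q2'\<close>, which differ by a transport. Since
  data pass from restricted or transported representatives to the original ones, a single set of
  data for \<open>q1' q2'\<close> induces data for the other three pairs, with equivalent pastings.
  Independence of the data closes the chain at both ends.\<close>

lemma Paste_well_defined:
  assumes rel1: "(r1, r1') \<in> frac_rel C W (A1, w1, f1) (A2, w2, f2)"
    and rel2: "(r2, r2') \<in> frac_rel C W (A2, w2, f2) (A3, w3, f3)"
    and d: "d \<in> weak_F4_data r1 r2" and d': "d' \<in> weak_F4_data r1' r2'"
  shows "(Paste r1 r2 d, Paste r1' r2' d') \<in> Rel13"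
proof -
  obtain A4 u1 u2 \<alpha>1 \<beta>1 A4' u1' u2' \<alpha>1' \<beta>1' where
    r1: "r1 = (A4, u1, u2, \<alpha>1, \<beta>1)" "r1' = (A4', u1', u2', \<alpha>1', \<beta>1')"
    using prod_cases5 by metis
  obtain A5 u3 u4 \<alpha>2 \<beta>2 A5' u3' u4' \<alpha>2' \<beta>2' where
    r2: "r2 = (A5, u3, u4, \<alpha>2, \<beta>2)" "r2' = (A5', u3', u4', \<alpha>2', \<beta>2')"
    using prod_cases5 by metis
  note rel = rel1[unfolded r1 frac_rel_iff] rel2[unfolded r2 frac_rel_iff]
  note rep = rel[THEN conjunct1] rel[THEN conjunct2, THEN conjunct1]
  note S = rep[unfolded frac_rep_iff]
  obtain z z' \<sigma>1 \<sigma>2 where z: "z \<in> Mor C" "trg C z = A4" "z' \<in> Mor C" "trg C z' = A4'" "src C z' = src C z"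
    and \<sigma>1: "iso \<sigma>1" "dom C \<sigma>1 = u1' \<cdot> z'" "cod C \<sigma>1 = u1 \<cdot> z"
    and \<sigma>2: "iso \<sigma>2" "dom C \<sigma>2 = u2 \<cdot> z" "cod C \<sigma>2 = u2' \<cdot> z'"
    and zW: "w1 \<cdot> u1 \<cdot> z \<in> W"
    and eq1: "transports w1 w2 u1 u2 \<alpha>1 z u1' u2' \<alpha>1' z' \<sigma>1 \<sigma>2"
      "transports f1 f2 u1 u2 \<beta>1 z u1' u2' \<beta>1' z' \<sigma>1 \<sigma>2"
    using rel(1) by blast
  obtain y y' \<tau>1 \<tau>2 where y: "y \<in> Mor C" "trg C y = A5" "y' \<in> Mor C" "trg C y' = A5'" "src C y' = src C y"
    and \<tau>1: "iso \<tau>1" "dom C \<tau>1 = u3' \<cdot> y'" "cod C \<tau>1 = u3 \<cdot> y"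
    and \<tau>2: "iso \<tau>2" "dom C \<tau>2 = u4 \<cdot> y" "cod C \<tau>2 = u4' \<cdot> y'"
    and yW: "w2 \<cdot> u3 \<cdot> y \<in> W"
    and eq2: "transports w2 w3 u3 u4 \<alpha>2 y u3' u4' \<alpha>2' y' \<tau>1 \<tau>2"
      "transports f2 f3 u3 u4 \<beta>2 y u3' u4' \<beta>2' y' \<tau>1 \<tau>2"
    using rel(2) by blast
  have zW': "w1 \<cdot> u1' \<cdot> z' \<in> W"
    using W_iso_iff[of "w1 \<rhd> \<sigma>1" "w1 \<cdot> u1' \<cdot> z'" "w1 \<cdot> u1 \<cdot> z"] by (simp add: zW S z \<sigma>1)
  have yW': "w2 \<cdot> u3' \<cdot> y' \<in> W"
    using W_iso_iff[of "w2 \<rhd> \<tau>1" "w2 \<cdot> u3' \<cdot> y'" "w2 \<cdot> u3 \<cdot> y"] by (simp add: yW S y \<tau>1)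
  define q1 where "q1 = (src C z, u1 \<cdot> z, u2 \<cdot> z, whisk_reassoc C (w1, u1) (w2, u2) \<alpha>1 z,
    whisk_reassoc C (f1, u1) (f2, u2) \<beta>1 z)"
  define q1' where "q1' = (src C z', u1' \<cdot> z', u2' \<cdot> z', whisk_reassoc C (w1, u1') (w2, u2') \<alpha>1' z',
    whisk_reassoc C (f1, u1') (f2, u2') \<beta>1' z')"
  define q2 where "q2 = (src C y, u3 \<cdot> y, u4 \<cdot> y, whisk_reassoc C (w2, u3) (w3, u4) \<alpha>2 y,
    whisk_reassoc C (f2, u3) (f3, u4) \<beta>2 y)"
  define q2' where "q2' = (src C y', u3' \<cdot> y', u4' \<cdot> y', whisk_reassoc C (w2, u3') (w3, u4') \<alpha>2' y',
    whisk_reassoc C (f2, u3') (f3, u4') \<beta>2' y')"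
  have q: "q1 \<in> Rep1" "q1' \<in> Rep1" "q2 \<in> Rep2" "q2' \<in> Rep2"
    unfolding q1_def q1'_def q2_def q2'_def frac_rep_iff by (simp_all add: S z y zW zW' yW yW')
  \<comment> \<open>The equations of the witness identify the restriction of \<open>r1'\<close> with
    a transport of \<open>q1\<close>; likewise for \<open>q2'\<close> below.\<close>
  have q1'_eq: "q1' = (src C z, u1' \<cdot> z', u2' \<cdot> z',
      (w2 \<rhd> \<sigma>2) \<bullet> whisk_reassoc C (w1, u1) (w2, u2) \<alpha>1 z \<bullet> (w1 \<rhd> \<sigma>1),
      (f2 \<rhd> \<sigma>2) \<bullet> whisk_reassoc C (f1, u1) (f2, u2) \<beta>1 z \<bullet> (f1 \<rhd> \<sigma>1))"
    unfolding q1'_def eq1[unfolded transports_def] z(5) ..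
  have q2'_eq: "q2' = (src C y, u3' \<cdot> y', u4' \<cdot> y',
      (w3 \<rhd> \<tau>2) \<bullet> whisk_reassoc C (w2, u3) (w3, u4) \<alpha>2 y \<bullet> (w2 \<rhd> \<tau>1),
      (f3 \<rhd> \<tau>2) \<bullet> whisk_reassoc C (f2, u3) (f3, u4) \<beta>2 y \<bullet> (f2 \<rhd> \<tau>1))"
    unfolding q2'_def eq2[unfolded transports_def] y(5) ..
  \<comment> \<open>Data for \<open>q1' q2'\<close> exist because
    \<open>w2 \<cdot> u3' \<cdot> y'\<close> is in \<open>W\<close>, so that the inner legs complete
    to a square.\<close>
  obtain p q \<mu> where p: "p \<in> W" "trg C p = src C (u2' \<cdot> z')"
    and q_: "q \<in> Mor C" "trg C q = src C (u3' \<cdot> y')" "src C q = src C p"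
    and \<mu>: "iso \<mu>" "dom C \<mu> = (u2' \<cdot> z') \<cdot> p" "cod C \<mu> = (u3' \<cdot> y') \<cdot> q"
    by (rule square_completion[of w2 "u2' \<cdot> z'" "u3' \<cdot> y'"]) (simp_all add: S z y yW')
  have "w1 \<cdot> (u1' \<cdot> z') \<cdot> p \<in> W"
    by (rule W_comp1_assoc) (use p in \<open>simp_all add: S z zW'\<close>)
  then have d0: "(src C p, p, q, \<mu>) \<in> weak_F4_data q1' q2'"
    unfolding q1'_def q2'_def weak_F4_data_iff using p q_ \<mu> by (simp add: S z y)
  obtain d1 where d1: "d1 \<in> weak_F4_data r1' r2'" "(Paste q1' q2' (src C p, p, q, \<mu>), Paste r1' r2' d1) \<in> Rel13"
    using Paste_whisk_args[OF rep(3,4) z(3,4) y(3,4) q1'_def q(2) q2'_def q(4) d0] unfolding r1 r2 by blast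
  obtain d2 where d2: "d2 \<in> weak_F4_data q1 q2" "(Paste q1 q2 d2, Paste q1' q2' (src C p, p, q, \<mu>)) \<in> Rel13"
    using Paste_transport_args[OF q1_def q(1) q2_def q(3) \<sigma>1 \<sigma>2 \<tau>1 \<tau>2 q1'_eq q2'_eq d0] by blast
  obtain d3 where d3: "d3 \<in> weak_F4_data r1 r2" "(Paste q1 q2 d2, Paste r1 r2 d3) \<in> Rel13"
    using Paste_whisk_args[OF rep(1,2) z(1,2) y(1,2) q1_def q(1) q2_def q(3) d2(1)] unfolding r1 r2 by blast
  have "(Paste r1 r2 d, Paste r1 r2 d3) \<in> Rel13"
    by (cases d; cases d3) (use Paste_independent[OF rep(1,2)] d d3(1) in \<open>simp add: r1 r2\<close>)
  moreover have "(Paste r1 r2 d3, Paste q1 q2 d2) \<in> Rel13"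
    by (rule frac_rel_sym[OF F1 F3 d3(2)])
  moreover have "(Paste r1' r2' d1, Paste r1' r2' d') \<in> Rel13"
    by (cases d1; cases d') (use Paste_independent[OF rep(3,4)] d' d1(1) in \<open>simp add: r1 r2\<close>)
  ultimately show ?thesis
    using d1(2) d2(2) frac_rel_transI by blast
qed

section \<open>Given data, Pronk's data and the resulting class\<close>

lemma F4_data_weak:
  assumes "r1 \<in> Rep1" "r2 \<in> Rep2" "d \<in> F4_data C W r1 r2"
  shows "d \<in> weak_F4_data r1 r2"
proof -
  obtain A4 u1 u2 \<alpha>1 \<beta>1 where r1: "r1 = (A4, u1, u2, \<alpha>1, \<beta>1)"
    using prod_cases5 by metis
  obtain A5 u3 u4 \<alpha>2 \<beta>2 where r2: "r2 = (A5, u3, u4, \<alpha>2, \<beta>2)"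
    using prod_cases5 by metis
  obtain X t1 t2 \<rho> where d: "d = (X, t1, t2, \<rho>)"
    using prod_cases4 by metis
  have t: "t1 \<in> W" "src C t1 = X" "trg C t1 = A4" "t2 \<in> Mor C" "src C t2 = X" "trg C t2 = A5"
    and \<rho>: "iso \<rho>" "dom C \<rho> = u2 \<cdot> t1" "cod C \<rho> = u3 \<cdot> t2"
    using assms(3) by (auto simp: r1 r2 d hom_def iso2_iff)
  note S = assms(1,2)[unfolded r1 r2 frac_rep_iff]
  have "w1 \<cdot> u1 \<cdot> t1 \<in> W"
    by (rule W_comp1_assoc) (simp_all add: S t)
  then show ?thesis
    unfolding r1 r2 d weak_F4_data_iff by (simp add: S t \<rho>)
qed

text \<open>The lifting \<sigma> selected by \<open>dd\<close> may fail to be invertible, but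
  \<open>w2 \<rhd> \<sigma>\<close> is by construction a restriction of the invertible
  \<rho>1.\<close>

lemma Pronk_data_weak:
  assumes cc: "C_choice C W cc" and dd: "D_choice C W dd" and "r1 \<in> Rep1" "r2 \<in> Rep2"
  shows "Pronk_data C cc dd (A2, w2, f2) r1 r2 \<in> weak_F4_data r1 r2"
proof -
  obtain A4 u1 u2 \<alpha>1 \<beta>1 where r1: "r1 = (A4, u1, u2, \<alpha>1, \<beta>1)"
    using prod_cases5 by metis
  obtain A5 u3 u4 \<alpha>2 \<beta>2 where r2: "r2 = (A5, u3, u4, \<alpha>2, \<beta>2)"
    using prod_cases5 by metis
  note S = assms(3,4)[unfolded r1 r2 frac_rep_iff]
  obtain E v' g \<rho>0 where cc_eq: "cc (w2 \<cdot> u2) (w2 \<cdot> u3) = (E, v', g, \<rho>0)"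
    using prod_cases4 by metis
  have "w2 \<cdot> u2 \<in> hom C A4 A" "w2 \<cdot> u3 \<in> hom C A5 A \<inter> W"
    by (auto simp: S hom_def)
  then have "case cc (w2 \<cdot> u2) (w2 \<cdot> u3) of (A'', v', f', \<rho>) \<Rightarrow>
      v' \<in> hom C A'' A4 \<inter> W \<and> f' \<in> hom C A'' A5 \<and> \<rho> \<in> iso2 C ((w2 \<cdot> u2) \<cdot> v') ((w2 \<cdot> u3) \<cdot> f')"
    by (rule cc[unfolded C_choice_def, rule_format])
  then have v': "v' \<in> W" "src C v' = E" "trg C v' = A4"
    and g: "g \<in> Mor C" "src C g = E" "trg C g = A5"
    and \<rho>0: "iso \<rho>0" "dom C \<rho>0 = (w2 \<cdot> u2) \<cdot> v'" "cod C \<rho>0 = (w2 \<cdot> u3) \<cdot> g"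
    by (auto simp: cc_eq hom_def iso2_iff)
  define \<rho>1 where "\<rho>1 = assoc C w2 u3 g \<bullet> \<rho>0 \<bullet> inv2 C (assoc C w2 u2 v')"
  have \<rho>1: "iso \<rho>1" "dom C \<rho>1 = w2 \<cdot> u2 \<cdot> v'" "cod C \<rho>1 = w2 \<cdot> u3 \<cdot> g"
    unfolding \<rho>1_def by (simp_all add: S v' g \<rho>0)
  obtain D v \<sigma> where dd_eq: "dd w2 (u2 \<cdot> v') (u3 \<cdot> g) \<rho>1 = (D, v, \<sigma>)"
    using prod_cases3 by metis
  have "w2 \<in> hom C A2 A \<inter> W" "u2 \<cdot> v' \<in> hom C E A2" "u3 \<cdot> g \<in> hom C E A2"
    "\<rho>1 \<in> hom2 C (w2 \<cdot> u2 \<cdot> v') (w2 \<cdot> u3 \<cdot> g)"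
    using \<rho>1 by (auto simp: S v' g hom_def hom2_def)
  then have "dd w2 (u2 \<cdot> v') (u3 \<cdot> g) \<rho>1 \<in> liftings C W w2 (u2 \<cdot> v') (u3 \<cdot> g) \<rho>1"
    by (rule dd[unfolded D_choice_def, rule_format])
  then have v: "v \<in> W" "src C v = D" "trg C v = E"
    and \<sigma>: "\<sigma> \<in> Cell C" "dom C \<sigma> = (u2 \<cdot> v') \<cdot> v" "cod C \<sigma> = (u3 \<cdot> g) \<cdot> v"
    and lift: "whisk_reassoc C (w2, u2 \<cdot> v') (w2, u3 \<cdot> g) \<rho>1 v = w2 \<rhd> \<sigma>"
    by (auto simp: dd_eq liftings_def hom_def hom2_def S v' g)
  note S = S v' g v \<sigma>
  have \<sigma>_iso: "iso (w2 \<rhd> \<sigma>)"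
    unfolding lift[symmetric] by (simp add: S \<rho>1)
  have "w2 \<rhd> (assoc C u3 g v \<bullet> \<sigma> \<bullet> inv2 C (assoc C u2 v' v)) =
      (w2 \<rhd> assoc C u3 g v) \<bullet> (w2 \<rhd> \<sigma>) \<bullet> (w2 \<rhd> inv2 C (assoc C u2 v' v))"
    by (rule whisk_left_vcomp3) (simp_all add: S)
  moreover have "w1 \<cdot> u1 \<cdot> v' \<cdot> v \<in> W"
    by (rule W_comp1_assoc) (simp_all add: S)
  ultimately show ?thesis
    unfolding r1 r2 Pronk_data.simps
    by (simp add: cc_eq \<rho>1_def[symmetric] dd_eq weak_F4_data_iff S \<sigma>_iso)
qed

text \<open>Well-definedness, with Pronk's data on one side and \<open>d\<close> on the other, shows
  that all members of the union are the same class; \<open>r1\<close> and \<open>r2\<close> make the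
  union nonempty.\<close>

lemma frac_vcomp_eq_class:
  assumes cc: "C_choice C W cc" and dd: "D_choice C W dd"
    and \<Gamma>1: "\<Gamma>1 \<in> frac_hom2 C W (A1, w1, f1) (A2, w2, f2)"
    and \<Gamma>2: "\<Gamma>2 \<in> frac_hom2 C W (A2, w2, f2) (A3, w3, f3)"
    and r: "r1 \<in> \<Gamma>1" "r2 \<in> \<Gamma>2" and d: "d \<in> weak_F4_data r1 r2"
  shows "frac_vcomp C W cc dd (A1, w1, f1) (A2, w2, f2) (A3, w3, f3) \<Gamma>2 \<Gamma>1 = Rel13 `` {Paste r1 r2 d}"
proof -
  note E1 = equiv_frac_rel[OF F1 F2] and E2 = equiv_frac_rel[OF F2 F3]
  have "Rel13 `` {Paste r1' r2' (Pronk_data C cc dd (A2, w2, f2) r1' r2')} = Rel13 `` {Paste r1 r2 d}"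
    if r': "r1' \<in> \<Gamma>1" "r2' \<in> \<Gamma>2" for r1' r2'
  proof (rule equiv_class_eq[OF equiv_frac_rel[OF F1 F3]], rule Paste_well_defined)
    show "(r1', r1) \<in> frac_rel C W (A1, w1, f1) (A2, w2, f2)"
      using in_quotient_imp_in_rel[OF E1 \<Gamma>1[unfolded frac_hom2_def]] r r' by blast
    show "(r2', r2) \<in> frac_rel C W (A2, w2, f2) (A3, w3, f3)"
      using in_quotient_imp_in_rel[OF E2 \<Gamma>2[unfolded frac_hom2_def]] r r' by blast
    show "Pronk_data C cc dd (A2, w2, f2) r1' r2' \<in> weak_F4_data r1' r2'"
      using Pronk_data_weak[OF cc dd] r'
        in_quotient_imp_subset[OF E1 \<Gamma>1[unfolded frac_hom2_def]]
        in_quotient_imp_subset[OF E2 \<Gamma>2[unfolded frac_hom2_def]] by blast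
  qed (rule d)
  with r show ?thesis
    unfolding frac_vcomp_def by auto
qed

end

theorem proposition5p1:
  fixes C :: "('o, 'a, 'c) bicat" (structure)
    and W :: "'a set"
    and cc :: "'a \<Rightarrow> 'a \<Rightarrow> 'o \<times> 'a \<times> 'a \<times> 'c"
    and dd :: "'a \<Rightarrow> 'a \<Rightarrow> 'a \<Rightarrow> 'c \<Rightarrow> 'o \<times> 'a \<times> 'c"
  assumes "BF_bicategory C W"
    and "C_choice C W cc" and "D_choice C W dd"
    and "A \<in> Obj C" and "B \<in> Obj C"
    and "(A1, w1, f1) \<in> frac_hom C W A B"
    and "(A2, w2, f2) \<in> frac_hom C W A B"
    and "(A3, w3, f3) \<in> frac_hom C W A B"
    and "\<Gamma>1 \<in> frac_hom2 C W (A1, w1, f1) (A2, w2, f2)"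
    and "\<Gamma>2 \<in> frac_hom2 C W (A2, w2, f2) (A3, w3, f3)"
    and "(A4, u1, u2, \<alpha>1, \<beta>1) \<in> \<Gamma>1"
    and "(A5, u3, u4, \<alpha>2, \<beta>2) \<in> \<Gamma>2"
    and "t1 \<in> hom C X A4 \<inter> W" and "t2 \<in> hom C X A5"
    and "\<rho> \<in> iso2 C (u2 \<cdot> t1) (u3 \<cdot> t2)"
  shows "frac_vcomp C W cc dd (A1, w1, f1) (A2, w2, f2) (A3, w3, f3) \<Gamma>2 \<Gamma>1
           \<in> frac_hom2 C W (A1, w1, f1) (A3, w3, f3) \<and>
         (X, u1 \<cdot> t1, u4 \<cdot> t2,
          whisk_reassoc C (w2, u3) (w3, u4) \<alpha>2 t2 \<bullet> (w2 \<rhd> \<rho>)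
            \<bullet> whisk_reassoc C (w1, u1) (w2, u2) \<alpha>1 t1,
          whisk_reassoc C (f2, u3) (f3, u4) \<beta>2 t2 \<bullet> (f2 \<rhd> \<rho>)
            \<bullet> whisk_reassoc C (f1, u1) (f2, u2) \<beta>1 t1)
           \<in> frac_vcomp C W cc dd (A1, w1, f1) (A2, w2, f2) (A3, w3, f3) \<Gamma>2 \<Gamma>1 \<and>
         (\<forall>r1 \<in> \<Gamma>1. \<forall>r2 \<in> \<Gamma>2. \<forall>d \<in> F4_data C W r1 r2.
           frac_paste C (A1, w1, f1) (A2, w2, f2) (A3, w3, f3) r1 r2 d
             \<in> frac_vcomp C W cc dd (A1, w1, f1) (A2, w2, f2) (A3, w3, f3) \<Gamma>2 \<Gamma>1)"
proof -
  interpret three_fractions C W A B A1 A2 A3 w1 w2 w3 f1 f2 f3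
    by (intro three_fractions.intro three_fractions_axioms.intro assms)
  let ?V = "frac_vcomp C W cc dd (A1, w1, f1) (A2, w2, f2) (A3, w3, f3) \<Gamma>2 \<Gamma>1"
  let ?r1 = "(A4, u1, u2, \<alpha>1, \<beta>1)" and ?r2 = "(A5, u3, u4, \<alpha>2, \<beta>2)" and ?d = "(X, t1, t2, \<rho>)"
  note sub1 = in_quotient_imp_subset[OF equiv_frac_rel[OF F1 F2] assms(9)[unfolded frac_hom2_def]]
    and sub2 = in_quotient_imp_subset[OF equiv_frac_rel[OF F2 F3] assms(10)[unfolded frac_hom2_def]]
  have V: "?V = Rel13 `` {Paste r1 r2 d}" "Paste r1 r2 d \<in> ?V" "?V \<in> frac_hom2 C W (A1, w1, f1) (A3, w3, f3)"
    if r: "r1 \<in> \<Gamma>1" "r2 \<in> \<Gamma>2" and d: "d \<in> F4_data C W r1 r2" for r1 r2 d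
  proof -
    have rep: "r1 \<in> Rep1" "r2 \<in> Rep2"
      using r sub1 sub2 by auto
    note weak = F4_data_weak[OF rep d]
    show V: "?V = Rel13 `` {Paste r1 r2 d}"
      by (rule frac_vcomp_eq_class[OF assms(2,3,9,10) r weak])
    note P = Paste_frac_rep[OF rep weak]
    show "Paste r1 r2 d \<in> ?V"
      unfolding V by (rule equiv_class_self[OF equiv_frac_rel[OF F1 F3] P])
    show "?V \<in> frac_hom2 C W (A1, w1, f1) (A3, w3, f3)"
      unfolding V frac_hom2_def by (rule quotientI[OF P])
  qed
  \<comment> \<open>That the composite is a 2-morphism mentions no data, but \<open>V\<close>
    derives it from some pair of representatives with data; the given ones serve.\<close>
  have "?d \<in> F4_data C W ?r1 ?r2"
    using assms(13-15) by simp
  with assms(11,12) have "?V \<in> frac_hom2 C W (A1, w1, f1) (A3, w3, f3)" "Paste ?r1 ?r2 ?d \<in> ?V"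
    using V by blast+
  then show ?thesis
    using V(2) by (simp only: frac_paste.simps simp_thms) blast
qed

end
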